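(* Let $T$ be a theory. The 2-category $\mathcal{C}$ of small pseudo $T$-algebras admits cotensor products: for every small category $J$ and every small pseudo $T$-algebra $F$ there exists a cotensor product $\{J,F\}$ of $J$ and $F$ in $\mathcal{C}$.
   Context: Cotensor products. For a 2-category $\mathcal{C}$, a small category $J$ and an object $F$ of $\mathcal{C}$, an object $\{J,F\}$ of $\mathcal{C}$ is a cotensor product of $J$ and $F$ if the strict 2-functors $\mathcal{C}^{op}\to Cat$, $C\mapsto\mathcal{C}(C,\{J,F\})$ and $C\mapsto Cat(J,\mathcal{C}(C,F))$, are 2-naturally isomorphic. Theories. A theory $T$ is a category with objects $0,1,2,\dots$ in which $n$ is the product of $n$ copies of $1$, with chosen projections $pr_i:n\to 1$. Put $T(n)=Mor_T(n,1)$ (words of arity $n$). For a function $f:\{1,\dots,k\}\to\{1,\dots,\ell\}$ let $f':\ell\to k$ be the morphism with $pr_i f'=pr_{f(i)}$, and for $w\in T(k)$ put $w_f=w\circ f'\in T(\ell)$. For $w\in T(k)$, $w_i\in T(n_i)$ put $\gamma(w,w_1,\dots,w_k)=w\circ(w_1,\dots,w_k)\in T(n_1+\dots+n_k)$, where $(w_1,\dots,w_k):n_1+\dots+n_k\to k$ has $i$-th component $(w_i)_{\iota_i}$, $\iota_i$ being the inclusion onto the $i$-th block. The unit $1\in T(1)$ is the projection $pr_1:1\to1$. For a category $X$, $End(X)$ is the theory with $End(X)(n)=Functors(X^n,X)$; there $\gamma(F,F_1,\dots,F_k)=F\circ(F_1\times\dots\times F_k)$, $F_f(x_1,\dots,x_\ell)=F(x_{f1},\dots,x_{fk})$,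 and the unit is $1_X$; these operations also apply to natural transformations. Pseudo $T$-algebras. A pseudo $T$-algebra is a category $X$ with functions $\Phi:T(n)\to Functors(X^n,X)$ for all $n\ge 0$ and natural isomorphisms $c_{w,w_1,\dots,w_k}:\Phi(\gamma(w,w_1,\dots,w_k))\Rightarrow\gamma(\Phi(w),\Phi(w_1),\dots,\Phi(w_k))$, $I:\Phi(1)\Rightarrow 1_X$, $s_{w,f}:\Phi(w_f)\Rightarrow\Phi(w)_f$, such that (vertical composition written $\circ$, $i$ = identity 2-cell): (1) $\gamma(c_{w,w_1,\dots,w_k},i,\dots,i)\circ c_{\gamma(w,w_1,\dots,w_k),w_{11},\dots,w_{kn_k}}=\gamma(i_{\Phi(w)},c_{w_1,w_{11},\dots,w_{1n_1}},\dots,c_{w_k,w_{k1},\dots,w_{kn_k}})\circ c_{w,\gamma(w_1,w_{11},\dots),\dots,\gamma(w_k,w_{k1},\dots)}$; (2) $\gamma(i_{\Phi(w)},I,\dots,I)\circ c_{w,1,\dots,1}=i$; (3) $\gamma(I,i_{\Phi(w)})\circ c_{1,w}=i$; (4) for $f:\{1,\dots,k\}\to\{1,\dots,\ell\}$, $w\in T(k)$, $w_j\in T(n_j)$ ($1\le j\le\ell$), with $\bar f:\{1,\dots,n_{f1}+\dots+n_{fk}\}\to\{1,\dots,n_1+\dots+n_\ell\}$ carrying the $i$-th block identically onto the $f(i)$-th block: $(c_{w,w_{f1},\dots,w_{fk}})_{\bar f}\circ s_{\gamma(w,w_{f1},\dots,w_{fk}),\bar f}=\gamma(s_{w,f},i,\dots,i)\circ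 c_{w_f,w_1,\dots,w_\ell}$; (5) for functions $g_i:\{1,\dots,n_i\}\to\{1,\dots,n_i'\}$ with block sum $g=g_1+\dots+g_k$: $(c_{w,w_1,\dots,w_k})_g\circ s_{\gamma(w,w_1,\dots,w_k),g}=\gamma(i_{\Phi(w)},s_{w_1,g_1},\dots,s_{w_k,g_k})\circ c_{w,(w_1)_{g_1},\dots,(w_k)_{g_k}}$; (6) $(s_{w,f})_g\circ s_{w_f,g}=s_{w,g\circ f}$; (7) $s_{w,id}$ is the identity. A morphism $H:(X,\Phi)\to(Y,\Psi)$ of pseudo $T$-algebras is a functor with natural isomorphisms $\rho_w:H\circ\Phi(w)\Rightarrow\Psi(w)\circ(H,\dots,H)$ for all words $w$ such that $(c*i)\circ\rho_{\gamma(w,w_1,\dots,w_k)}=(i_{\Psi(w)}*(\rho_{w_1},\dots,\rho_{w_k}))\circ(\rho_w*i)\circ(i_H*c)$, $(I*i_H)\circ\rho_1=i_H*I$, and $(s_{w,f}*i)\circ\rho_{w_f}=(\rho_w)_f\circ(i_H*s_{w,f})$. Composites have $\rho^{HG}_w=(\rho^H_w*i)\circ(i_H*\rho^G_w)$. A 2-cell $\alpha:G\Rightarrow H$ is a natural transformation with $\rho^H_w\circ(\alpha*i_{\Phi(w)})=(i_{\Psi(w)}*(\alpha,\dots,\alpha))\circ\rho^G_w$ for all $w$. *)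

theory Defs
  imports "HOL-Library.FuncSet" "HOL-Library.Nat_Bijection"
begin

section \<open>Universes\<close>

text \<open>
  The type of a universe of sets, \<open>elts x\<close> being the set of elements of \<open>x\<close>.  A collection of
  type \<open>'u set\<close> is small if it is itself an element of the universe.  These are the closure
  conditions of the class of all sets of ZFC, or of a Grothendieck universe; the axioms of
  infinity and foundation are not needed and are left out.
\<close>

definition small :: "('u \<Rightarrow> 'u set) \<Rightarrow> 'u set \<Rightarrow> bool" where
  "small elts S \<longleftrightarrow> S \<in> range elts"

locale universe =
  fixes elts :: "'u \<Rightarrow> 'u set"
  assumes extensionality: "elts x = elts y \<Longrightarrow> x = y"
    and separation: "small elts S \<Longrightarrow> R \<subseteq> S \<Longrightarrow> small elts R"
    and pairing: "small elts {x, y}"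
    and union: "small elts S \<Longrightarrow> small elts (\<Union>x\<in>S. elts x)"
    and powerset: "small elts S \<Longrightarrow> small elts {x. elts x \<subseteq> S}"
    and replacement: "small elts S \<Longrightarrow> small elts (h ` S)"

text \<open>The axioms are satisfiable in HOL itself: the hereditarily finite sets.\<close>

lemma universe_hereditarily_finite: "universe set_decode"
proof -
  have small_iff: "small set_decode S \<longleftrightarrow> finite S" for S
    unfolding small_def by (metis finite_set_decode rangeE rangeI set_encode_inverse)
  have "finite {x. set_decode x \<subseteq> S}" if "finite S" for S
  proof (rule inj_on_finite[of set_decode _ "Pow S"])
    show "inj_on set_decode {x. set_decode x \<subseteq> S}"
      by (metis inj_onI set_decode_inverse)
  qed (use that in auto)
  then show ?thesis
    by unfold_locales
      (auto simp: small_iff intro: finite_subset dest: arg_cong[of _ _ set_encode])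
qed


section \<open>Categories, functors and natural transformations\<close>

record ('o, 'a) cat =
  Obj :: "'o set"
  Arr :: "'a set"
  Dom :: "'a \<Rightarrow> 'o"
  Cod :: "'a \<Rightarrow> 'o"
  Idn :: "'o \<Rightarrow> 'a"
  Comp :: "'a \<Rightarrow> 'a \<Rightarrow> 'a"  \<comment> \<open>\<open>Comp C g f\<close> is \<open>g\<close> after \<open>f\<close>\<close>

definition hom :: "('o, 'a, 'z) cat_scheme \<Rightarrow> 'o \<Rightarrow> 'o \<Rightarrow> 'a set" where
  "hom C x y = {f \<in> Arr C. Dom C f = x \<and> Cod C f = y}"

locale category =
  fixes C :: "('o, 'a, 'z) cat_scheme"
  assumes Dom_Obj: "f \<in> Arr C \<Longrightarrow> Dom C f \<in> Obj C"
    and Cod_Obj: "f \<in> Arr C \<Longrightarrow> Cod C f \<in> Obj C"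
    and Idn_hom: "x \<in> Obj C \<Longrightarrow> Idn C x \<in> hom C x x"
    and Comp_hom: "f \<in> hom C x y \<Longrightarrow> g \<in> hom C y z \<Longrightarrow> Comp C g f \<in> hom C x z"
    and Comp_Idn_left: "f \<in> hom C x y \<Longrightarrow> Comp C (Idn C y) f = f"
    and Comp_Idn_right: "f \<in> hom C x y \<Longrightarrow> Comp C f (Idn C x) = f"
    and Comp_assoc: "f \<in> hom C w x \<Longrightarrow> g \<in> hom C x y \<Longrightarrow> h \<in> hom C y z \<Longrightarrow>
      Comp C h (Comp C g f) = Comp C (Comp C h g) f"

definition small_category :: "('u \<Rightarrow> 'u set) \<Rightarrow> ('u, 'u) cat \<Rightarrow> bool" where
  "small_category elts C \<longleftrightarrow> category C \<and> small elts (Obj C) \<and> small elts (Arr C)"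

definition iso :: "('o, 'a, 'z) cat_scheme \<Rightarrow> 'a \<Rightarrow> bool" where
  "iso C f \<longleftrightarrow> f \<in> Arr C \<and> (\<exists>g \<in> hom C (Cod C f) (Dom C f).
     Comp C g f = Idn C (Dom C f) \<and> Comp C f g = Idn C (Cod C f))"

text \<open>
  Functors and natural transformations are extensional, that is, \<open>undefined\<close> outside their domain
  of definition, so that HOL equality of these records is equality of functors and of
  transformations.
\<close>

record ('o, 'a, 'p, 'b) ftr =
  on_ob :: "'o \<Rightarrow> 'p"
  on_ar :: "'a \<Rightarrow> 'b"

record ('o, 'a, 'p, 'b) ntr =
  src :: "('o, 'a, 'p, 'b) ftr"
  tgt :: "('o, 'a, 'p, 'b) ftr"
  cmp :: "'o \<Rightarrow> 'b"

definition is_functor :: "('o, 'a) cat \<Rightarrow> ('p, 'b) cat \<Rightarrow> ('o, 'a, 'p, 'b) ftr \<Rightarrow> bool" where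
  "is_functor A B F \<longleftrightarrow> category A \<and> category B \<and>
     on_ob F \<in> Obj A \<rightarrow>\<^sub>E Obj B \<and> on_ar F \<in> Arr A \<rightarrow>\<^sub>E Arr B \<and>
     (\<forall>f \<in> Arr A. Dom B (on_ar F f) = on_ob F (Dom A f) \<and> Cod B (on_ar F f) = on_ob F (Cod A f)) \<and>
     (\<forall>x \<in> Obj A. on_ar F (Idn A x) = Idn B (on_ob F x)) \<and>
     (\<forall>x y z. \<forall>f \<in> hom A x y. \<forall>g \<in> hom A y z.
        on_ar F (Comp A g f) = Comp B (on_ar F g) (on_ar F f))"

definition is_natural :: "('o, 'a) cat \<Rightarrow> ('p, 'b) cat \<Rightarrow> ('o, 'a, 'p, 'b) ntr \<Rightarrow> bool" where
  "is_natural A B \<tau> \<longleftrightarrow> is_functor A B (src \<tau>) \<and> is_functor A B (tgt \<tau>) \<and>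
     cmp \<tau> \<in> extensional (Obj A) \<and>
     (\<forall>x \<in> Obj A. cmp \<tau> x \<in> hom B (on_ob (src \<tau>) x) (on_ob (tgt \<tau>) x)) \<and>
     (\<forall>x y. \<forall>f \<in> hom A x y.
        Comp B (cmp \<tau> y) (on_ar (src \<tau>) f) = Comp B (on_ar (tgt \<tau>) f) (cmp \<tau> x))"

definition natural_iso :: "('o, 'a) cat \<Rightarrow> ('p, 'b) cat \<Rightarrow>
    ('o, 'a, 'p, 'b) ftr \<Rightarrow> ('o, 'a, 'p, 'b) ftr \<Rightarrow> ('o, 'a, 'p, 'b) ntr \<Rightarrow> bool" where
  "natural_iso A B F G \<tau> \<longleftrightarrow> is_natural A B \<tau> \<and> src \<tau> = F \<and> tgt \<tau> = G \<and>
     (\<forall>x \<in> Obj A. iso B (cmp \<tau> x))"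

text \<open>
  In the following operations \<open>A\<close> is the common domain of the functors involved; it serves to make
  the result extensional.
\<close>

definition fid :: "('o, 'a) cat \<Rightarrow> ('o, 'a, 'o, 'a) ftr" where
  "fid A = \<lparr>on_ob = (\<lambda>x\<in>Obj A. x), on_ar = (\<lambda>f\<in>Arr A. f)\<rparr>"

definition fcomp :: "('o, 'a) cat \<Rightarrow> ('p, 'b, 'q, 'c) ftr \<Rightarrow> ('o, 'a, 'p, 'b) ftr \<Rightarrow>
    ('o, 'a, 'q, 'c) ftr" where
  "fcomp A G F = \<lparr>on_ob = (\<lambda>x\<in>Obj A. on_ob G (on_ob F x)),
                  on_ar = (\<lambda>f\<in>Arr A. on_ar G (on_ar F f))\<rparr>"

definition nid :: "('o, 'a) cat \<Rightarrow> ('p, 'b) cat \<Rightarrow> ('o, 'a, 'p, 'b) ftr \<Rightarrow> ('o, 'a, 'p, 'b) ntr" where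
  "nid A B F = \<lparr>src = F, tgt = F, cmp = (\<lambda>x\<in>Obj A. Idn B (on_ob F x))\<rparr>"

text \<open>Vertical composite \<open>\<sigma> \<circ> \<tau>\<close>, for functors from \<open>A\<close> to \<open>B\<close>.\<close>

definition vcomp :: "('o, 'a) cat \<Rightarrow> ('p, 'b) cat \<Rightarrow> ('o, 'a, 'p, 'b) ntr \<Rightarrow>
    ('o, 'a, 'p, 'b) ntr \<Rightarrow> ('o, 'a, 'p, 'b) ntr" where
  "vcomp A B \<sigma> \<tau> = \<lparr>src = src \<tau>, tgt = tgt \<sigma>, cmp = (\<lambda>x\<in>Obj A. Comp B (cmp \<sigma> x) (cmp \<tau> x))\<rparr>"

text \<open>
  Horizontal composite \<open>\<sigma> * \<tau>\<close>, where \<open>\<tau>\<close> is between functors from \<open>A\<close> to some \<open>B\<close> and \<open>\<sigma>\<close> is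
  between functors from \<open>B\<close> to \<open>D\<close>.
\<close>

definition hcomp :: "('o, 'a) cat \<Rightarrow> ('q, 'c) cat \<Rightarrow> ('p, 'b, 'q, 'c) ntr \<Rightarrow>
    ('o, 'a, 'p, 'b) ntr \<Rightarrow> ('o, 'a, 'q, 'c) ntr" where
  "hcomp A D \<sigma> \<tau> = \<lparr>src = fcomp A (src \<sigma>) (src \<tau>), tgt = fcomp A (tgt \<sigma>) (tgt \<tau>),
     cmp = (\<lambda>x\<in>Obj A. Comp D (cmp \<sigma> (on_ob (tgt \<tau>) x)) (on_ar (src \<sigma>) (cmp \<tau> x)))\<rparr>"

text \<open>The category of functors from \<open>A\<close> to \<open>B\<close>, written \<open>Cat(A,B)\<close>.\<close>

definition fun_cat :: "('o, 'a) cat \<Rightarrow> ('p, 'b) cat \<Rightarrow>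
    (('o, 'a, 'p, 'b) ftr, ('o, 'a, 'p, 'b) ntr) cat" where
  "fun_cat A B = \<lparr>Obj = {F. is_functor A B F}, Arr = {\<tau>. is_natural A B \<tau>},
     Dom = src, Cod = tgt, Idn = nid A B, Comp = vcomp A B\<rparr>"

definition iso_of_categories :: "('o, 'a) cat \<Rightarrow> ('p, 'b) cat \<Rightarrow> ('o, 'a, 'p, 'b) ftr \<Rightarrow> bool" where
  "iso_of_categories A B F \<longleftrightarrow> is_functor A B F \<and>
     (\<exists>G. is_functor B A G \<and> fcomp A G F = fid A \<and> fcomp B F G = fid B)"


section \<open>2-categories and cotensor products\<close>

text \<open>
  \<open>HomCat C A B\<close> is the category of 1-cells and 2-cells from \<open>A\<close> to \<open>B\<close>.  For 1-cells (2-cells)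
  \<open>f\<close> from \<open>A\<close> to \<open>B\<close> and \<open>g\<close> from \<open>B\<close> to \<open>D\<close>, \<open>Comp1 C A B D g f\<close> (\<open>Comp2 C A B D g f\<close>) is
  their horizontal composite.
\<close>

record ('o, 'h, 'k) two_cat =
  Ob :: "'o set"
  HomCat :: "'o \<Rightarrow> 'o \<Rightarrow> ('h, 'k) cat"
  Unit1 :: "'o \<Rightarrow> 'h"
  Comp1 :: "'o \<Rightarrow> 'o \<Rightarrow> 'o \<Rightarrow> 'h \<Rightarrow> 'h \<Rightarrow> 'h"
  Comp2 :: "'o \<Rightarrow> 'o \<Rightarrow> 'o \<Rightarrow> 'k \<Rightarrow> 'k \<Rightarrow> 'k"

locale two_category =
  fixes C :: "('o, 'h, 'k) two_cat"
  assumes HomCat: "A \<in> Ob C \<Longrightarrow> B \<in> Ob C \<Longrightarrow> category (HomCat C A B)"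
    and Unit1: "A \<in> Ob C \<Longrightarrow> Unit1 C A \<in> Obj (HomCat C A A)"
    and Comp1: "\<lbrakk>A \<in> Ob C; B \<in> Ob C; D \<in> Ob C;
        f \<in> Obj (HomCat C A B); g \<in> Obj (HomCat C B D)\<rbrakk> \<Longrightarrow>
      Comp1 C A B D g f \<in> Obj (HomCat C A D)"
    and Comp2: "\<lbrakk>A \<in> Ob C; B \<in> Ob C; D \<in> Ob C;
        \<alpha> \<in> hom (HomCat C A B) f f'; \<beta> \<in> hom (HomCat C B D) g g'\<rbrakk> \<Longrightarrow>
      Comp2 C A B D \<beta> \<alpha> \<in> hom (HomCat C A D) (Comp1 C A B D g f) (Comp1 C A B D g' f')"
    and Comp2_Idn: "\<lbrakk>A \<in> Ob C; B \<in> Ob C; D \<in> Ob C;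
        f \<in> Obj (HomCat C A B); g \<in> Obj (HomCat C B D)\<rbrakk> \<Longrightarrow>
      Comp2 C A B D (Idn (HomCat C B D) g) (Idn (HomCat C A B) f) =
        Idn (HomCat C A D) (Comp1 C A B D g f)"
    and interchange: "\<lbrakk>A \<in> Ob C; B \<in> Ob C; D \<in> Ob C;
        \<alpha> \<in> hom (HomCat C A B) f f'; \<alpha>' \<in> hom (HomCat C A B) f' f'';
        \<beta> \<in> hom (HomCat C B D) g g'; \<beta>' \<in> hom (HomCat C B D) g' g''\<rbrakk> \<Longrightarrow>
      Comp2 C A B D (Comp (HomCat C B D) \<beta>' \<beta>) (Comp (HomCat C A B) \<alpha>' \<alpha>) =
        Comp (HomCat C A D) (Comp2 C A B D \<beta>' \<alpha>') (Comp2 C A B D \<beta> \<alpha>)"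
    and Comp1_assoc: "\<lbrakk>A \<in> Ob C; B \<in> Ob C; D \<in> Ob C; E \<in> Ob C; f \<in> Obj (HomCat C A B);
        g \<in> Obj (HomCat C B D); h \<in> Obj (HomCat C D E)\<rbrakk> \<Longrightarrow>
      Comp1 C A D E h (Comp1 C A B D g f) = Comp1 C A B E (Comp1 C B D E h g) f"
    and Comp2_assoc: "\<lbrakk>A \<in> Ob C; B \<in> Ob C; D \<in> Ob C; E \<in> Ob C; \<alpha> \<in> Arr (HomCat C A B);
        \<beta> \<in> Arr (HomCat C B D); \<gamma> \<in> Arr (HomCat C D E)\<rbrakk> \<Longrightarrow>
      Comp2 C A D E \<gamma> (Comp2 C A B D \<beta> \<alpha>) = Comp2 C A B E (Comp2 C B D E \<gamma> \<beta>) \<alpha>"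
    and Comp1_Unit_left: "\<lbrakk>A \<in> Ob C; B \<in> Ob C; f \<in> Obj (HomCat C A B)\<rbrakk> \<Longrightarrow>
      Comp1 C A B B (Unit1 C B) f = f"
    and Comp1_Unit_right: "\<lbrakk>A \<in> Ob C; B \<in> Ob C; f \<in> Obj (HomCat C A B)\<rbrakk> \<Longrightarrow>
      Comp1 C A A B f (Unit1 C A) = f"
    and Comp2_Unit_left: "\<lbrakk>A \<in> Ob C; B \<in> Ob C; \<alpha> \<in> Arr (HomCat C A B)\<rbrakk> \<Longrightarrow>
      Comp2 C A B B (Idn (HomCat C B B) (Unit1 C B)) \<alpha> = \<alpha>"
    and Comp2_Unit_right: "\<lbrakk>A \<in> Ob C; B \<in> Ob C; \<alpha> \<in> Arr (HomCat C A B)\<rbrakk> \<Longrightarrow>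
      Comp2 C A A B \<alpha> (Idn (HomCat C A A) (Unit1 C A)) = \<alpha>"

text \<open>
  The data of a strict 2-functor from \<open>C\<^sup>o\<^sup>p\<close> (1-cells reversed, 2-cells not) to \<open>Cat\<close>: the
  category at each object, and for 1-cells \<open>h, h' : A \<rightarrow> B\<close> and a 2-cell \<open>\<alpha> : h \<Rightarrow> h'\<close> a functor
  \<open>on1 A B h\<close> from \<open>val B\<close> to \<open>val A\<close> and a transformation \<open>on2 A B \<alpha>\<close> from \<open>on1 A B h\<close> to
  \<open>on1 A B h'\<close>.
\<close>

record ('o, 'h, 'k, 'x, 'y) cat_presheaf =
  val :: "'o \<Rightarrow> ('x, 'y) cat"
  on1 :: "'o \<Rightarrow> 'o \<Rightarrow> 'h \<Rightarrow> ('x, 'y, 'x, 'y) ftr"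
  on2 :: "'o \<Rightarrow> 'o \<Rightarrow> 'k \<Rightarrow> ('x, 'y, 'x, 'y) ntr"

text \<open>The representable 2-functor sending an object \<open>A\<close> to \<open>C(A,P)\<close>.\<close>

definition repr_fun :: "('o, 'h, 'k) two_cat \<Rightarrow> 'o \<Rightarrow> 'o \<Rightarrow> 'o \<Rightarrow> 'h \<Rightarrow> ('h, 'k, 'h, 'k) ftr" where
  "repr_fun C P A B h =
     \<lparr>on_ob = (\<lambda>g\<in>Obj (HomCat C B P). Comp1 C A B P g h),
      on_ar = (\<lambda>\<beta>\<in>Arr (HomCat C B P). Comp2 C A B P \<beta> (Idn (HomCat C A B) h))\<rparr>"

definition repr :: "('o, 'h, 'k) two_cat \<Rightarrow> 'o \<Rightarrow> ('o, 'h, 'k, 'h, 'k) cat_presheaf" where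
  "repr C P =
     \<lparr>val = (\<lambda>A. HomCat C A P),
      on1 = repr_fun C P,
      on2 = (\<lambda>A B \<alpha>.
        \<lparr>src = repr_fun C P A B (Dom (HomCat C A B) \<alpha>),
         tgt = repr_fun C P A B (Cod (HomCat C A B) \<alpha>),
         cmp = (\<lambda>g\<in>Obj (HomCat C B P). Comp2 C A B P (Idn (HomCat C B P) g) \<alpha>)\<rparr>)\<rparr>"

text \<open>The 2-functor sending an object \<open>A\<close> to \<open>Cat(J, \<Theta> A)\<close>.\<close>

definition power_fun :: "('j, 'i) cat \<Rightarrow> ('x, 'y) cat \<Rightarrow> ('x, 'y) cat \<Rightarrow> ('x, 'y, 'x, 'y) ftr \<Rightarrow>
    (('j, 'i, 'x, 'y) ftr, ('j, 'i, 'x, 'y) ntr, ('j, 'i, 'x, 'y) ftr, ('j, 'i, 'x, 'y) ntr) ftr" where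
  "power_fun J X Y R =
     \<lparr>on_ob = (\<lambda>K\<in>Obj (fun_cat J X). fcomp J R K),
      on_ar = (\<lambda>\<tau>\<in>Arr (fun_cat J X). hcomp J Y (nid X Y R) \<tau>)\<rparr>"

definition power :: "('j, 'i) cat \<Rightarrow> ('o, 'h, 'k, 'x, 'y) cat_presheaf \<Rightarrow>
    ('o, 'h, 'k, ('j, 'i, 'x, 'y) ftr, ('j, 'i, 'x, 'y) ntr) cat_presheaf" where
  "power J \<Theta> =
     \<lparr>val = (\<lambda>A. fun_cat J (val \<Theta> A)),
      on1 = (\<lambda>A B h. power_fun J (val \<Theta> B) (val \<Theta> A) (on1 \<Theta> A B h)),
      on2 = (\<lambda>A B \<alpha>.
        \<lparr>src = power_fun J (val \<Theta> B) (val \<Theta> A) (src (on2 \<Theta> A B \<alpha>)),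
         tgt = power_fun J (val \<Theta> B) (val \<Theta> A) (tgt (on2 \<Theta> A B \<alpha>)),
         cmp = (\<lambda>K\<in>Obj (fun_cat J (val \<Theta> B)).
           hcomp J (val \<Theta> A) (on2 \<Theta> A B \<alpha>) (nid J (val \<Theta> B) K))\<rparr>)\<rparr>"

definition two_natural_iso :: "('o, 'h, 'k) two_cat \<Rightarrow> ('o, 'h, 'k, 'x, 'y) cat_presheaf \<Rightarrow>
    ('o, 'h, 'k, 'p, 'q) cat_presheaf \<Rightarrow> ('o \<Rightarrow> ('x, 'y, 'p, 'q) ftr) \<Rightarrow> bool" where
  "two_natural_iso C \<Theta> \<Xi> \<eta> \<longleftrightarrow>
     (\<forall>A \<in> Ob C. iso_of_categories (val \<Theta> A) (val \<Xi> A) (\<eta> A)) \<and>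
     (\<forall>A \<in> Ob C. \<forall>B \<in> Ob C. \<forall>h \<in> Obj (HomCat C A B).
        fcomp (val \<Theta> B) (\<eta> A) (on1 \<Theta> A B h) = fcomp (val \<Theta> B) (on1 \<Xi> A B h) (\<eta> B)) \<and>
     (\<forall>A \<in> Ob C. \<forall>B \<in> Ob C. \<forall>\<alpha> \<in> Arr (HomCat C A B).
        hcomp (val \<Theta> B) (val \<Xi> A) (nid (val \<Theta> A) (val \<Xi> A) (\<eta> A)) (on2 \<Theta> A B \<alpha>) =
        hcomp (val \<Theta> B) (val \<Xi> A) (on2 \<Xi> A B \<alpha>) (nid (val \<Theta> B) (val \<Xi> B) (\<eta> B)))"

text \<open>
  For a 2-category \<open>C\<close> the data \<open>repr C P\<close> and \<open>power J (repr C F)\<close> satisfy the laws of strict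
  2-functors by the axioms of \<open>C\<close>, so only \<open>two_category C\<close> is required here.
\<close>

definition is_cotensor :: "('o, 'h, 'k) two_cat \<Rightarrow> ('j, 'i) cat \<Rightarrow> 'o \<Rightarrow> 'o \<Rightarrow> bool" where
  "is_cotensor C J F P \<longleftrightarrow> two_category C \<and> category J \<and> F \<in> Ob C \<and> P \<in> Ob C \<and>
     (\<exists>\<eta>. two_natural_iso C (repr C P) (power J (repr C F)) \<eta>)"


section \<open>Theories\<close>

text \<open>
  Indices start at \<open>0\<close>.  A function from a \<open>k\<close>-element to an \<open>l\<close>-element index set is encoded as the
  list of its \<open>k\<close> values; \<open>l\<close> is supplied separately where it matters.
\<close>

definition index_map :: "nat \<Rightarrow> nat \<Rightarrow> nat list \<Rightarrow> bool" where
  "index_map k l f \<longleftrightarrow> length f = k \<and> set f \<subseteq> {..<l}"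

definition reindex :: "nat list \<Rightarrow> 'x list \<Rightarrow> 'x list" where
  "reindex f xs = map (\<lambda>i. xs ! i) f"

text \<open>Inclusion of the \<open>i\<close>-th block of \<open>n\<^sub>0 + \<dots> + n\<^sub>k\<^sub>-\<^sub>1\<close>, where \<open>ns = [n\<^sub>0, \<dots>, n\<^sub>k\<^sub>-\<^sub>1]\<close>.\<close>

definition block :: "nat list \<Rightarrow> nat \<Rightarrow> nat list" where
  "block ns i = [sum_list (take i ns) ..< sum_list (take (Suc i) ns)]"

text \<open>The map carrying the \<open>i\<close>-th block identically onto the \<open>f(i)\<close>-th block of \<open>sum_list ns\<close>.\<close>

definition block_map :: "nat list \<Rightarrow> nat list \<Rightarrow> nat list" where
  "block_map ns f = concat (map (block ns) f)"

text \<open>The block sum of maps \<open>gs ! i\<close> into \<open>ms ! i\<close>-element sets.\<close>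

definition block_sum :: "nat list \<Rightarrow> nat list list \<Rightarrow> nat list" where
  "block_sum ms gs = concat (map (\<lambda>i. reindex (gs ! i) (block ms i)) [0..<length gs])"

record 't lawvere = "(nat, 't) cat" +
  pr :: "nat \<Rightarrow> nat \<Rightarrow> 't"  \<comment> \<open>\<open>pr T n i\<close> is the \<open>i\<close>-th projection, \<open>i < n\<close>\<close>

definition is_tuple :: "'t lawvere \<Rightarrow> nat \<Rightarrow> 't list \<Rightarrow> 't \<Rightarrow> bool" where
  "is_tuple T m us h \<longleftrightarrow> h \<in> hom T m (length us) \<and>
     (\<forall>i < length us. Comp T (pr T (length us) i) h = us ! i)"

locale lawvere_theory = category T for T :: "'t lawvere" +
  assumes Obj_eq: "Obj T = UNIV"
    and pr_hom: "i < n \<Longrightarrow> pr T n i \<in> hom T n 1"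
    and product: "set us \<subseteq> hom T m 1 \<Longrightarrow> \<exists>!h. is_tuple T m us h"

definition tuple :: "'t lawvere \<Rightarrow> nat \<Rightarrow> 't list \<Rightarrow> 't" where
  "tuple T m us = (THE h. is_tuple T m us h)"

definition words :: "'t lawvere \<Rightarrow> 't set" where
  "words T = {w \<in> Arr T. Cod T w = 1}"

abbreviation arity :: "'t lawvere \<Rightarrow> 't \<Rightarrow> nat" where
  "arity \<equiv> Dom"

definition unit_word :: "'t lawvere \<Rightarrow> 't" where
  "unit_word T = pr T 1 0"

text \<open>The word \<open>w\<^sub>f\<close>, for \<open>f\<close> with values in an \<open>l\<close>-element set.\<close>

definition wsub :: "'t lawvere \<Rightarrow> nat \<Rightarrow> nat list \<Rightarrow> 't \<Rightarrow> 't" where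
  "wsub T l f w = Comp T w (tuple T l (map (pr T l) f))"

definition wgamma :: "'t lawvere \<Rightarrow> 't \<Rightarrow> 't list \<Rightarrow> 't" where
  "wgamma T w ws = (let ns = map (arity T) ws; N = sum_list ns in
     Comp T w (tuple T N (map (\<lambda>i. wsub T N (block ns i) (ws ! i)) [0..<length ws])))"

definition composable :: "'t lawvere \<Rightarrow> 't \<Rightarrow> 't list \<Rightarrow> bool" where
  "composable T w ws \<longleftrightarrow> w \<in> words T \<and> set ws \<subseteq> words T \<and> length ws = arity T w"


section \<open>The endomorphism theory of a category\<close>

definition pow :: "nat \<Rightarrow> ('o, 'a) cat \<Rightarrow> ('o list, 'a list) cat" where
  "pow n X = \<lparr>Obj = {xs. length xs = n \<and> set xs \<subseteq> Obj X}, Arr = {fs. length fs = n \<and> set fs \<subseteq> Arr X},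
     Dom = map (Dom X), Cod = map (Cod X), Idn = map (Idn X), Comp = map2 (Comp X)\<rparr>"

text \<open>The functor \<open>(H, \<dots>, H)\<close> on \<open>X\<^sup>n\<close>, and likewise for transformations.\<close>

definition fpow :: "nat \<Rightarrow> ('o, 'a) cat \<Rightarrow> ('o, 'a, 'p, 'b) ftr \<Rightarrow>
    ('o list, 'a list, 'p list, 'b list) ftr" where
  "fpow n X H = \<lparr>on_ob = (\<lambda>xs\<in>Obj (pow n X). map (on_ob H) xs),
                 on_ar = (\<lambda>fs\<in>Arr (pow n X). map (on_ar H) fs)\<rparr>"

definition npow :: "nat \<Rightarrow> ('o, 'a) cat \<Rightarrow> ('o, 'a, 'p, 'b) ntr \<Rightarrow>
    ('o list, 'a list, 'p list, 'b list) ntr" where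
  "npow n X \<alpha> = \<lparr>src = fpow n X (src \<alpha>), tgt = fpow n X (tgt \<alpha>),
                 cmp = (\<lambda>xs\<in>Obj (pow n X). map (cmp \<alpha>) xs)\<rparr>"

text \<open>
  The product \<open>F\<^sub>0 \<times> \<dots> \<times> F\<^sub>k\<^sub>-\<^sub>1\<close> of functors \<open>F\<^sub>i\<close> on the powers \<open>ns ! i\<close> of \<open>X\<close>, and likewise for
  transformations.
\<close>

definition fprod :: "('o, 'a) cat \<Rightarrow> nat list \<Rightarrow> ('o list, 'a list, 'p, 'b) ftr list \<Rightarrow>
    ('o list, 'a list, 'p list, 'b list) ftr" where
  "fprod X ns Fs =
     \<lparr>on_ob = (\<lambda>xs\<in>Obj (pow (sum_list ns) X).
        map (\<lambda>i. on_ob (Fs ! i) (reindex (block ns i) xs)) [0..<length Fs]),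
      on_ar = (\<lambda>fs\<in>Arr (pow (sum_list ns) X).
        map (\<lambda>i. on_ar (Fs ! i) (reindex (block ns i) fs)) [0..<length Fs])\<rparr>"

definition nprod :: "('o, 'a) cat \<Rightarrow> nat list \<Rightarrow> ('o list, 'a list, 'p, 'b) ntr list \<Rightarrow>
    ('o list, 'a list, 'p list, 'b list) ntr" where
  "nprod X ns \<tau>s =
     \<lparr>src = fprod X ns (map src \<tau>s), tgt = fprod X ns (map tgt \<tau>s),
      cmp = (\<lambda>xs\<in>Obj (pow (sum_list ns) X).
        map (\<lambda>i. cmp (\<tau>s ! i) (reindex (block ns i) xs)) [0..<length \<tau>s])\<rparr>"

definition fgamma :: "('o, 'a) cat \<Rightarrow> nat list \<Rightarrow> ('o list, 'a list, 'o, 'a) ftr \<Rightarrow>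
    ('o list, 'a list, 'o, 'a) ftr list \<Rightarrow> ('o list, 'a list, 'o, 'a) ftr" where
  "fgamma X ns F Fs = fcomp (pow (sum_list ns) X) F (fprod X ns Fs)"

definition ngamma :: "('o, 'a) cat \<Rightarrow> nat list \<Rightarrow> ('o list, 'a list, 'o, 'a) ntr \<Rightarrow>
    ('o list, 'a list, 'o, 'a) ntr list \<Rightarrow> ('o list, 'a list, 'o, 'a) ntr" where
  "ngamma X ns \<tau> \<tau>s = hcomp (pow (sum_list ns) X) X \<tau> (nprod X ns \<tau>s)"

text \<open>\<open>F\<^sub>f\<close> and \<open>\<tau>\<^sub>f\<close>, for \<open>f\<close> with values in an \<open>l\<close>-element set.\<close>

definition fsub :: "('o, 'a) cat \<Rightarrow> nat \<Rightarrow> nat list \<Rightarrow> ('o list, 'a list, 'p, 'b) ftr \<Rightarrow>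
    ('o list, 'a list, 'p, 'b) ftr" where
  "fsub X l f F = \<lparr>on_ob = (\<lambda>xs\<in>Obj (pow l X). on_ob F (reindex f xs)),
                   on_ar = (\<lambda>us\<in>Arr (pow l X). on_ar F (reindex f us))\<rparr>"

definition nsub :: "('o, 'a) cat \<Rightarrow> nat \<Rightarrow> nat list \<Rightarrow> ('o list, 'a list, 'p, 'b) ntr \<Rightarrow>
    ('o list, 'a list, 'p, 'b) ntr" where
  "nsub X l f \<tau> = \<lparr>src = fsub X l f (src \<tau>), tgt = fsub X l f (tgt \<tau>),
                   cmp = (\<lambda>xs\<in>Obj (pow l X). cmp \<tau> (reindex f xs))\<rparr>"

text \<open>\<open>1\<^sub>X\<close> as an element of \<open>End(X)(1)\<close>.\<close>

definition funit :: "('o, 'a) cat \<Rightarrow> ('o list, 'a list, 'o, 'a) ftr" where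
  "funit X = \<lparr>on_ob = (\<lambda>xs\<in>Obj (pow 1 X). xs ! 0), on_ar = (\<lambda>us\<in>Arr (pow 1 X). us ! 0)\<rparr>"


section \<open>Pseudo algebras\<close>

text \<open>
  The families \<open>Phi\<close>, \<open>Co\<close> and \<open>Sb\<close> are unconstrained off their index sets, so a pseudo algebra may be
  represented by several records; these are isomorphic through identities.
  \<open>Co A w ws\<close>, \<open>Iu A\<close> and \<open>Sb A w l f\<close> are the coherence isomorphisms \<open>c\<close>, \<open>I\<close> and \<open>s\<close>, with \<open>f\<close>
  taking values in an \<open>l\<close>-element set.
\<close>

record ('t, 'o, 'a) psalg =
  Und :: "('o, 'a) cat"
  Phi :: "'t \<Rightarrow> ('o list, 'a list, 'o, 'a) ftr"
  Co :: "'t \<Rightarrow> 't list \<Rightarrow> ('o list, 'a list, 'o, 'a) ntr"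
  Iu :: "('o list, 'a list, 'o, 'a) ntr"
  Sb :: "'t \<Rightarrow> nat \<Rightarrow> nat list \<Rightarrow> ('o list, 'a list, 'o, 'a) ntr"

abbreviation Pw :: "nat \<Rightarrow> ('t, 'o, 'a) psalg \<Rightarrow> ('o list, 'a list) cat" where
  "Pw n A \<equiv> pow n (Und A)"

definition idPhi :: "'t lawvere \<Rightarrow> ('t, 'o, 'a) psalg \<Rightarrow> 't \<Rightarrow> ('o list, 'a list, 'o, 'a) ntr" where
  "idPhi T A w = nid (Pw (arity T w) A) (Und A) (Phi A w)"

locale pseudo_algebra =
  fixes T :: "'t lawvere" and A :: "('t, 'o, 'a) psalg"
  assumes Und: "category (Und A)"
    and Phi: "w \<in> words T \<Longrightarrow> is_functor (Pw (arity T w) A) (Und A) (Phi A w)"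
    and Co: "\<lbrakk>composable T w ws; ns = map (arity T) ws\<rbrakk> \<Longrightarrow>
      natural_iso (Pw (sum_list ns) A) (Und A)
        (Phi A (wgamma T w ws)) (fgamma (Und A) ns (Phi A w) (map (Phi A) ws)) (Co A w ws)"
    and Iu: "natural_iso (Pw 1 A) (Und A) (Phi A (unit_word T)) (funit (Und A)) (Iu A)"
    and Sb: "\<lbrakk>w \<in> words T; index_map (arity T w) l f\<rbrakk> \<Longrightarrow>
      natural_iso (Pw l A) (Und A)
        (Phi A (wsub T l f w)) (fsub (Und A) l f (Phi A w)) (Sb A w l f)"
    and Co_assoc: "\<lbrakk>composable T w ws; length wss = length ws;
        \<forall>i < length ws. composable T (ws ! i) (wss ! i);
        ns = map (arity T) (concat wss); ms = map (\<lambda>vs. sum_list (map (arity T) vs)) wss\<rbrakk> \<Longrightarrow>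
      vcomp (Pw (sum_list ns) A) (Und A)
        (ngamma (Und A) ns (Co A w ws) (map (idPhi T A) (concat wss)))
        (Co A (wgamma T w ws) (concat wss)) =
      vcomp (Pw (sum_list ns) A) (Und A)
        (ngamma (Und A) ms (idPhi T A w) (map2 (Co A) ws wss))
        (Co A w (map2 (wgamma T) ws wss))"
    and Co_unit_right: "\<lbrakk>w \<in> words T; k = arity T w\<rbrakk> \<Longrightarrow>
      vcomp (Pw k A) (Und A)
        (ngamma (Und A) (replicate k 1) (idPhi T A w) (replicate k (Iu A)))
        (Co A w (replicate k (unit_word T))) = idPhi T A w"
    and Co_unit_left: "\<lbrakk>w \<in> words T; k = arity T w\<rbrakk> \<Longrightarrow>
      vcomp (Pw k A) (Und A)
        (ngamma (Und A) [k] (Iu A) [idPhi T A w])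
        (Co A (unit_word T) [w]) = idPhi T A w"
    and Co_Sb_outer: "\<lbrakk>w \<in> words T; index_map (arity T w) l f; length ws = l; set ws \<subseteq> words T;
        ns = map (arity T) ws; N = sum_list ns; f' = block_map ns f\<rbrakk> \<Longrightarrow>
      vcomp (Pw N A) (Und A)
        (nsub (Und A) N f' (Co A w (reindex f ws)))
        (Sb A (wgamma T w (reindex f ws)) N f') =
      vcomp (Pw N A) (Und A)
        (ngamma (Und A) ns (Sb A w l f) (map (idPhi T A) ws))
        (Co A (wsub T l f w) ws)"
    and Co_Sb_inner: "\<lbrakk>composable T w ws; length gs = length ws; length ms = length ws;
        \<forall>i < length ws. index_map (arity T (ws ! i)) (ms ! i) (gs ! i);
        M = sum_list ms; g = block_sum ms gs\<rbrakk> \<Longrightarrow>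
      vcomp (Pw M A) (Und A)
        (nsub (Und A) M g (Co A w ws))
        (Sb A (wgamma T w ws) M g) =
      vcomp (Pw M A) (Und A)
        (ngamma (Und A) ms (idPhi T A w)
          (map (\<lambda>i. Sb A (ws ! i) (ms ! i) (gs ! i)) [0..<length ws]))
        (Co A w (map (\<lambda>i. wsub T (ms ! i) (gs ! i) (ws ! i)) [0..<length ws]))"
    and Sb_comp: "\<lbrakk>w \<in> words T; index_map (arity T w) l f; index_map l m g\<rbrakk> \<Longrightarrow>
      vcomp (Pw m A) (Und A) (nsub (Und A) m g (Sb A w l f)) (Sb A (wsub T l f w) m g) =
      Sb A w m (reindex f g)"  \<comment> \<open>\<open>reindex f g\<close> encodes \<open>g \<circ> f\<close>\<close>
    and Sb_id: "\<lbrakk>w \<in> words T; k = arity T w\<rbrakk> \<Longrightarrow> Sb A w k [0..<k] = idPhi T A w"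


section \<open>The 2-category of small pseudo algebras\<close>

record ('t, 'o, 'a, 'p, 'b) psmor =
  fn :: "('o, 'a, 'p, 'b) ftr"
  rho :: "'t \<Rightarrow> ('o list, 'a list, 'p, 'b) ntr"

locale pseudo_morphism =
  fixes T :: "'t lawvere" and A :: "('t, 'o, 'a) psalg" and B :: "('t, 'p, 'b) psalg"
    and H :: "('t, 'o, 'a, 'p, 'b) psmor"
  assumes fn: "is_functor (Und A) (Und B) (fn H)"
    and rho_ext: "rho H \<in> extensional (words T)"
    and rho: "\<lbrakk>w \<in> words T; n = arity T w\<rbrakk> \<Longrightarrow>
      natural_iso (Pw n A) (Und B)
        (fcomp (Pw n A) (fn H) (Phi A w))
        (fcomp (Pw n A) (Phi B w) (fpow n (Und A) (fn H)))
        (rho H w)"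
    and rho_Co: "\<lbrakk>composable T w ws; ns = map (arity T) ws; N = sum_list ns\<rbrakk> \<Longrightarrow>
      vcomp (Pw N A) (Und B)
        (hcomp (Pw N A) (Und B) (Co B w ws) (nid (Pw N A) (Pw N B) (fpow N (Und A) (fn H))))
        (rho H (wgamma T w ws)) =
      vcomp (Pw N A) (Und B)
        (hcomp (Pw N A) (Und B) (idPhi T B w) (nprod (Und A) ns (map (rho H) ws)))
        (vcomp (Pw N A) (Und B)
          (hcomp (Pw N A) (Und B) (rho H w)
            (nid (Pw N A) (Pw (length ws) A) (fprod (Und A) ns (map (Phi A) ws))))
          (hcomp (Pw N A) (Und B) (nid (Und A) (Und B) (fn H)) (Co A w ws)))"
    and rho_Iu:
      "vcomp (Pw 1 A) (Und B)
        (hcomp (Pw 1 A) (Und B) (Iu B) (nid (Pw 1 A) (Pw 1 B) (fpow 1 (Und A) (fn H))))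
        (rho H (unit_word T)) =
      hcomp (Pw 1 A) (Und B) (nid (Und A) (Und B) (fn H)) (Iu A)"
    and rho_Sb: "\<lbrakk>w \<in> words T; index_map (arity T w) l f\<rbrakk> \<Longrightarrow>
      vcomp (Pw l A) (Und B)
        (hcomp (Pw l A) (Und B) (Sb B w l f) (nid (Pw l A) (Pw l B) (fpow l (Und A) (fn H))))
        (rho H (wsub T l f w)) =
      vcomp (Pw l A) (Und B)
        (nsub (Und A) l f (rho H w))
        (hcomp (Pw l A) (Und B) (nid (Und A) (Und B) (fn H)) (Sb A w l f))"

definition psmor_id :: "'t lawvere \<Rightarrow> ('t, 'o, 'a) psalg \<Rightarrow> ('t, 'o, 'a, 'o, 'a) psmor" where
  "psmor_id T A = \<lparr>fn = fid (Und A), rho = (\<lambda>w\<in>words T. idPhi T A w)\<rparr>"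

definition psmor_comp :: "'t lawvere \<Rightarrow> ('t, 'o, 'a) psalg \<Rightarrow> ('t, 'p, 'b) psalg \<Rightarrow>
    ('t, 'q, 'c) psalg \<Rightarrow> ('t, 'p, 'b, 'q, 'c) psmor \<Rightarrow> ('t, 'o, 'a, 'p, 'b) psmor \<Rightarrow>
    ('t, 'o, 'a, 'q, 'c) psmor" where
  "psmor_comp T A B D H G =
     \<lparr>fn = fcomp (Und A) (fn H) (fn G),
      rho = (\<lambda>w\<in>words T. let n = arity T w in
        vcomp (Pw n A) (Und D)
          (hcomp (Pw n A) (Und D) (rho H w) (nid (Pw n A) (Pw n B) (fpow n (Und A) (fn G))))
          (hcomp (Pw n A) (Und D) (nid (Und B) (Und D) (fn H)) (rho G w)))\<rparr>"

text \<open>A 2-cell is a transformation together with its source and target morphism.\<close>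

type_synonym ('t, 'o, 'a, 'p, 'b) pscell =
  "('t, 'o, 'a, 'p, 'b) psmor \<times> ('t, 'o, 'a, 'p, 'b) psmor \<times> ('o, 'a, 'p, 'b) ntr"

definition pseudo_cell :: "'t lawvere \<Rightarrow> ('t, 'o, 'a) psalg \<Rightarrow> ('t, 'p, 'b) psalg \<Rightarrow>
    ('t, 'o, 'a, 'p, 'b) psmor \<Rightarrow> ('t, 'o, 'a, 'p, 'b) psmor \<Rightarrow> ('o, 'a, 'p, 'b) ntr \<Rightarrow> bool" where
  "pseudo_cell T A B G H \<alpha> \<longleftrightarrow> pseudo_morphism T A B G \<and> pseudo_morphism T A B H \<and>
     is_natural (Und A) (Und B) \<alpha> \<and> src \<alpha> = fn G \<and> tgt \<alpha> = fn H \<and>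
     (\<forall>w \<in> words T. let n = arity T w in
        vcomp (Pw n A) (Und B)
          (rho H w)
          (hcomp (Pw n A) (Und B) \<alpha> (idPhi T A w)) =
        vcomp (Pw n A) (Und B)
          (hcomp (Pw n A) (Und B) (idPhi T B w) (npow n (Und A) \<alpha>))
          (rho G w))"

definition psalg_hom :: "'t lawvere \<Rightarrow> ('t, 'o, 'a) psalg \<Rightarrow> ('t, 'p, 'b) psalg \<Rightarrow>
    (('t, 'o, 'a, 'p, 'b) psmor, ('t, 'o, 'a, 'p, 'b) pscell) cat" where
  "psalg_hom T A B =
     \<lparr>Obj = {H. pseudo_morphism T A B H},
      Arr = {(G, H, \<alpha>). pseudo_cell T A B G H \<alpha>},
      Dom = (\<lambda>(G, H, \<alpha>). G),
      Cod = (\<lambda>(G, H, \<alpha>). H),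
      Idn = (\<lambda>H. (H, H, nid (Und A) (Und B) (fn H))),
      Comp = (\<lambda>(H, K, \<beta>) (G, H', \<alpha>). (G, K, vcomp (Und A) (Und B) \<beta> \<alpha>))\<rparr>"

definition PsAlg :: "('u \<Rightarrow> 'u set) \<Rightarrow> 't lawvere \<Rightarrow>
    (('t, 'u, 'u) psalg, ('t, 'u, 'u, 'u, 'u) psmor, ('t, 'u, 'u, 'u, 'u) pscell) two_cat" where
  "PsAlg elts T =
     \<lparr>Ob = {A. pseudo_algebra T A \<and> small_category elts (Und A)},
      HomCat = psalg_hom T,
      Unit1 = psmor_id T,
      Comp1 = psmor_comp T,
      Comp2 = (\<lambda>A B D (H, H', \<beta>) (G, G', \<alpha>).
        (psmor_comp T A B D H G, psmor_comp T A B D H' G', hcomp (Und A) (Und D) \<beta> \<alpha>))\<rparr>"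

end

theory Submission
  imports Defs
begin

text \<open>
  The cotensor product \<open>{J, F}\<close> is the functor category \<open>Cat(J, X)\<close>, where \<open>X\<close> is the category
  underlying \<open>F\<close>, coded as a category \<open>E\<close> inside the universe and given pointwise operations and
  coherence isomorphisms.  An operation \<open>X\<^sup>n \<rightarrow> X\<close> lifts to \<open>E\<^sup>n \<rightarrow> E\<close>, and this lifting is a strict
  map of theories \<open>End(X) \<rightarrow> End(E)\<close> that also acts on transformations; applying it to the coherence
  diagrams of \<open>F\<close> gives those of \<open>E\<close>.  Evaluation at the objects and arrows of \<open>J\<close> is a functor from \<open>J\<close>
  to the category of morphisms \<open>E \<rightarrow> F\<close>, each evaluation at an object being a strict morphism.
  Composition with it defines the comparison functors from \<open>C(A, E)\<close> to \<open>Cat(J, C(A, F))\<close>.  Their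
  2-naturality is formal, and they are bijective because morphisms and 2-cells into \<open>E\<close> are
  determined by their components and can be assembled from them.
\<close>

section \<open>Categories, functors and natural transformations\<close>

text \<open>Two obstacles shape the development. The algebras of the 2-category live on categories
  whose objects and arrows are elements of the universe, while functors and transformations are
  records. The functor category is therefore available only up to isomorphism, and all work after
  the coding is done for any category \<open>E\<close> isomorphic to it. Moreover, equality of
  transformations includes equality of their ends, so a coherence condition speaks of functors as
  well as of components; the conditions are converted into equations at each list of objects. The
  universal property rests on an exchange of roles. The components of \<open>rho\<close> for a
  morphism into \<open>E\<close> code transformations in the variable of \<open>J\<close>. Their
  values at \<open>j\<close> form the \<open>rho\<close> of the \<open>j\<close>-th component
  morphism, and their naturality along an arrow \<open>u\<close> of \<open>J\<close> is precisely
  the 2-cell condition for the transformation attached to \<open>u\<close>. The same exchange turns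
  naturality in the source algebra into naturality in \<open>J\<close>.\<close>

lemma hom_iff: "f \<in> hom C x y \<longleftrightarrow> f \<in> Arr C \<and> Dom C f = x \<and> Cod C f = y"
  by (simp add: hom_def)

text \<open>The locale axioms speak of hom sets, whose end points the simplifier would have to
  guess. Here composability is an equation between a domain and a codomain, and associativity is
  oriented to the right, so that composites have a normal form.\<close>

lemma cat_rules:
  assumes "category C"
  shows "f \<in> Arr C \<Longrightarrow> Dom C f \<in> Obj C"
    and "f \<in> Arr C \<Longrightarrow> Cod C f \<in> Obj C"
    and "x \<in> Obj C \<Longrightarrow> Idn C x \<in> Arr C"
    and "x \<in> Obj C \<Longrightarrow> Dom C (Idn C x) = x"
    and "x \<in> Obj C \<Longrightarrow> Cod C (Idn C x) = x"
    and "\<lbrakk>f \<in> Arr C; g \<in> Arr C; Dom C g = Cod C f\<rbrakk> \<Longrightarrow> Comp C g f \<in> Arr C"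
    and "\<lbrakk>f \<in> Arr C; g \<in> Arr C; Dom C g = Cod C f\<rbrakk> \<Longrightarrow> Dom C (Comp C g f) = Dom C f"
    and "\<lbrakk>f \<in> Arr C; g \<in> Arr C; Dom C g = Cod C f\<rbrakk> \<Longrightarrow> Cod C (Comp C g f) = Cod C g"
    and "\<lbrakk>f \<in> Arr C; Cod C f = x\<rbrakk> \<Longrightarrow> Comp C (Idn C x) f = f"
    and "\<lbrakk>f \<in> Arr C; Dom C f = x\<rbrakk> \<Longrightarrow> Comp C f (Idn C x) = f"
    and "\<lbrakk>f \<in> Arr C; g \<in> Arr C; h \<in> Arr C; Dom C g = Cod C f; Dom C h = Cod C g\<rbrakk> \<Longrightarrow>
      Comp C (Comp C h g) f = Comp C h (Comp C g f)"
proof -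
  interpret category C by fact
  show "f \<in> Arr C \<Longrightarrow> Dom C f \<in> Obj C" "f \<in> Arr C \<Longrightarrow> Cod C f \<in> Obj C"
    by (simp_all add: Dom_Obj Cod_Obj)
  show "x \<in> Obj C \<Longrightarrow> Idn C x \<in> Arr C" "x \<in> Obj C \<Longrightarrow> Dom C (Idn C x) = x"
    "x \<in> Obj C \<Longrightarrow> Cod C (Idn C x) = x"
    using Idn_hom by (auto simp: hom_iff)
  show "\<lbrakk>f \<in> Arr C; g \<in> Arr C; Dom C g = Cod C f\<rbrakk> \<Longrightarrow> Comp C g f \<in> Arr C"
    "\<lbrakk>f \<in> Arr C; g \<in> Arr C; Dom C g = Cod C f\<rbrakk> \<Longrightarrow> Dom C (Comp C g f) = Dom C f"
    "\<lbrakk>f \<in> Arr C; g \<in> Arr C; Dom C g = Cod C f\<rbrakk> \<Longrightarrow> Cod C (Comp C g f) = Cod C g"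
    using Comp_hom[of f "Dom C f" "Cod C f" g "Cod C g"] by (auto simp: hom_iff)
  show "\<lbrakk>f \<in> Arr C; Cod C f = x\<rbrakk> \<Longrightarrow> Comp C (Idn C x) f = f"
    using Comp_Idn_left[of f "Dom C f" x] by (auto simp: hom_iff)
  show "\<lbrakk>f \<in> Arr C; Dom C f = x\<rbrakk> \<Longrightarrow> Comp C f (Idn C x) = f"
    using Comp_Idn_right[of f x "Cod C f"] by (auto simp: hom_iff)
  show "\<lbrakk>f \<in> Arr C; g \<in> Arr C; h \<in> Arr C; Dom C g = Cod C f; Dom C h = Cod C g\<rbrakk> \<Longrightarrow>
      Comp C (Comp C h g) f = Comp C h (Comp C g f)"
    using Comp_assoc[of f "Dom C f" "Cod C f" g "Cod C g" h "Cod C h"] by (auto simp: hom_iff)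
qed

lemma functor_rules:
  assumes "is_functor A B F"
  shows "x \<in> Obj A \<Longrightarrow> on_ob F x \<in> Obj B"
    and "f \<in> Arr A \<Longrightarrow> on_ar F f \<in> Arr B"
    and "f \<in> Arr A \<Longrightarrow> Dom B (on_ar F f) = on_ob F (Dom A f)"
    and "f \<in> Arr A \<Longrightarrow> Cod B (on_ar F f) = on_ob F (Cod A f)"
    and "x \<in> Obj A \<Longrightarrow> on_ar F (Idn A x) = Idn B (on_ob F x)"
    and "\<lbrakk>f \<in> Arr A; g \<in> Arr A; Dom A g = Cod A f\<rbrakk> \<Longrightarrow>
      on_ar F (Comp A g f) = Comp B (on_ar F g) (on_ar F f)"
  using assms unfolding is_functor_def by (auto simp: hom_iff dest: PiE_mem)

lemma functorD:
  assumes "is_functor A B F"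
  shows functor_dom: "category A" and functor_cod: "category B"
    and functor_ext_ob: "on_ob F \<in> extensional (Obj A)"
    and functor_ext_ar: "on_ar F \<in> extensional (Arr A)"
  using assms unfolding is_functor_def by (auto simp: PiE_def)

lemma functorI:
  assumes "category A" "category B"
    and "on_ob F \<in> extensional (Obj A)" "on_ar F \<in> extensional (Arr A)"
    and "\<And>x. x \<in> Obj A \<Longrightarrow> on_ob F x \<in> Obj B"
    and "\<And>f. f \<in> Arr A \<Longrightarrow> on_ar F f \<in> Arr B"
    and "\<And>f. f \<in> Arr A \<Longrightarrow> Dom B (on_ar F f) = on_ob F (Dom A f)"
    and "\<And>f. f \<in> Arr A \<Longrightarrow> Cod B (on_ar F f) = on_ob F (Cod A f)"
    and "\<And>x. x \<in> Obj A \<Longrightarrow> on_ar F (Idn A x) = Idn B (on_ob F x)"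
    and "\<And>f g. \<lbrakk>f \<in> Arr A; g \<in> Arr A; Dom A g = Cod A f\<rbrakk> \<Longrightarrow>
      on_ar F (Comp A g f) = Comp B (on_ar F g) (on_ar F f)"
  shows "is_functor A B F"
  using assms unfolding is_functor_def by (auto simp: hom_iff PiE_def)

lemma natural_rules:
  assumes "is_natural A B \<tau>"
  shows "x \<in> Obj A \<Longrightarrow> cmp \<tau> x \<in> Arr B"
    and "x \<in> Obj A \<Longrightarrow> Dom B (cmp \<tau> x) = on_ob (src \<tau>) x"
    and "x \<in> Obj A \<Longrightarrow> Cod B (cmp \<tau> x) = on_ob (tgt \<tau>) x"
  using assms unfolding is_natural_def by (auto simp: hom_iff)

lemma naturalD:
  assumes "is_natural A B \<tau>"
  shows natural_src: "is_functor A B (src \<tau>)" and natural_tgt: "is_functor A B (tgt \<tau>)"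
    and natural_ext: "cmp \<tau> \<in> extensional (Obj A)"
  using assms unfolding is_natural_def by auto

lemma naturality:
  assumes "is_natural A B \<tau>" "f \<in> Arr A"
  shows "Comp B (cmp \<tau> (Cod A f)) (on_ar (src \<tau>) f) = Comp B (on_ar (tgt \<tau>) f) (cmp \<tau> (Dom A f))"
  using assms unfolding is_natural_def by (auto simp: hom_iff)

lemma naturalI:
  assumes "is_functor A B (src \<tau>)" "is_functor A B (tgt \<tau>)" "cmp \<tau> \<in> extensional (Obj A)"
    and "\<And>x. x \<in> Obj A \<Longrightarrow> cmp \<tau> x \<in> Arr B"
    and "\<And>x. x \<in> Obj A \<Longrightarrow> Dom B (cmp \<tau> x) = on_ob (src \<tau>) x"
    and "\<And>x. x \<in> Obj A \<Longrightarrow> Cod B (cmp \<tau> x) = on_ob (tgt \<tau>) x"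
    and "\<And>f. f \<in> Arr A \<Longrightarrow>
      Comp B (cmp \<tau> (Cod A f)) (on_ar (src \<tau>) f) = Comp B (on_ar (tgt \<tau>) f) (cmp \<tau> (Dom A f))"
  shows "is_natural A B \<tau>"
  using assms unfolding is_natural_def by (auto simp: hom_iff)

lemma natural_isoD:
  assumes "natural_iso A B F G \<tau>"
  shows "is_natural A B \<tau>" "src \<tau> = F" "tgt \<tau> = G" "x \<in> Obj A \<Longrightarrow> iso B (cmp \<tau> x)"
  using assms unfolding natural_iso_def by auto

text \<open>Only extensionality enters, on two freely chosen sets. Composites can thus be compared
  before they are known to be functors, in particular the ends of transformations.\<close>

lemma ftr_eqI:
  fixes F :: "('o, 'a, 'p, 'b) ftr"
  assumes "on_ob F \<in> extensional S" "on_ob G \<in> extensional S"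
    and "on_ar F \<in> extensional R" "on_ar G \<in> extensional R"
    and "\<And>x. x \<in> S \<Longrightarrow> on_ob F x = on_ob G x" "\<And>f. f \<in> R \<Longrightarrow> on_ar F f = on_ar G f"
  shows "F = G"
proof (rule ftr.equality)
  show "on_ob F = on_ob G" by (rule extensionalityI[of _ S]) (use assms in auto)
  show "on_ar F = on_ar G" by (rule extensionalityI[of _ R]) (use assms in auto)
qed simp

lemma ntr_eqI:
  fixes \<sigma> :: "('o, 'a, 'p, 'b) ntr"
  assumes "src \<sigma> = src \<tau>" "tgt \<sigma> = tgt \<tau>" "cmp \<sigma> \<in> extensional S" "cmp \<tau> \<in> extensional S"
    and "\<And>x. x \<in> S \<Longrightarrow> cmp \<sigma> x = cmp \<tau> x"
  shows "\<sigma> = \<tau>"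
proof (rule ntr.equality)
  show "cmp \<sigma> = cmp \<tau>" by (rule extensionalityI[of _ S]) (use assms in auto)
qed (use assms in simp_all)

lemma functor_eqI:
  assumes "is_functor A B F" "is_functor A B G"
    and "\<And>x. x \<in> Obj A \<Longrightarrow> on_ob F x = on_ob G x" "\<And>f. f \<in> Arr A \<Longrightarrow> on_ar F f = on_ar G f"
  shows "F = G"
  using assms by (intro ftr_eqI[of _ "Obj A" _ "Arr A"]) (auto dest: functorD)

lemma natural_eqI:
  assumes "is_natural A B \<sigma>" "is_natural A B \<tau>" "src \<sigma> = src \<tau>" "tgt \<sigma> = tgt \<tau>"
    and "\<And>x. x \<in> Obj A \<Longrightarrow> cmp \<sigma> x = cmp \<tau> x"
  shows "\<sigma> = \<tau>"
  using assms by (intro ntr_eqI[of _ _ "Obj A"]) (auto dest: naturalD)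

lemma fid_sel [simp]: "x \<in> Obj A \<Longrightarrow> on_ob (fid A) x = x" "f \<in> Arr A \<Longrightarrow> on_ar (fid A) f = f"
  "on_ob (fid A) \<in> extensional (Obj A)" "on_ar (fid A) \<in> extensional (Arr A)"
  by (auto simp: fid_def)

lemma fcomp_sel [simp]: "x \<in> Obj A \<Longrightarrow> on_ob (fcomp A G F) x = on_ob G (on_ob F x)"
  "f \<in> Arr A \<Longrightarrow> on_ar (fcomp A G F) f = on_ar G (on_ar F f)"
  "on_ob (fcomp A G F) \<in> extensional (Obj A)" "on_ar (fcomp A G F) \<in> extensional (Arr A)"
  by (auto simp: fcomp_def)

lemma nid_sel [simp]: "src (nid A B F) = F" "tgt (nid A B F) = F"
  "x \<in> Obj A \<Longrightarrow> cmp (nid A B F) x = Idn B (on_ob F x)" "cmp (nid A B F) \<in> extensional (Obj A)"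
  by (auto simp: nid_def)

lemma vcomp_sel [simp]: "src (vcomp A B \<sigma> \<tau>) = src \<tau>" "tgt (vcomp A B \<sigma> \<tau>) = tgt \<sigma>"
  "x \<in> Obj A \<Longrightarrow> cmp (vcomp A B \<sigma> \<tau>) x = Comp B (cmp \<sigma> x) (cmp \<tau> x)"
  "cmp (vcomp A B \<sigma> \<tau>) \<in> extensional (Obj A)"
  by (auto simp: vcomp_def)

lemma hcomp_sel [simp]: "src (hcomp A D \<sigma> \<tau>) = fcomp A (src \<sigma>) (src \<tau>)"
  "tgt (hcomp A D \<sigma> \<tau>) = fcomp A (tgt \<sigma>) (tgt \<tau>)"
  "x \<in> Obj A \<Longrightarrow> cmp (hcomp A D \<sigma> \<tau>) x = Comp D (cmp \<sigma> (on_ob (tgt \<tau>) x)) (on_ar (src \<sigma>) (cmp \<tau> x))"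
  "cmp (hcomp A D \<sigma> \<tau>) \<in> extensional (Obj A)"
  by (auto simp: hcomp_def)

lemma fun_cat_sel [simp]: "Obj (fun_cat A B) = {F. is_functor A B F}"
  "Arr (fun_cat A B) = {\<tau>. is_natural A B \<tau>}" "Dom (fun_cat A B) = src" "Cod (fun_cat A B) = tgt"
  "Idn (fun_cat A B) = nid A B" "Comp (fun_cat A B) = vcomp A B"
  by (simp_all add: fun_cat_def)

text \<open>Both composites are extensional on \<open>Obj A\<close> by construction, so nothing
  beyond the outer ends and the components there can differ. This is the passage from equations of
  transformations to families of equations in \<open>B\<close>.\<close>

lemma vcomp_eq_iff: "vcomp A B \<sigma> \<tau> = vcomp A B \<sigma>' \<tau>' \<longleftrightarrow>
    src \<tau> = src \<tau>' \<and> tgt \<sigma> = tgt \<sigma>' \<and>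
    (\<forall>x \<in> Obj A. Comp B (cmp \<sigma> x) (cmp \<tau> x) = Comp B (cmp \<sigma>' x) (cmp \<tau>' x))"
  by (auto simp: vcomp_def restrict_def fun_eq_iff)

lemma is_functor_fid: "category A \<Longrightarrow> is_functor A A (fid A)"
  by (rule functorI) (auto simp: cat_rules)

lemma is_functor_fcomp:
  assumes F: "is_functor A B F" and G: "is_functor B D G"
  shows "is_functor A D (fcomp A G F)"
proof -
  note [simp] = functor_rules[OF F] functor_rules[OF G] cat_rules[OF functor_dom[OF F]]
  show ?thesis
    by (rule functorI) (auto intro: functor_dom[OF F] functor_cod[OF G])
qed

lemma fcomp_assoc:
  assumes "is_functor A B F"
  shows "fcomp A H (fcomp A G F) = fcomp A (fcomp B H G) F"
  by (rule ftr_eqI[of _ "Obj A" _ "Arr A"]) (auto simp: functor_rules[OF assms])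

lemma fcomp_fid: assumes "is_functor A B F" shows "fcomp A (fid B) F = F" "fcomp A F (fid A) = F"
  by (rule ftr_eqI[of _ "Obj A" _ "Arr A"];
      simp add: functor_rules[OF assms] functor_ext_ob[OF assms] functor_ext_ar[OF assms])+

lemma is_natural_nid: assumes F: "is_functor A B F" shows "is_natural A B (nid A B F)"
proof -
  note [simp] = functor_rules[OF F] cat_rules[OF functor_dom[OF F]] cat_rules[OF functor_cod[OF F]]
  show ?thesis by (rule naturalI) (auto simp: F)
qed

lemma is_natural_vcomp:
  assumes \<tau>: "is_natural A B \<tau>" and \<sigma>: "is_natural A B \<sigma>" and e: "tgt \<tau> = src \<sigma>"
  shows "is_natural A B (vcomp A B \<sigma> \<tau>)"
proof -
  note [simp] = functor_rules[OF natural_src[OF \<tau>]] functor_rules[OF natural_src[OF \<sigma>]]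
    functor_rules[OF natural_tgt[OF \<sigma>]] natural_rules[OF \<tau>] natural_rules[OF \<sigma>]
    cat_rules[OF functor_dom[OF natural_src[OF \<tau>]]] cat_rules[OF functor_cod[OF natural_src[OF \<tau>]]]
  show ?thesis
  proof (rule naturalI)
    fix f assume [simp]: "f \<in> Arr A"
    have "Comp B (cmp \<sigma> (Cod A f)) (Comp B (cmp \<tau> (Cod A f)) (on_ar (src \<tau>) f)) =
      Comp B (cmp \<sigma> (Cod A f)) (Comp B (on_ar (src \<sigma>) f) (cmp \<tau> (Dom A f)))"
      using naturality[OF \<tau>, of f] e by simp
    also have "\<dots> = Comp B (Comp B (cmp \<sigma> (Cod A f)) (on_ar (src \<sigma>) f)) (cmp \<tau> (Dom A f))"
      using e by simp
    also have "\<dots> = Comp B (Comp B (on_ar (tgt \<sigma>) f) (cmp \<sigma> (Dom A f))) (cmp \<tau> (Dom A f))"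
      using naturality[OF \<sigma>, of f] by simp
    finally show "Comp B (cmp (vcomp A B \<sigma> \<tau>) (Cod A f)) (on_ar (src (vcomp A B \<sigma> \<tau>)) f) =
         Comp B (on_ar (tgt (vcomp A B \<sigma> \<tau>)) f) (cmp (vcomp A B \<sigma> \<tau>) (Dom A f))"
      using e by simp
  qed (use e in \<open>auto intro: natural_src[OF \<tau>] natural_tgt[OF \<sigma>]\<close>)
qed

lemma is_natural_hcomp:
  assumes \<tau>: "is_natural A B \<tau>" and \<sigma>: "is_natural B D \<sigma>"
  shows "is_natural A D (hcomp A D \<sigma> \<tau>)"
proof -
  note [simp] = functor_rules[OF natural_src[OF \<tau>]] functor_rules[OF natural_src[OF \<sigma>]]
    functor_rules[OF natural_tgt[OF \<tau>]]
    functor_rules[OF natural_tgt[OF \<sigma>]] natural_rules[OF \<tau>] natural_rules[OF \<sigma>]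
    cat_rules[OF functor_dom[OF natural_src[OF \<tau>]]] cat_rules[OF functor_cod[OF natural_src[OF \<tau>]]]
    cat_rules[OF functor_cod[OF natural_src[OF \<sigma>]]]
  show ?thesis
  proof (rule naturalI)
    fix f assume [simp]: "f \<in> Arr A"
    let ?x = "Dom A f" and ?y = "Cod A f"
    have "Comp D (Comp D (cmp \<sigma> (on_ob (tgt \<tau>) ?y)) (on_ar (src \<sigma>) (cmp \<tau> ?y)))
        (on_ar (src \<sigma>) (on_ar (src \<tau>) f)) =
      Comp D (cmp \<sigma> (on_ob (tgt \<tau>) ?y)) (on_ar (src \<sigma>) (Comp B (cmp \<tau> ?y) (on_ar (src \<tau>) f)))"
      by simp
    also have "\<dots> = Comp D (Comp D (cmp \<sigma> (on_ob (tgt \<tau>) ?y)) (on_ar (src \<sigma>) (on_ar (tgt \<tau>) f)))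
        (on_ar (src \<sigma>) (cmp \<tau> ?x))"
      unfolding naturality[OF \<tau> \<open>f \<in> Arr A\<close>] by simp
    also have "\<dots> = Comp D (Comp D (on_ar (tgt \<sigma>) (on_ar (tgt \<tau>) f)) (cmp \<sigma> (on_ob (tgt \<tau>) ?x)))
        (on_ar (src \<sigma>) (cmp \<tau> ?x))"
      using naturality[OF \<sigma>, of "on_ar (tgt \<tau>) f"] by simp
    finally show "Comp D (cmp (hcomp A D \<sigma> \<tau>) (Cod A f)) (on_ar (src (hcomp A D \<sigma> \<tau>)) f) =
         Comp D (on_ar (tgt (hcomp A D \<sigma> \<tau>)) f) (cmp (hcomp A D \<sigma> \<tau>) (Dom A f))"
      by simp
  qed (auto intro!: is_functor_fcomp[OF natural_src[OF \<tau>] natural_src[OF \<sigma>]]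
      is_functor_fcomp[OF natural_tgt[OF \<tau>] natural_tgt[OF \<sigma>]])
qed

text \<open>Whiskering by a functor on the domain side only relabels components, because the second
  factor of the horizontal composite is the image of an identity. On the other side, in the next
  lemma, the first factor is an identity and the functor is applied to each component.\<close>

lemma cmp_hcomp_nid_right:
  assumes \<sigma>: "is_natural B D \<sigma>" and F: "is_functor A B F" and x: "x \<in> Obj A"
  shows "cmp (hcomp A D \<sigma> (nid A B F)) x = cmp \<sigma> (on_ob F x)"
  by (simp add: x functor_rules[OF F] functor_rules[OF natural_src[OF \<sigma>]] natural_rules[OF \<sigma>]
      cat_rules[OF functor_cod[OF natural_src[OF \<sigma>]]])

lemma cmp_hcomp_nid_left:
  assumes \<tau>: "is_natural A B \<tau>" and G: "is_functor B D G" and x: "x \<in> Obj A"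
  shows "cmp (hcomp A D (nid B D G) \<tau>) x = on_ar G (cmp \<tau> x)"
  by (simp add: x functor_rules[OF G] functor_rules[OF natural_tgt[OF \<tau>]] natural_rules[OF \<tau>]
      cat_rules[OF functor_cod[OF G]] functor_rules[OF natural_src[OF \<tau>]])

lemma vcomp_assoc:
  assumes \<tau>: "is_natural A B \<tau>" and \<sigma>: "is_natural A B \<sigma>" and \<rho>: "is_natural A B \<rho>"
    and e: "src \<sigma> = tgt \<tau>" "src \<rho> = tgt \<sigma>"
  shows "vcomp A B (vcomp A B \<rho> \<sigma>) \<tau> = vcomp A B \<rho> (vcomp A B \<sigma> \<tau>)"
  by (rule ntr_eqI[of _ _ "Obj A"]) (auto simp: e natural_rules[OF \<tau>] natural_rules[OF \<sigma>] natural_rules[OF \<rho>]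
      cat_rules[OF functor_cod[OF natural_src[OF \<tau>]]])

lemma vcomp_nid:
  assumes \<tau>: "is_natural A B \<tau>"
  shows "F = src \<tau> \<Longrightarrow> vcomp A B \<tau> (nid A B F) = \<tau>" "G = tgt \<tau> \<Longrightarrow> vcomp A B (nid A B G) \<tau> = \<tau>"
  by (rule ntr_eqI[of _ _ "Obj A"]; auto simp: natural_rules[OF \<tau>]
      cat_rules[OF functor_cod[OF natural_src[OF \<tau>]]] natural_ext[OF \<tau>])+

lemma hcomp_nid:
  assumes F: "is_functor A B F" and G: "is_functor B D G"
  shows "hcomp A D (nid B D G) (nid A B F) = nid A D (fcomp A G F)"
  by (rule ntr_eqI[of _ _ "Obj A"]) (auto simp: functor_rules[OF F] functor_rules[OF G]
      cat_rules[OF functor_cod[OF G]] cat_rules[OF functor_dom[OF F]])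

lemma hcomp_assoc:
  assumes \<alpha>: "is_natural A B \<alpha>" and \<beta>: "is_natural B D \<beta>" and \<gamma>: "is_natural D E \<gamma>"
  shows "hcomp A E \<gamma> (hcomp A D \<beta> \<alpha>) = hcomp A E (hcomp B E \<gamma> \<beta>) \<alpha>"
proof -
  note [simp] = natural_rules[OF \<alpha>] natural_rules[OF \<beta>] natural_rules[OF \<gamma>]
    functor_rules[OF natural_src[OF \<alpha>]] functor_rules[OF natural_src[OF \<beta>]]
    functor_rules[OF natural_src[OF \<gamma>]] functor_rules[OF natural_tgt[OF \<alpha>]]
    functor_rules[OF natural_tgt[OF \<beta>]] functor_rules[OF natural_tgt[OF \<gamma>]]
    cat_rules[OF functor_cod[OF natural_src[OF \<gamma>]]]
  show ?thesis
    by (rule ntr_eqI[of _ _ "Obj A"]) (auto simp: fcomp_assoc[OF natural_src[OF \<alpha>]] fcomp_assoc[OF natural_tgt[OF \<alpha>]])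
qed

lemma interchange_law:
  assumes a: "is_natural A B \<alpha>" and a': "is_natural A B \<alpha>'" and b: "is_natural B D \<beta>"
    and b': "is_natural B D \<beta>'" and e: "src \<alpha>' = tgt \<alpha>" "src \<beta>' = tgt \<beta>"
  shows "hcomp A D (vcomp B D \<beta>' \<beta>) (vcomp A B \<alpha>' \<alpha>) = vcomp A D (hcomp A D \<beta>' \<alpha>') (hcomp A D \<beta> \<alpha>)"
proof -
  note [simp] = natural_rules[OF a] natural_rules[OF b] natural_rules[OF a'] natural_rules[OF b'] e
    functor_rules[OF natural_src[OF a]] functor_rules[OF natural_src[OF b]]
    functor_rules[OF natural_tgt[OF a]] functor_rules[OF natural_tgt[OF b]]
    functor_rules[OF natural_tgt[OF a']] functor_rules[OF natural_tgt[OF b']]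
    cat_rules[OF functor_cod[OF natural_src[OF b]]]
  show ?thesis
  proof (rule ntr_eqI[of _ _ "Obj A"])
    fix x assume [simp]: "x \<in> Obj A"
    \<comment> \<open>Naturality of \<beta> at the arrow \<open>cmp \<alpha>' x\<close> exchanges
      the two middle factors; the rest is functoriality and associativity.\<close>
    have n: "Comp D (cmp \<beta> (on_ob (tgt \<alpha>') x)) (on_ar (src \<beta>) (cmp \<alpha>' x)) =
      Comp D (on_ar (tgt \<beta>) (cmp \<alpha>' x)) (cmp \<beta> (on_ob (tgt \<alpha>) x))"
      using naturality[OF b, of "cmp \<alpha>' x"] by simp
    have "cmp (hcomp A D (vcomp B D \<beta>' \<beta>) (vcomp A B \<alpha>' \<alpha>)) x = Comp D (cmp \<beta>' (on_ob (tgt \<alpha>') x))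
      (Comp D (Comp D (cmp \<beta> (on_ob (tgt \<alpha>') x)) (on_ar (src \<beta>) (cmp \<alpha>' x)))
        (on_ar (src \<beta>) (cmp \<alpha> x)))"
      by simp
    also have "\<dots> = cmp (vcomp A D (hcomp A D \<beta>' \<alpha>') (hcomp A D \<beta> \<alpha>)) x"
      unfolding n by simp
    finally show "cmp (hcomp A D (vcomp B D \<beta>' \<beta>) (vcomp A B \<alpha>' \<alpha>)) x =
      cmp (vcomp A D (hcomp A D \<beta>' \<alpha>') (hcomp A D \<beta> \<alpha>)) x" .
  qed auto
qed

lemma hcomp_id:
  assumes \<alpha>: "is_natural A B \<alpha>"
  shows "hcomp A B (nid B B (fid B)) \<alpha> = \<alpha>" "hcomp A B \<alpha> (nid A A (fid A)) = \<alpha>"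
proof -
  note fs = natural_src[OF \<alpha>] natural_tgt[OF \<alpha>]
  note [simp] = natural_rules[OF \<alpha>] functor_rules[OF fs(1)] functor_rules[OF fs(2)]
    fcomp_fid[OF fs(1)] fcomp_fid[OF fs(2)] cat_rules[OF functor_cod[OF fs(1)]]
    cat_rules[OF functor_dom[OF fs(1)]] natural_ext[OF \<alpha>]
  show "hcomp A B (nid B B (fid B)) \<alpha> = \<alpha>" "hcomp A B \<alpha> (nid A A (fid A)) = \<alpha>"
    by (rule ntr_eqI[of _ _ "Obj A"]; simp)+
qed

lemma category_fun_cat:
  assumes "category A" "category B"
  shows "category (fun_cat A B)"
proof
  fix F G H K \<rho> \<sigma> \<tau>
  show "F \<in> Obj (fun_cat A B) \<Longrightarrow> Idn (fun_cat A B) F \<in> hom (fun_cat A B) F F"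
    by (simp add: hom_iff is_natural_nid)
  show "\<tau> \<in> Arr (fun_cat A B) \<Longrightarrow> Dom (fun_cat A B) \<tau> \<in> Obj (fun_cat A B)"
    "\<tau> \<in> Arr (fun_cat A B) \<Longrightarrow> Cod (fun_cat A B) \<tau> \<in> Obj (fun_cat A B)"
    by (simp_all add: natural_src natural_tgt)
  show "\<lbrakk>\<tau> \<in> hom (fun_cat A B) F G; \<sigma> \<in> hom (fun_cat A B) G H\<rbrakk> \<Longrightarrow>
      Comp (fun_cat A B) \<sigma> \<tau> \<in> hom (fun_cat A B) F H"
    by (simp add: hom_iff is_natural_vcomp)
  show "\<lbrakk>\<tau> \<in> hom (fun_cat A B) F G; \<sigma> \<in> hom (fun_cat A B) G H; \<rho> \<in> hom (fun_cat A B) H K\<rbrakk> \<Longrightarrow>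
      Comp (fun_cat A B) \<rho> (Comp (fun_cat A B) \<sigma> \<tau>) = Comp (fun_cat A B) (Comp (fun_cat A B) \<rho> \<sigma>) \<tau>"
    by (simp add: hom_iff vcomp_assoc)
qed (auto simp: hom_iff vcomp_nid)

section \<open>Isomorphisms in a category and isomorphisms of categories\<close>

lemma isoE:
  assumes "iso C f"
  obtains g where "f \<in> Arr C" "g \<in> Arr C" "Dom C g = Cod C f" "Cod C g = Dom C f"
    "Comp C g f = Idn C (Dom C f)" "Comp C f g = Idn C (Cod C f)"
  using assms by (auto simp: iso_def hom_iff)

lemma isoI:
  assumes "f \<in> Arr C" "g \<in> Arr C" "Dom C g = Cod C f" "Cod C g = Dom C f"
    "Comp C g f = Idn C (Dom C f)" "Comp C f g = Idn C (Cod C f)"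
  shows "iso C f"
  using assms by (auto simp: iso_def hom_iff)

lemma iso_Idn: assumes "category C" "x \<in> Obj C" shows "iso C (Idn C x)"
  using assms(2) by (intro isoI[of _ _ "Idn C x"]) (auto simp: cat_rules[OF assms(1)])

lemma iso_Comp:
  assumes C: "category C" and f: "iso C f" and g: "iso C g" and e: "Dom C g = Cod C f"
  shows "iso C (Comp C g f)"
proof -
  note [simp] = cat_rules[OF C] e
  obtain f' where [simp]: "f \<in> Arr C" "f' \<in> Arr C" "Dom C f' = Cod C f" "Cod C f' = Dom C f"
    and f': "Comp C f' f = Idn C (Dom C f)" "Comp C f f' = Idn C (Cod C f)"
    using f by (rule isoE)
  obtain g' where [simp]: "g \<in> Arr C" "g' \<in> Arr C" "Dom C g' = Cod C g" "Cod C g' = Dom C g"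
    and g': "Comp C g' g = Idn C (Dom C g)" "Comp C g g' = Idn C (Cod C g)"
    using g by (rule isoE)
  have "Comp C (Comp C f' g') (Comp C g f) = Comp C f' (Comp C (Comp C g' g) f)" by simp
  also have "\<dots> = Idn C (Dom C f)" unfolding g' by (simp add: f')
  finally have 1: "Comp C (Comp C f' g') (Comp C g f) = Idn C (Dom C f)" .
  have "Comp C (Comp C g f) (Comp C f' g') = Comp C g (Comp C (Comp C f f') g')" by simp
  also have "\<dots> = Idn C (Cod C g)" unfolding f' by (simp add: g')
  finally have 2: "Comp C (Comp C g f) (Comp C f' g') = Idn C (Cod C g)" .
  \<comment> \<open>Associativity is switched off because \<open>1\<close> and \<open>2\<close> are
    stated with the two pairs still grouped.\<close>
  show ?thesis
    by (rule isoI[of _ _ "Comp C f' g'"]) (simp_all add: 1 2 del: cat_rules(11)[OF C])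
qed

lemma iso_functor:
  assumes F: "is_functor A B F" and f: "iso A f"
  shows "iso B (on_ar F f)"
proof -
  note [simp] = functor_rules[OF F] cat_rules[OF functor_dom[OF F]]
  obtain f' where
    [simp]: "f \<in> Arr A" "f' \<in> Arr A" "Dom A f' = Cod A f" "Cod A f' = Dom A f"
    and f': "Comp A f' f = Idn A (Dom A f)" "Comp A f f' = Idn A (Cod A f)"
    using f by (rule isoE)
  have "Comp B (on_ar F f') (on_ar F f) = on_ar F (Comp A f' f)" by simp
  then have 1: "Comp B (on_ar F f') (on_ar F f) = Idn B (on_ob F (Dom A f))" unfolding f' by simp
  have "Comp B (on_ar F f) (on_ar F f') = on_ar F (Comp A f f')" by simp
  then have 2: "Comp B (on_ar F f) (on_ar F f') = Idn B (on_ob F (Cod A f))" unfolding f' by simp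
  show ?thesis
    by (rule isoI[of _ _ "on_ar F f'"]) (simp_all add: 1 2)
qed

text \<open>The inverse bijections preserve the structure automatically: each functor law for them
  follows by writing the arguments as images under \<open>F\<close> and using the law for
  \<open>F\<close>.\<close>

lemma iso_of_categoriesI:
  assumes F: "is_functor A B F"
    and ob: "bij_betw (on_ob F) (Obj A) (Obj B)" and ar: "bij_betw (on_ar F) (Arr A) (Arr B)"
  shows "iso_of_categories A B F"
proof -
  note [simp] = functor_rules[OF F] cat_rules[OF functor_dom[OF F]] cat_rules[OF functor_cod[OF F]]
  define go where "go = the_inv_into (Obj A) (on_ob F)"
  define ga where "ga = the_inv_into (Arr A) (on_ar F)"
  have go [simp]: "\<And>x. x \<in> Obj A \<Longrightarrow> go (on_ob F x) = x" "\<And>y. y \<in> Obj B \<Longrightarrow> on_ob F (go y) = y"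
    "\<And>y. y \<in> Obj B \<Longrightarrow> go y \<in> Obj A"
    using ob unfolding go_def bij_betw_def
    by (auto simp: the_inv_into_f_f f_the_inv_into_f the_inv_into_into)
  have ga [simp]: "\<And>x. x \<in> Arr A \<Longrightarrow> ga (on_ar F x) = x" "\<And>y. y \<in> Arr B \<Longrightarrow> on_ar F (ga y) = y"
    "\<And>y. y \<in> Arr B \<Longrightarrow> ga y \<in> Arr A"
    using ar unfolding ga_def bij_betw_def
    by (auto simp: the_inv_into_f_f f_the_inv_into_f the_inv_into_into)
  \<comment> \<open>The ends of \<open>ga b\<close> are identified by applying
    \<open>on_ob F\<close> to them, where the functor laws of \<open>F\<close> are available, and
    going back by \<open>go\<close>.\<close>
  have dc: "Dom A (ga b) = go (Dom B b)" "Cod A (ga b) = go (Cod B b)" if [simp]: "b \<in> Arr B" for b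
  proof -
    have "on_ob F (Dom A (ga b)) = Dom B (on_ar F (ga b))"
      using functor_rules(3)[OF F, of "ga b"] by (simp del: functor_rules(3)[OF F])
    then have "on_ob F (Dom A (ga b)) = Dom B b" by (simp only: ga that)
    then have "go (on_ob F (Dom A (ga b))) = go (Dom B b)" by simp
    then show "Dom A (ga b) = go (Dom B b)" by (simp add: go(1))
    have "on_ob F (Cod A (ga b)) = Cod B (on_ar F (ga b))"
      using functor_rules(4)[OF F, of "ga b"] by (simp del: functor_rules(4)[OF F])
    then have "on_ob F (Cod A (ga b)) = Cod B b" by (simp only: ga that)
    then have "go (on_ob F (Cod A (ga b))) = go (Cod B b)" by simp
    then show "Cod A (ga b) = go (Cod B b)" by (simp add: go(1))
  qed
  let ?G = "\<lparr>on_ob = restrict go (Obj B), on_ar = restrict ga (Arr B)\<rparr>"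
  have "is_functor B A ?G"
  proof (rule functorI)
    fix f g assume fg: "f \<in> Arr B" "g \<in> Arr B" "Dom B g = Cod B f"
    have "ga (Comp B g f) = ga (on_ar F (Comp A (ga g) (ga f)))"
      using fg by (simp add: dc del: ga(1))
    also have "\<dots> = Comp A (ga g) (ga f)"
      using fg by (intro ga(1)) (simp add: dc)
    finally show "on_ar ?G (Comp B g f) = Comp A (on_ar ?G g) (on_ar ?G f)"
      using fg by simp
  next
    fix x assume x: "x \<in> Obj B"
    have "ga (Idn B x) = ga (on_ar F (Idn A (go x)))"
      using x by (simp del: ga(1))
    also have "\<dots> = Idn A (go x)" using x by (intro ga(1)) simp
    finally show "on_ar ?G (Idn B x) = Idn A (on_ob ?G x)" using x by simp
  qed (auto simp: dc functor_dom[OF F] functor_cod[OF F])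
  moreover have "fcomp A ?G F = fid A" "fcomp B F ?G = fid B"
    by (rule ftr_eqI[of _ "Obj A" _ "Arr A"]; simp) (rule ftr_eqI[of _ "Obj B" _ "Arr B"]; simp)
  ultimately show ?thesis
    unfolding iso_of_categories_def using F by blast
qed

section \<open>Powers of a category\<close>

lemma pow_sel [simp]: "Obj (pow n X) = {xs. length xs = n \<and> set xs \<subseteq> Obj X}"
  "Arr (pow n X) = {fs. length fs = n \<and> set fs \<subseteq> Arr X}"
  "Dom (pow n X) = map (Dom X)" "Cod (pow n X) = map (Cod X)" "Idn (pow n X) = map (Idn X)"
  "Comp (pow n X) = map2 (Comp X)"
  by (simp_all add: pow_def)

lemma nth_in_subset: "set xs \<subseteq> S \<Longrightarrow> i < length xs \<Longrightarrow> xs ! i \<in> S"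
  by (meson nth_mem subsetD)

lemma subset_set_conv_nth: "set xs \<subseteq> S \<longleftrightarrow> (\<forall>i < length xs. xs ! i \<in> S)"
  by (auto simp: in_set_conv_nth subset_iff)

lemma category_pow:
  assumes "category X"
  shows "category (pow n X)"
proof -
  note [simp] = cat_rules[OF assms]
  note [simp] = hom_iff list_eq_iff_nth_eq subset_set_conv_nth
  show ?thesis by unfold_locales auto
qed

section \<open>Index maps, blocks and reindexed lists\<close>

lemma index_mapD:
  assumes "index_map k l f"
  shows "length f = k" "i < k \<Longrightarrow> f ! i < l" "set f \<subseteq> {..<l}"
  using assms by (auto simp: index_map_def subset_set_conv_nth)

lemma length_reindex [simp]: "length (reindex f xs) = length f"
  by (simp add: reindex_def)

lemma nth_reindex [simp]: "i < length f \<Longrightarrow> reindex f xs ! i = xs ! (f ! i)"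
  by (simp add: reindex_def)

lemma set_reindex: "set f \<subseteq> {..<length xs} \<Longrightarrow> set (reindex f xs) \<subseteq> set xs"
  by (auto simp: reindex_def)

lemma reindex_map: "set f \<subseteq> {..<length xs} \<Longrightarrow> reindex f (map h xs) = map h (reindex f xs)"
  by (auto simp: reindex_def)

lemma reindex_zip: "set f \<subseteq> {..<length xs} \<Longrightarrow> length ys = length xs \<Longrightarrow>
    reindex f (zip xs ys) = zip (reindex f xs) (reindex f ys)"
  by (auto simp: list_eq_iff_nth_eq subset_set_conv_nth)

lemma reindex_Obj: "index_map k l f \<Longrightarrow> length xs = l \<Longrightarrow> set xs \<subseteq> S \<Longrightarrow> set (reindex f xs) \<subseteq> S"
  by (metis index_mapD(3) set_reindex subset_trans)

lemma sum_list_take_Suc: "i < length ns \<Longrightarrow> sum_list (take (Suc i) ns) = sum_list (take i ns) + ns ! i"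
  for ns :: "nat list"
  by (simp add: take_Suc_conv_app_nth)

lemma sum_list_take_le: "sum_list (take i ns) \<le> sum_list ns" for ns :: "nat list"
  by (metis append_take_drop_id le_add1 sum_list_append)

lemma length_block [simp]: "i < length ns \<Longrightarrow> length (block ns i) = ns ! i"
  by (simp add: block_def sum_list_take_Suc)

lemma index_map_block: "i < length ns \<Longrightarrow> index_map (ns ! i) (sum_list ns) (block ns i)"
  using sum_list_take_le[of "Suc i" ns]
  by (auto simp: index_map_def block_def sum_list_take_Suc)

text \<open>Each entry \<open>i\<close> of \<open>f\<close> contributes one block of length
  \<open>ns ! i\<close>, which explains the length \<open>sum_list (reindex f ns)\<close>; hence the
  induction on the list \<open>f\<close>.\<close>

lemma index_map_block_map:
  assumes "index_map k (length ns) f"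
  shows "index_map (sum_list (reindex f ns)) (sum_list ns) (block_map ns f)"
proof -
  have "set f \<subseteq> {..<length ns}" using assms by (simp add: index_map_def)
  then have "length (concat (map (block ns) f)) = sum_list (reindex f ns) \<and>
    set (concat (map (block ns) f)) \<subseteq> {..<sum_list ns}"
  proof (induction f)
    case (Cons i f)
    then have "index_map (ns ! i) (sum_list ns) (block ns i)" by (auto intro: index_map_block)
    with Cons show ?case by (auto simp: reindex_def index_map_def)
  qed (simp add: reindex_def)
  then show ?thesis by (simp add: index_map_def block_map_def)
qed

lemma index_map_reindex:
  assumes f: "index_map k l f" and g: "index_map l m g"
  shows "index_map k m (reindex f g)"
  using index_mapD[OF f] index_mapD[OF g] by (auto simp: index_map_def subset_set_conv_nth)

lemma index_map_block_sum:
  assumes "length gs = length ns" "length ms = length ns"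
    and "\<forall>i < length ns. index_map (ns ! i) (ms ! i) (gs ! i)"
  shows "index_map (sum_list ns) (sum_list ms) (block_sum ms gs)"
proof -
  \<comment> \<open>\<open>reindex (gs ! i) (block ms i)\<close> is \<open>gs ! i\<close> followed
    by the inclusion of the \<open>i\<close>-th block, hence a map into the whole sum.\<close>
  have r: "index_map (ns ! i) (sum_list ms) (reindex (gs ! i) (block ms i))" if "i < length ns" for i
    using assms that by (intro index_map_reindex[of _ "ms ! i"]) (auto intro: index_map_block)
  have "length (block_sum ms gs) = sum_list (map (\<lambda>i. ns ! i) [0..<length ns])"
    unfolding block_sum_def length_concat map_map comp_def
    using assms by (intro arg_cong[where f = sum_list] map_cong)
      (auto simp: index_map_def)
  moreover have "set (block_sum ms gs) \<subseteq> {..<sum_list ms}"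
    using r assms unfolding block_sum_def index_map_def by fastforce
  ultimately show ?thesis by (simp add: index_map_def map_nth)
qed

section \<open>Functors and transformations on powers\<close>

lemma fpow_sel [simp]: "xs \<in> Obj (pow n X) \<Longrightarrow> on_ob (fpow n X H) xs = map (on_ob H) xs"
  "fs \<in> Arr (pow n X) \<Longrightarrow> on_ar (fpow n X H) fs = map (on_ar H) fs"
  "on_ob (fpow n X H) \<in> extensional (Obj (pow n X))" "on_ar (fpow n X H) \<in> extensional (Arr (pow n X))"
  by (simp_all add: fpow_def del: pow_sel)

lemma npow_sel [simp]: "xs \<in> Obj (pow n X) \<Longrightarrow> cmp (npow n X \<alpha>) xs = map (cmp \<alpha>) xs"
  "src (npow n X \<alpha>) = fpow n X (src \<alpha>)" "tgt (npow n X \<alpha>) = fpow n X (tgt \<alpha>)"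
  "cmp (npow n X \<alpha>) \<in> extensional (Obj (pow n X))"
  by (simp_all add: npow_def del: pow_sel)

lemma fprod_sel [simp]:
  "xs \<in> Obj (pow (sum_list ns) X) \<Longrightarrow>
    on_ob (fprod X ns Fs) xs = map (\<lambda>i. on_ob (Fs ! i) (reindex (block ns i) xs)) [0..<length Fs]"
  "fs \<in> Arr (pow (sum_list ns) X) \<Longrightarrow>
    on_ar (fprod X ns Fs) fs = map (\<lambda>i. on_ar (Fs ! i) (reindex (block ns i) fs)) [0..<length Fs]"
  "on_ob (fprod X ns Fs) \<in> extensional (Obj (pow (sum_list ns) X))"
  "on_ar (fprod X ns Fs) \<in> extensional (Arr (pow (sum_list ns) X))"
  by (simp_all add: fprod_def del: pow_sel)

lemma nprod_sel [simp]:
  "xs \<in> Obj (pow (sum_list ns) X) \<Longrightarrow>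
    cmp (nprod X ns \<tau>s) xs = map (\<lambda>i. cmp (\<tau>s ! i) (reindex (block ns i) xs)) [0..<length \<tau>s]"
  "src (nprod X ns \<tau>s) = fprod X ns (map src \<tau>s)" "tgt (nprod X ns \<tau>s) = fprod X ns (map tgt \<tau>s)"
  "cmp (nprod X ns \<tau>s) \<in> extensional (Obj (pow (sum_list ns) X))"
  by (simp_all add: nprod_def del: pow_sel)

lemma fsub_sel [simp]:
  "xs \<in> Obj (pow l X) \<Longrightarrow> on_ob (fsub X l f F) xs = on_ob F (reindex f xs)"
  "us \<in> Arr (pow l X) \<Longrightarrow> on_ar (fsub X l f F) us = on_ar F (reindex f us)"
  "on_ob (fsub X l f F) \<in> extensional (Obj (pow l X))"
  "on_ar (fsub X l f F) \<in> extensional (Arr (pow l X))"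
  by (simp_all add: fsub_def del: pow_sel)

lemma nsub_sel [simp]:
  "xs \<in> Obj (pow l X) \<Longrightarrow> cmp (nsub X l f \<tau>) xs = cmp \<tau> (reindex f xs)"
  "src (nsub X l f \<tau>) = fsub X l f (src \<tau>)" "tgt (nsub X l f \<tau>) = fsub X l f (tgt \<tau>)"
  "cmp (nsub X l f \<tau>) \<in> extensional (Obj (pow l X))"
  by (simp_all add: nsub_def del: pow_sel)

lemma funit_sel [simp]:
  "xs \<in> Obj (pow (Suc 0) X) \<Longrightarrow> on_ob (funit X) xs = xs ! 0"
  "us \<in> Arr (pow (Suc 0) X) \<Longrightarrow> on_ar (funit X) us = us ! 0"
  "on_ob (funit X) \<in> extensional (Obj (pow (Suc 0) X))" "on_ar (funit X) \<in> extensional (Arr (pow (Suc 0) X))"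
  by (simp_all add: funit_def del: pow_sel)

lemma fgamma_ngamma_sel [simp]:
  "src (ngamma X ns \<tau> \<tau>s) = fgamma X ns (src \<tau>) (map src \<tau>s)"
  "tgt (ngamma X ns \<tau> \<tau>s) = fgamma X ns (tgt \<tau>) (map tgt \<tau>s)"
  "cmp (ngamma X ns \<tau> \<tau>s) \<in> extensional (Obj (pow (sum_list ns) X))"
  "on_ob (fgamma X ns F Fs) \<in> extensional (Obj (pow (sum_list ns) X))"
  "on_ar (fgamma X ns F Fs) \<in> extensional (Arr (pow (sum_list ns) X))"
  by (simp_all add: ngamma_def fgamma_def del: pow_sel)

lemma is_functor_fpow:
  assumes H: "is_functor X Y H"
  shows "is_functor (pow n X) (pow n Y) (fpow n X H)"
proof -
  note [simp] = functor_rules[OF H] list_eq_iff_nth_eq subset_set_conv_nth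
    cat_rules[OF functor_dom[OF H]]
  show ?thesis
  proof (rule functorI)
    fix f g assume "f \<in> Arr (pow n X)" "g \<in> Arr (pow n X)" "Dom (pow n X) g = Cod (pow n X) f"
    then show "on_ar (fpow n X H) (Comp (pow n X) g f) =
        Comp (pow n Y) (on_ar (fpow n X H) g) (on_ar (fpow n X H) f)"
      by auto
  qed (use category_pow[OF functor_dom[OF H]] category_pow[OF functor_cod[OF H]]
        fpow_sel(3,4)[of n X H] in auto)
qed

lemma is_natural_npow:
  assumes a: "is_natural X Y \<alpha>"
  shows "is_natural (pow n X) (pow n Y) (npow n X \<alpha>)"
proof -
  note [simp] = natural_rules[OF a] list_eq_iff_nth_eq subset_set_conv_nth
    functor_rules[OF natural_src[OF a]] functor_rules[OF natural_tgt[OF a]]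
    cat_rules[OF functor_dom[OF natural_src[OF a]]]
  show ?thesis
    by (rule naturalI) (use is_functor_fpow[OF natural_src[OF a]] is_functor_fpow[OF natural_tgt[OF a]]
        npow_sel(4)[of n X \<alpha>] in \<open>auto simp: naturality[OF a]\<close>)
qed

text \<open>Reindexing along \<open>f\<close> is a functor from the \<open>l\<close>-th power to the
  \<open>k\<close>-th. It is given in the form of rewrite rules, since \<open>fsub\<close> and
  \<open>nsub\<close> mention only its effect on lists.\<close>

lemma reindex_pow:
  assumes f: "index_map k l f"
  shows "xs \<in> Obj (pow l X) \<Longrightarrow> reindex f xs \<in> Obj (pow k X)"
    and "us \<in> Arr (pow l X) \<Longrightarrow> reindex f us \<in> Arr (pow k X)"
    and "us \<in> Arr (pow l X) \<Longrightarrow> reindex f (Dom (pow l X) us) = Dom (pow k X) (reindex f us)"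
    and "us \<in> Arr (pow l X) \<Longrightarrow> reindex f (Cod (pow l X) us) = Cod (pow k X) (reindex f us)"
    and "xs \<in> Obj (pow l X) \<Longrightarrow> reindex f (Idn (pow l X) xs) = Idn (pow k X) (reindex f xs)"
    and "us \<in> Arr (pow l X) \<Longrightarrow> vs \<in> Arr (pow l X) \<Longrightarrow>
      reindex f (Comp (pow l X) vs us) = Comp (pow k X) (reindex f vs) (reindex f us)"
  using index_mapD[OF f] by (simp_all add: reindex_Obj[OF f] reindex_map reindex_zip)

lemma is_functor_fsub:
  assumes f: "index_map k l f" and X: "category X" and F: "is_functor (pow k X) B F"
  shows "is_functor (pow l X) B (fsub X l f F)"
proof -
  have Xk: "category (pow l X)" by (rule category_pow[OF X])
  note [simp] = functor_rules[OF F] cat_rules[OF Xk] reindex_pow[OF f]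
  note [simp del] = pow_sel
  show ?thesis
  proof (rule functorI)
    fix u v assume uv: "u \<in> Arr (pow l X)" "v \<in> Arr (pow l X)" "Dom (pow l X) v = Cod (pow l X) u"
    \<comment> \<open>Composability in the \<open>l\<close>-th power has to be carried over to the
      \<open>k\<close>-th before functoriality of \<open>F\<close> can be used.\<close>
    then have "reindex f (Dom (pow l X) v) = reindex f (Cod (pow l X) u)" by simp
    then have "Dom (pow k X) (reindex f v) = Cod (pow k X) (reindex f u)"
      using uv(1,2) by (simp only: reindex_pow[OF f])
    then show "on_ar (fsub X l f F) (Comp (pow l X) v u) =
        Comp B (on_ar (fsub X l f F) v) (on_ar (fsub X l f F) u)"
      using uv by simp
  qed (simp_all add: Xk functor_cod[OF F])
qed

lemma is_natural_nsub:
  assumes f: "index_map k l f" and X: "category X" and t: "is_natural (pow k X) B \<tau>"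
  shows "is_natural (pow l X) B (nsub X l f \<tau>)"
proof -
  have Xk: "category (pow l X)" by (rule category_pow[OF X])
  note [simp] = natural_rules[OF t] cat_rules[OF Xk] reindex_pow[OF f]
  note [simp del] = pow_sel
  show ?thesis
    by (rule naturalI) (simp_all add: naturality[OF t] is_functor_fsub[OF f X natural_src[OF t]]
        is_functor_fsub[OF f X natural_tgt[OF t]])
qed

text \<open>The functor into the \<open>k\<close>-th power induced by \<open>k\<close> functors
  through the universal property of the product. A product \<open>fprod\<close> is the tuple of its
  factors, each substituted along the inclusion of its block, so facts about products reduce to
  tuples and substitutions.\<close>

definition ftuple :: "nat \<Rightarrow> ('o, 'a) cat \<Rightarrow> (nat \<Rightarrow> ('o, 'a, 'p, 'b) ftr) \<Rightarrow>
    ('o, 'a, 'p list, 'b list) ftr" where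
  "ftuple k A G = \<lparr>on_ob = (\<lambda>x\<in>Obj A. map (\<lambda>i. on_ob (G i) x) [0..<k]),
                   on_ar = (\<lambda>f\<in>Arr A. map (\<lambda>i. on_ar (G i) f) [0..<k])\<rparr>"

lemma is_functor_ftuple:
  assumes A: "category A" and B: "category B" and G: "\<And>i. i < k \<Longrightarrow> is_functor A B (G i)"
  shows "is_functor A (pow k B) (ftuple k A G)"
proof -
  note [simp] = functor_rules[OF G] cat_rules[OF A]
  show ?thesis
    by (rule functorI) (auto simp: A category_pow[OF B] ftuple_def list_eq_iff_nth_eq)
qed

lemma fprod_eq_ftuple:
  "fprod X ns Fs = ftuple (length Fs) (pow (sum_list ns) X)
    (\<lambda>i. fsub X (sum_list ns) (block ns i) (Fs ! i))"
  by (simp add: fprod_def ftuple_def restrict_def fun_eq_iff)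

lemma is_functor_fprod:
  assumes X: "category X" and B: "category B" and len: "length Fs = length ns"
    and Fs: "\<And>i. i < length ns \<Longrightarrow> is_functor (pow (ns ! i) X) B (Fs ! i)"
  shows "is_functor (pow (sum_list ns) X) (pow (length ns) B) (fprod X ns Fs)"
  unfolding fprod_eq_ftuple len
  by (intro is_functor_ftuple is_functor_fsub[OF index_map_block] category_pow X B Fs)

definition ntuple :: "nat \<Rightarrow> ('o, 'a) cat \<Rightarrow> (nat \<Rightarrow> ('o, 'a, 'p, 'b) ntr) \<Rightarrow>
    ('o, 'a, 'p list, 'b list) ntr" where
  "ntuple k A t = \<lparr>src = ftuple k A (\<lambda>i. src (t i)), tgt = ftuple k A (\<lambda>i. tgt (t i)),
                   cmp = (\<lambda>x\<in>Obj A. map (\<lambda>i. cmp (t i) x) [0..<k])\<rparr>"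

lemma is_natural_ntuple:
  assumes A: "category A" and B: "category B" and t: "\<And>i. i < k \<Longrightarrow> is_natural A B (t i)"
  shows "is_natural A (pow k B) (ntuple k A t)"
proof -
  have 1: "is_functor A (pow k B) (src (ntuple k A t))" "is_functor A (pow k B) (tgt (ntuple k A t))"
    using t by (auto simp: ntuple_def intro!: is_functor_ftuple A B natural_src natural_tgt)
  note [simp] = natural_rules[OF t] cat_rules[OF A]
  show ?thesis
    by (rule naturalI[OF 1])
      (auto simp: ntuple_def ftuple_def list_eq_iff_nth_eq naturality[OF t])
qed

lemma nprod_eq_ntuple:
  "nprod X ns \<tau>s = ntuple (length \<tau>s) (pow (sum_list ns) X)
    (\<lambda>i. nsub X (sum_list ns) (block ns i) (\<tau>s ! i))"
  by (simp add: nprod_def ntuple_def fprod_def ftuple_def restrict_def fun_eq_iff)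

lemma is_natural_nprod:
  assumes X: "category X" and B: "category B" and len: "length \<tau>s = length ns"
    and ts: "\<And>i. i < length ns \<Longrightarrow> is_natural (pow (ns ! i) X) B (\<tau>s ! i)"
  shows "is_natural (pow (sum_list ns) X) (pow (length ns) B) (nprod X ns \<tau>s)"
  unfolding nprod_eq_ntuple len
  by (intro is_natural_ntuple is_natural_nsub[OF index_map_block] category_pow X B ts)

lemma is_functor_fgamma:
  assumes X: "category X" and len: "length Fs = length ns"
    and F: "is_functor (pow (length ns) X) X F"
    and Fs: "\<And>i. i < length ns \<Longrightarrow> is_functor (pow (ns ! i) X) X (Fs ! i)"
  shows "is_functor (pow (sum_list ns) X) X (fgamma X ns F Fs)"
  unfolding fgamma_def by (rule is_functor_fcomp[OF is_functor_fprod[OF X X len Fs] F])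

lemma is_natural_ngamma:
  assumes X: "category X" and len: "length \<tau>s = length ns"
    and t: "is_natural (pow (length ns) X) X \<tau>"
    and ts: "\<And>i. i < length ns \<Longrightarrow> is_natural (pow (ns ! i) X) X (\<tau>s ! i)"
  shows "is_natural (pow (sum_list ns) X) X (ngamma X ns \<tau> \<tau>s)"
  unfolding ngamma_def by (rule is_natural_hcomp[OF is_natural_nprod[OF X X len ts] t])

lemma is_functor_funit: assumes X: "category X" shows "is_functor (pow (Suc 0) X) X (funit X)"
proof -
  note [simp] = cat_rules[OF X] list_eq_iff_nth_eq subset_set_conv_nth
  show ?thesis
    by (rule functorI) (use funit_sel(3,4)[of X] X category_pow[OF X, of "Suc 0"] in auto)
qed

lemma cmp_ngamma:
  assumes "xs \<in> Obj (pow (sum_list ns) X)"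
  shows "cmp (ngamma X ns \<tau> \<tau>s) xs = Comp X
    (cmp \<tau> (map (\<lambda>i. on_ob (tgt (\<tau>s ! i)) (reindex (block ns i) xs)) [0..<length \<tau>s]))
    (on_ar (src \<tau>) (map (\<lambda>i. cmp (\<tau>s ! i) (reindex (block ns i) xs)) [0..<length \<tau>s]))"
proof -
  have "map (\<lambda>i. on_ob (map tgt \<tau>s ! i) (reindex (block ns i) xs)) [0..<length \<tau>s] =
    map (\<lambda>i. on_ob (tgt (\<tau>s ! i)) (reindex (block ns i) xs)) [0..<length \<tau>s]"
    by (rule map_cong) simp_all
  then show ?thesis
    unfolding ngamma_def hcomp_sel(3)[OF assms] nprod_sel(1)[OF assms] nprod_sel(2,3)
      fprod_sel(1)[OF assms] by (simp only: length_map)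
qed

lemma fgamma_sel:
  "xs \<in> Obj (pow (sum_list ns) X) \<Longrightarrow> on_ob (fgamma X ns F Fs) xs =
    on_ob F (map (\<lambda>i. on_ob (Fs ! i) (reindex (block ns i) xs)) [0..<length Fs])"
  "us \<in> Arr (pow (sum_list ns) X) \<Longrightarrow> on_ar (fgamma X ns F Fs) us =
    on_ar F (map (\<lambda>i. on_ar (Fs ! i) (reindex (block ns i) us)) [0..<length Fs])"
  by (simp_all add: fgamma_def)

text \<open>In the axiom for \<open>Co\<close> the inner functors have the form
  \<open>map G ws\<close>. Replacing \<open>map G ws ! i\<close> under the binder uses the bound on
  \<open>i\<close>, hence the congruence rule in the proof.\<close>

lemma fgamma_map_sel [simp]:
  assumes "length ws = length ns"
  shows "xs \<in> Obj (pow (sum_list ns) X) \<Longrightarrow> on_ob (fgamma X ns F (map G ws)) xs =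
      on_ob F (map (\<lambda>i. on_ob (G (ws ! i)) (reindex (block ns i) xs)) [0..<length ns])"
    and "us \<in> Arr (pow (sum_list ns) X) \<Longrightarrow> on_ar (fgamma X ns F (map G ws)) us =
      on_ar F (map (\<lambda>i. on_ar (G (ws ! i)) (reindex (block ns i) us)) [0..<length ns])"
proof -
  have "map (\<lambda>i. on_ob (map G ws ! i) (reindex (block ns i) xs)) [0..<length ns] =
      map (\<lambda>i. on_ob (G (ws ! i)) (reindex (block ns i) xs)) [0..<length ns]"
    by (rule map_cong) (simp_all add: assms)
  then show "on_ob (fgamma X ns F (map G ws)) xs =
      on_ob F (map (\<lambda>i. on_ob (G (ws ! i)) (reindex (block ns i) xs)) [0..<length ns])"
    if "xs \<in> Obj (pow (sum_list ns) X)"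
    using that by (simp only: fgamma_sel length_map assms)
  have "map (\<lambda>i. on_ar (map G ws ! i) (reindex (block ns i) us)) [0..<length ns] =
      map (\<lambda>i. on_ar (G (ws ! i)) (reindex (block ns i) us)) [0..<length ns]"
    by (rule map_cong) (simp_all add: assms)
  then show "on_ar (fgamma X ns F (map G ws)) us =
      on_ar F (map (\<lambda>i. on_ar (G (ws ! i)) (reindex (block ns i) us)) [0..<length ns])"
    if "us \<in> Arr (pow (sum_list ns) X)"
    using that by (simp only: fgamma_sel length_map assms)
qed

section \<open>Coherence conditions evaluated at objects\<close>

text \<open>Membership in a power remains opaque from here on, so that the selection rules having it
  as a premise apply; it is unfolded only where single entries matter.\<close>

declare pow_sel [simp del]

section \<open>Arities of composite words\<close>

lemma (in lawvere_theory) tuple_hom: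
  assumes "set us \<subseteq> hom T m 1"
  shows "tuple T m us \<in> hom T m (length us)"
  using theI'[OF product[OF assms]] by (simp add: tuple_def is_tuple_def)

lemma (in lawvere_theory) wsub_word:
  assumes w: "w \<in> words T" and f: "index_map (arity T w) l f"
  shows "wsub T l f w \<in> words T" "arity T (wsub T l f w) = l"
proof -
  have "set (map (pr T l) f) \<subseteq> hom T l 1"
    using index_mapD(3)[OF f] pr_hom by auto
  then have "tuple T l (map (pr T l) f) \<in> hom T l (arity T w)"
    using tuple_hom[of "map (pr T l) f" l] index_mapD(1)[OF f] by simp
  then have "wsub T l f w \<in> hom T l 1"
    using w unfolding wsub_def by (intro Comp_hom) (auto simp: words_def hom_iff)
  then show "wsub T l f w \<in> words T" "arity T (wsub T l f w) = l"
    by (auto simp: words_def hom_iff)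
qed

lemma composableD:
  assumes "composable T w ws"
  shows "w \<in> words T" "i < length ws \<Longrightarrow> ws ! i \<in> words T" "length ws = arity T w"
    "length (map (arity T) ws) = arity T w"
  using assms by (auto simp: composable_def subset_set_conv_nth)

lemma (in lawvere_theory) wgamma_word:
  assumes "composable T w ws"
  shows "wgamma T w ws \<in> words T" "arity T (wgamma T w ws) = sum_list (map (arity T) ws)"
proof -
  note c = composableD[OF assms]
  let ?ns = "map (arity T) ws"
  let ?N = "sum_list ?ns"
  let ?us = "map (\<lambda>i. wsub T ?N (block ?ns i) (ws ! i)) [0..<length ws]"
  have b: "index_map (arity T (ws ! i)) ?N (block ?ns i)" if "i < length ws" for i
    using index_map_block[of i ?ns] that by simp
  have "set ?us \<subseteq> hom T ?N 1"
    using wsub_word[OF c(2) b] by (auto simp: hom_iff words_def)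
  then have "tuple T ?N ?us \<in> hom T ?N (arity T w)"
    using tuple_hom[of ?us ?N] c(3) by simp
  then have "wgamma T w ws \<in> hom T ?N 1"
    using c(1) unfolding wgamma_def Let_def by (intro Comp_hom) (auto simp: words_def hom_iff)
  then show "wgamma T w ws \<in> words T" "arity T (wgamma T w ws) = ?N"
    by (auto simp: words_def hom_iff)
qed

lemma (in lawvere_theory) unit_word:
  shows "unit_word T \<in> words T" "arity T (unit_word T) = Suc 0"
  using pr_hom[of 0 1] by (auto simp: unit_word_def words_def hom_iff)

section \<open>Morphisms and 2-cells in componentwise form\<close>

lemma (in pseudo_algebra) is_natural_idPhi:
  "w \<in> words T \<Longrightarrow> is_natural (Pw (arity T w) A) (Und A) (idPhi T A w)"
  unfolding idPhi_def by (intro is_natural_nid Phi)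

lemma idPhi_sel [simp]: "src (idPhi T A w) = Phi A w" "tgt (idPhi T A w) = Phi A w"
  by (simp_all add: idPhi_def)

lemma (in pseudo_algebra) fprod_Phi:
  assumes c: "composable T w ws" and ns: "ns = map (arity T) ws"
  shows "is_functor (Pw (sum_list ns) A) (Pw (length ws) A) (fprod (Und A) ns (map (Phi A) ws))"
proof -
  have "length ws = length ns" by (simp add: ns)
  then show ?thesis
    using Phi[OF composableD(2)[OF c]] is_functor_fprod[OF Und Und, of "map (Phi A) ws" ns]
    by (simp add: ns)
qed

text \<open>The data of a morphism before any coherence equation: enough to give all components of
  \<open>rho\<close> their domains and codomains. Identities, composites, evaluations and assembled
  cones are first shown to be of this kind, and coherence is then tested on components.\<close>

locale premorphism = lawvere_theory T + A: pseudo_algebra T A + B: pseudo_algebra T B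
  for T :: "'t lawvere" and A :: "('t, 'o, 'a) psalg" and B :: "('t, 'p, 'b) psalg"
    and H :: "('t, 'o, 'a, 'p, 'b) psmor" +
  assumes fn: "is_functor (Und A) (Und B) (fn H)"
    and rho: "w \<in> words T \<Longrightarrow>
      natural_iso (Pw (arity T w) A) (Und B)
        (fcomp (Pw (arity T w) A) (fn H) (Phi A w))
        (fcomp (Pw (arity T w) A) (Phi B w) (fpow (arity T w) (Und A) (fn H)))
        (rho H w)"
begin

lemma rho_natural: "w \<in> words T \<Longrightarrow> is_natural (Pw (arity T w) A) (Und B) (rho H w)"
  by (rule natural_isoD(1)[OF rho])

lemma rho_src: "w \<in> words T \<Longrightarrow> src (rho H w) = fcomp (Pw (arity T w) A) (fn H) (Phi A w)"
  by (rule natural_isoD(2)[OF rho])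

lemma rho_tgt: "w \<in> words T \<Longrightarrow>
    tgt (rho H w) = fcomp (Pw (arity T w) A) (Phi B w) (fpow (arity T w) (Und A) (fn H))"
  by (rule natural_isoD(3)[OF rho])

lemma rho_rules:
  assumes "w \<in> words T" "xs \<in> Obj (Pw (arity T w) A)"
  shows "cmp (rho H w) xs \<in> Arr (Und B)"
    "Dom (Und B) (cmp (rho H w) xs) = on_ob (fn H) (on_ob (Phi A w) xs)"
    "Cod (Und B) (cmp (rho H w) xs) = on_ob (Phi B w) (map (on_ob (fn H)) xs)"
  using natural_rules[OF rho_natural[OF assms(1)] assms(2)] assms
  by (simp_all add: rho_src rho_tgt)

lemma fpow_fn: "is_functor (Pw n A) (Pw n B) (fpow n (Und A) (fn H))"
  by (rule is_functor_fpow[OF fn])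

lemma rho_naturality:
  assumes w: "w \<in> words T" and u: "u \<in> Arr (Pw (arity T w) A)"
  shows "Comp (Und B) (cmp (rho H w) (map (Cod (Und A)) u)) (on_ar (fn H) (on_ar (Phi A w) u)) =
    Comp (Und B) (on_ar (Phi B w) (map (on_ar (fn H)) u)) (cmp (rho H w) (map (Dom (Und A)) u))"
  using naturality[OF rho_natural[OF w] u] w u cat_rules(1,2)[OF category_pow[OF A.Und] u]
  by (simp add: rho_src rho_tgt) (simp add: pow_sel)

text \<open>The outer ends of both sides agree for any \<open>rho\<close> with the prescribed ends,
  so the equation of transformations amounts to its components, where each whiskering is evaluated
  by \<open>cmp_hcomp_nid_right\<close> or \<open>cmp_hcomp_nid_left\<close>.\<close>

lemma rho_Co_iff:
  assumes c: "composable T w ws" and ns: "ns = map (arity T) ws" and N: "N = sum_list ns"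
  shows "vcomp (Pw N A) (Und B)
        (hcomp (Pw N A) (Und B) (Co B w ws) (nid (Pw N A) (Pw N B) (fpow N (Und A) (fn H))))
        (rho H (wgamma T w ws)) =
      vcomp (Pw N A) (Und B)
        (hcomp (Pw N A) (Und B) (idPhi T B w) (nprod (Und A) ns (map (rho H) ws)))
        (vcomp (Pw N A) (Und B)
          (hcomp (Pw N A) (Und B) (rho H w)
            (nid (Pw N A) (Pw (length ws) A) (fprod (Und A) ns (map (Phi A) ws))))
          (hcomp (Pw N A) (Und B) (nid (Und A) (Und B) (fn H)) (Co A w ws))) \<longleftrightarrow>
    (\<forall>xs \<in> Obj (Pw N A).
      Comp (Und B) (cmp (Co B w ws) (map (on_ob (fn H)) xs)) (cmp (rho H (wgamma T w ws)) xs) =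
      Comp (Und B)
        (on_ar (Phi B w) (map (\<lambda>i. cmp (rho H (ws ! i)) (reindex (block ns i) xs)) [0..<length ws]))
        (Comp (Und B)
          (cmp (rho H w) (map (\<lambda>i. on_ob (Phi A (ws ! i)) (reindex (block ns i) xs)) [0..<length ws]))
          (on_ar (fn H) (cmp (Co A w ws) xs))))"
    (is "vcomp _ _ ?\<sigma> ?\<tau> = vcomp _ _ ?\<sigma>' ?\<tau>' \<longleftrightarrow> (\<forall>xs \<in> _. ?P xs)")
proof -
  note cD = composableD[OF c]
  note \<gamma> = wgamma_word[OF c]
  note ca = natural_isoD[OF A.Co[OF c ns]] and cb = natural_isoD[OF B.Co[OF c ns]]
  have len: "length ws = length ns" "length ns = arity T w" by (simp_all add: ns cD(3))
  have nsi: "arity T (ws ! i) = ns ! i" if "i < length ws" for i using that by (simp add: ns)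
  have blk: "set (block ns i) \<subseteq> {..<N}" if "i < length ws" for i
    using index_mapD(3)[OF index_map_block[of i ns]] that by (simp add: N len)
  have rx: "reindex (block ns i) xs \<in> Obj (Pw (ns ! i) A)" if "i < length ws" "xs \<in> Obj (Pw N A)" for i xs
    using reindex_pow(1)[OF index_map_block[of i ns]] that by (simp add: N len)
  have rxa: "reindex (block ns i) xs \<in> Arr (Pw (ns ! i) A)" if "i < length ws" "xs \<in> Arr (Pw N A)" for i xs
    using reindex_pow(2)[OF index_map_block[of i ns]] that by (simp add: N len)
  have np: "is_natural (Pw N A) (Pw (arity T w) B) (nprod (Und A) ns (map (rho H) ws))"
    using is_natural_nprod[OF A.Und B.Und, of "map (rho H) ws" ns] rho_natural[OF cD(2)]
    by (simp add: len nsi N)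
  have fp: "is_functor (Pw N A) (Pw (arity T w) A) (fprod (Und A) ns (map (Phi A) ws))"
    using A.fprod_Phi[OF c ns] by (simp add: N cD(3))
  have src: "src ?\<tau> = src ?\<tau>'"
    by (simp add: rho_src \<gamma> ca(2) ns N)
  \<comment> \<open>Both targets send \<open>xs\<close> to \<open>Phi B w\<close> of the list of
    values of the inner operations on the blocks of the image of \<open>xs\<close>; they agree
    because taking blocks commutes with applying \<open>fn H\<close> entrywise.\<close>
  have tgt: "tgt ?\<sigma> = tgt ?\<sigma>'"
  proof (rule ftr_eqI[of _ "Obj (Pw N A)" _ "Arr (Pw N A)"])
    fix xs assume xs: "xs \<in> Obj (Pw N A)"
    have "map (on_ob (fn H)) xs \<in> Obj (Pw N B)" using functor_rules(1)[OF fpow_fn xs] xs by (simp add: pow_sel)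
    then show "on_ob (tgt ?\<sigma>) xs = on_ob (tgt ?\<sigma>') xs"
      using xs rx[OF _ xs] blk unfolding N
      by (auto simp: cb(3) rho_tgt cD nsi reindex_map fgamma_sel simp del: fgamma_map_sel
          intro!: arg_cong[where f = "on_ob (Phi B w)"]) (simp_all add: reindex_map pow_sel)
  next
    fix xs assume xs: "xs \<in> Arr (Pw N A)"
    have "map (on_ar (fn H)) xs \<in> Arr (Pw N B)" using functor_rules(2)[OF fpow_fn xs] xs by (simp add: pow_sel)
    then show "on_ar (tgt ?\<sigma>) xs = on_ar (tgt ?\<sigma>') xs"
      using xs rxa[OF _ xs] blk unfolding N
      by (auto simp: cb(3) rho_tgt cD nsi reindex_map fgamma_sel simp del: fgamma_map_sel
          intro!: arg_cong[where f = "on_ar (Phi B w)"]) (simp_all add: reindex_map pow_sel)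
  qed simp_all
  have "Comp (Und B) (cmp ?\<sigma> xs) (cmp ?\<tau> xs) = Comp (Und B) (cmp ?\<sigma>' xs) (cmp ?\<tau>' xs) \<longleftrightarrow> ?P xs"
    if xs: "xs \<in> Obj (Pw N A)" for xs
  proof -
    have 1: "cmp ?\<sigma> xs = cmp (Co B w ws) (map (on_ob (fn H)) xs)"
      using cmp_hcomp_nid_right[OF cb(1)[folded N] fpow_fn xs] xs by (simp add: pow_sel)
    have 2: "cmp ?\<sigma>' xs =
      on_ar (Phi B w) (map (\<lambda>i. cmp (rho H (ws ! i)) (reindex (block ns i) xs)) [0..<length ws])"
    proof -
      have e: "map (\<lambda>i. cmp (map (rho H) ws ! i) (reindex (block ns i) xs)) [0..<length ws] =
        map (\<lambda>i. cmp (rho H (ws ! i)) (reindex (block ns i) xs)) [0..<length ws]"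
        by (rule map_cong) simp_all
      show ?thesis
        unfolding idPhi_def cmp_hcomp_nid_left[OF np B.Phi[OF cD(1)] xs]
        using xs by (simp add: N e)
    qed
    have 3: "cmp (hcomp (Pw N A) (Und B) (rho H w)
            (nid (Pw N A) (Pw (length ws) A) (fprod (Und A) ns (map (Phi A) ws)))) xs =
       cmp (rho H w) (map (\<lambda>i. on_ob (Phi A (ws ! i)) (reindex (block ns i) xs)) [0..<length ws])"
    proof -
      have e: "map (\<lambda>i. on_ob (map (Phi A) ws ! i) (reindex (block ns i) xs)) [0..<length ws] =
        map (\<lambda>i. on_ob (Phi A (ws ! i)) (reindex (block ns i) xs)) [0..<length ws]"
        by (rule map_cong) simp_all
      show ?thesis
        unfolding cD(3) cmp_hcomp_nid_right[OF rho_natural[OF cD(1)] fp xs]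
        using xs by (simp add: N cD(3) e[unfolded cD(3)])
    qed
    have 4: "cmp (hcomp (Pw N A) (Und B) (nid (Und A) (Und B) (fn H)) (Co A w ws)) xs =
       on_ar (fn H) (cmp (Co A w ws) xs)"
      by (rule cmp_hcomp_nid_left[OF ca(1)[folded N] fn xs])
    show ?thesis unfolding vcomp_sel(3)[OF xs] 1 2 3 4 ..
  qed
  then show ?thesis unfolding vcomp_eq_iff using src tgt by auto
qed

text \<open>\<open>Suc 0\<close> is what the simplifier makes of the arity \<open>1\<close>; the
  axiom for \<open>Iu\<close> is therefore used with \<open>One_nat_def\<close> unfolded.\<close>

lemma rho_Iu_iff:
  "vcomp (Pw (Suc 0) A) (Und B)
      (hcomp (Pw (Suc 0) A) (Und B) (Iu B) (nid (Pw (Suc 0) A) (Pw (Suc 0) B) (fpow (Suc 0) (Und A) (fn H))))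
      (rho H (unit_word T)) =
    hcomp (Pw (Suc 0) A) (Und B) (nid (Und A) (Und B) (fn H)) (Iu A) \<longleftrightarrow>
  (\<forall>xs \<in> Obj (Pw (Suc 0) A).
    Comp (Und B) (cmp (Iu B) (map (on_ob (fn H)) xs)) (cmp (rho H (unit_word T)) xs) =
    on_ar (fn H) (cmp (Iu A) xs))" (is "vcomp _ _ ?\<sigma> ?\<tau> = ?\<upsilon> \<longleftrightarrow> (\<forall>xs \<in> _. ?P xs)")
proof -
  note u = unit_word and ia = natural_isoD[OF A.Iu[unfolded One_nat_def]]
    and ib = natural_isoD[OF B.Iu[unfolded One_nat_def]]
  have src: "src ?\<tau> = src ?\<upsilon>" by (simp add: rho_src u ia(2))
  have tgt: "tgt ?\<sigma> = tgt ?\<upsilon>"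
    unfolding hcomp_sel nid_sel ib(3) ia(3)
  proof (rule ftr_eqI[of _ "Obj (Pw (Suc 0) A)" _ "Arr (Pw (Suc 0) A)"])
    fix xs assume xs: "xs \<in> Obj (Pw (Suc 0) A)"
    have "map (on_ob (fn H)) xs \<in> Obj (Pw (Suc 0) B)" using functor_rules(1)[OF fpow_fn xs] xs by (simp add: pow_sel)
    then show "on_ob (fcomp (Pw (Suc 0) A) (funit (Und B)) (fpow (Suc 0) (Und A) (fn H))) xs =
        on_ob (fcomp (Pw (Suc 0) A) (fn H) (funit (Und A))) xs"
      using xs by simp (simp add: pow_sel)
  next
    fix xs assume xs: "xs \<in> Arr (Pw (Suc 0) A)"
    have "map (on_ar (fn H)) xs \<in> Arr (Pw (Suc 0) B)" using functor_rules(2)[OF fpow_fn xs] xs by (simp add: pow_sel)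
    then show "on_ar (fcomp (Pw (Suc 0) A) (funit (Und B)) (fpow (Suc 0) (Und A) (fn H))) xs =
        on_ar (fcomp (Pw (Suc 0) A) (fn H) (funit (Und A))) xs"
      using xs by simp (simp add: pow_sel)
  qed simp_all
  have eq: "Comp (Und B) (cmp ?\<sigma> xs) (cmp ?\<tau> xs) = cmp ?\<upsilon> xs \<longleftrightarrow> ?P xs"
    if xs: "xs \<in> Obj (Pw (Suc 0) A)" for xs
    using cmp_hcomp_nid_right[OF ib(1) fpow_fn xs] cmp_hcomp_nid_left[OF ia(1) fn xs] xs
    by (simp del: hcomp_sel)
  \<comment> \<open>The right-hand side is a single whiskering and not a vertical composite, so
    \<open>vcomp_eq_iff\<close> does not apply and the two directions are argued separately.\<close>
  show ?thesis
  proof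
    assume *: "vcomp (Pw (Suc 0) A) (Und B) ?\<sigma> ?\<tau> = ?\<upsilon>"
    show "\<forall>xs \<in> Obj (Pw (Suc 0) A). ?P xs"
    proof
      fix xs assume xs: "xs \<in> Obj (Pw (Suc 0) A)"
      show "?P xs" using arg_cong[OF *, of "\<lambda>t. cmp t xs"] eq[OF xs] vcomp_sel(3)[OF xs] by metis
    qed
  next
    assume "\<forall>xs \<in> Obj (Pw (Suc 0) A). ?P xs"
    then show "vcomp (Pw (Suc 0) A) (Und B) ?\<sigma> ?\<tau> = ?\<upsilon>"
      using eq by (intro ntr_eqI[of _ _ "Obj (Pw (Suc 0) A)"])
        (simp_all only: vcomp_sel hcomp_sel(4) src tgt)
  qed
qed

lemma rho_Sb_iff:
  assumes w: "w \<in> words T" and f: "index_map (arity T w) l f"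
  shows "vcomp (Pw l A) (Und B)
        (hcomp (Pw l A) (Und B) (Sb B w l f) (nid (Pw l A) (Pw l B) (fpow l (Und A) (fn H))))
        (rho H (wsub T l f w)) =
      vcomp (Pw l A) (Und B)
        (nsub (Und A) l f (rho H w))
        (hcomp (Pw l A) (Und B) (nid (Und A) (Und B) (fn H)) (Sb A w l f)) \<longleftrightarrow>
    (\<forall>xs \<in> Obj (Pw l A).
      Comp (Und B) (cmp (Sb B w l f) (map (on_ob (fn H)) xs)) (cmp (rho H (wsub T l f w)) xs) =
      Comp (Und B) (cmp (rho H w) (reindex f xs)) (on_ar (fn H) (cmp (Sb A w l f) xs)))"
    (is "vcomp _ _ ?\<sigma> ?\<tau> = vcomp _ _ ?\<sigma>' ?\<tau>' \<longleftrightarrow> (\<forall>xs \<in> _. ?P xs)")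
proof -
  note sa = natural_isoD[OF A.Sb[OF w f]] and sb = natural_isoD[OF B.Sb[OF w f]]
  note rx = reindex_pow[OF f]
  have src: "src ?\<tau> = src ?\<tau>'" by (simp add: rho_src wsub_word[OF w f] sa(2))
  have fl: "set f \<subseteq> {..<l}" by (rule index_mapD(3)[OF f])
  have tgt: "tgt ?\<sigma> = tgt ?\<sigma>'"
    unfolding hcomp_sel nid_sel nsub_sel sb(3) rho_tgt[OF w]
  proof (rule ftr_eqI[of _ "Obj (Pw l A)" _ "Arr (Pw l A)"])
    fix xs assume xs: "xs \<in> Obj (Pw l A)"
    have 1: "map (on_ob (fn H)) xs \<in> Obj (Pw l B)" using functor_rules(1)[OF fpow_fn xs] xs by (simp add: pow_sel)
    have 2: "reindex f (map (on_ob (fn H)) xs) = map (on_ob (fn H)) (reindex f xs)"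
      using xs fl by (simp add: reindex_map pow_sel)
    show "on_ob (fcomp (Pw l A) (fsub (Und B) l f (Phi B w)) (fpow l (Und A) (fn H))) xs =
        on_ob (fsub (Und A) l f (fcomp (Pw (arity T w) A) (Phi B w) (fpow (arity T w) (Und A) (fn H)))) xs"
      using xs rx(1)[OF xs] 1 by (simp add: 2)
  next
    fix xs assume xs: "xs \<in> Arr (Pw l A)"
    have 1: "map (on_ar (fn H)) xs \<in> Arr (Pw l B)" using functor_rules(2)[OF fpow_fn xs] xs by (simp add: pow_sel)
    have 2: "reindex f (map (on_ar (fn H)) xs) = map (on_ar (fn H)) (reindex f xs)"
      using xs fl by (simp add: reindex_map pow_sel)
    show "on_ar (fcomp (Pw l A) (fsub (Und B) l f (Phi B w)) (fpow l (Und A) (fn H))) xs =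
        on_ar (fsub (Und A) l f (fcomp (Pw (arity T w) A) (Phi B w) (fpow (arity T w) (Und A) (fn H)))) xs"
      using xs rx(2)[OF xs] 1 by (simp add: 2)
  qed simp_all
  have "Comp (Und B) (cmp ?\<sigma> xs) (cmp ?\<tau> xs) = Comp (Und B) (cmp ?\<sigma>' xs) (cmp ?\<tau>' xs) \<longleftrightarrow> ?P xs"
    if xs: "xs \<in> Obj (Pw l A)" for xs
    using cmp_hcomp_nid_right[OF sb(1) fpow_fn xs] cmp_hcomp_nid_left[OF sa(1) fn xs] xs
    by (simp del: hcomp_sel)
  then show ?thesis unfolding vcomp_eq_iff using src tgt by auto
qed

text \<open>Collects the ends of the arrows in the equation for \<open>Co\<close>. Here
  \<open>hs\<close> is the image of \<open>xs\<close>, \<open>ps\<close> the list of values of the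
  inner operations on the blocks of \<open>xs\<close>, and \<open>rs\<close> the list of components
  of \<open>rho\<close> on these blocks. The last two items exhibit \<open>rs\<close> as an arrow of
  the power from the image of \<open>ps\<close> to the list of values on the blocks of
  \<open>hs\<close>.\<close>

lemma Co_typing:
  assumes c: "composable T w ws" and xs: "xs \<in> Obj (Pw (sum_list (map (arity T) ws)) A)"
  defines "ps \<equiv> map (\<lambda>i. on_ob (Phi A (ws ! i)) (reindex (block (map (arity T) ws) i) xs)) [0..<length ws]"
    and "rs \<equiv> map (\<lambda>i. cmp (rho H (ws ! i)) (reindex (block (map (arity T) ws) i) xs)) [0..<length ws]"
    and "hs \<equiv> map (on_ob (fn H)) xs"
  shows "ps \<in> Obj (Pw (arity T w) A)" "rs \<in> Arr (Pw (arity T w) B)"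
    "hs \<in> Obj (Pw (sum_list (map (arity T) ws)) B)"
    "cmp (Co A w ws) xs \<in> Arr (Und A)"
    "Dom (Und A) (cmp (Co A w ws) xs) = on_ob (Phi A (wgamma T w ws)) xs"
    "Cod (Und A) (cmp (Co A w ws) xs) = on_ob (Phi A w) ps"
    "cmp (Co B w ws) hs \<in> Arr (Und B)"
    "Dom (Und B) (cmp (Co B w ws) hs) = on_ob (Phi B (wgamma T w ws)) hs"
    "on_ar (Phi B w) rs \<in> Arr (Und B)"
    "Dom (Und B) (on_ar (Phi B w) rs) = on_ob (Phi B w) (map (on_ob (fn H)) ps)"
    "Cod (Und B) (on_ar (Phi B w) rs) = Cod (Und B) (cmp (Co B w ws) hs)"
    "Dom (Pw (arity T w) B) rs = map (on_ob (fn H)) ps"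
    "Cod (Pw (arity T w) B) rs =
      map (\<lambda>i. on_ob (Phi B (ws ! i)) (reindex (block (map (arity T) ws) i) hs)) [0..<length ws]"
proof -
  let ?ns = "map (arity T) ws"
  let ?x = "\<lambda>i. reindex (block ?ns i) xs" and ?y = "\<lambda>i. reindex (block ?ns i) hs"
  let ?qs = "map (\<lambda>i. on_ob (Phi B (ws ! i)) (?y i)) [0..<length ws]"
  note cD = composableD[OF c]
  note ca = natural_isoD[OF A.Co[OF c refl]] and cb = natural_isoD[OF B.Co[OF c refl]]
  have bl: "index_map (arity T (ws ! i)) (sum_list ?ns) (block ?ns i)" if "i < length ws" for i
    using index_map_block[of i ?ns] that by simp
  have x: "?x i \<in> Obj (Pw (arity T (ws ! i)) A)" if "i < length ws" for i
    by (rule reindex_pow(1)[OF bl[OF that] xs])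
  have y: "?y i = map (on_ob (fn H)) (?x i)" if "i < length ws" for i
    unfolding hs_def using index_mapD(3)[OF bl[OF that]] xs by (simp add: reindex_map pow_sel)
  note r = rho_rules[OF cD(2) x]
  show ps: "ps \<in> Obj (Pw (arity T w) A)"
    using functor_rules(1)[OF A.Phi[OF cD(2)] x] by (auto simp: pow_sel cD(3) ps_def)
  show hs: "hs \<in> Obj (Pw (sum_list ?ns) B)"
    using functor_rules(1)[OF fpow_fn xs] fpow_sel(1)[OF xs, of "fn H"] by (simp add: hs_def)
  show rs: "rs \<in> Arr (Pw (arity T w) B)" using r by (auto simp: pow_sel cD(3) rs_def)
  show dr: "Dom (Pw (arity T w) B) rs = map (on_ob (fn H)) ps"
    using r by (simp add: pow_sel rs_def ps_def)
  show cr: "Cod (Pw (arity T w) B) rs = ?qs"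
    using r y by (simp add: pow_sel rs_def)
  show "cmp (Co A w ws) xs \<in> Arr (Und A)"
    "Dom (Und A) (cmp (Co A w ws) xs) = on_ob (Phi A (wgamma T w ws)) xs"
    "Cod (Und A) (cmp (Co A w ws) xs) = on_ob (Phi A w) ps"
    using natural_rules[OF ca(1) xs] xs by (simp_all add: ca ps_def)
  show "cmp (Co B w ws) hs \<in> Arr (Und B)"
    "Dom (Und B) (cmp (Co B w ws) hs) = on_ob (Phi B (wgamma T w ws)) hs"
    using natural_rules(1,2)[OF cb(1) hs] by (simp_all add: cb)
  have "Cod (Und B) (cmp (Co B w ws) hs) = on_ob (Phi B w) ?qs"
    using natural_rules(3)[OF cb(1) hs] hs by (simp add: cb)
  then show "on_ar (Phi B w) rs \<in> Arr (Und B)"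
    "Dom (Und B) (on_ar (Phi B w) rs) = on_ob (Phi B w) (map (on_ob (fn H)) ps)"
    "Cod (Und B) (on_ar (Phi B w) rs) = Cod (Und B) (cmp (Co B w ws) hs)"
    using functor_rules(2-4)[OF B.Phi[OF cD(1)] rs] dr cr by simp_all
qed

end

lemma pseudo_morphism_premorphism:
  assumes "lawvere_theory T" "pseudo_algebra T A" "pseudo_algebra T B" and H: "pseudo_morphism T A B H"
  shows "premorphism T A B H"
proof -
  interpret pseudo_morphism T A B H by fact
  show ?thesis
    using assms by (auto simp: premorphism_def premorphism_axioms_def fn rho)
qed

text \<open>The working form of the definition: equations between arrows of \<open>Und B\<close>,
  indexed by lists of objects of \<open>Und A\<close>, with no composites of transformations
  left.\<close>

lemma pseudo_morphism_iff:
  assumes P: "premorphism T A B H"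
  shows "pseudo_morphism T A B H \<longleftrightarrow> rho H \<in> extensional (words T) \<and>
    (\<forall>w ws. composable T w ws \<longrightarrow> (\<forall>xs \<in> Obj (Pw (sum_list (map (arity T) ws)) A).
      Comp (Und B) (cmp (Co B w ws) (map (on_ob (fn H)) xs)) (cmp (rho H (wgamma T w ws)) xs) =
      Comp (Und B)
        (on_ar (Phi B w)
          (map (\<lambda>i. cmp (rho H (ws ! i)) (reindex (block (map (arity T) ws) i) xs)) [0..<length ws]))
        (Comp (Und B)
          (cmp (rho H w)
            (map (\<lambda>i. on_ob (Phi A (ws ! i)) (reindex (block (map (arity T) ws) i) xs)) [0..<length ws]))
          (on_ar (fn H) (cmp (Co A w ws) xs))))) \<and>
    (\<forall>xs \<in> Obj (Pw (Suc 0) A).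
      Comp (Und B) (cmp (Iu B) (map (on_ob (fn H)) xs)) (cmp (rho H (unit_word T)) xs) =
      on_ar (fn H) (cmp (Iu A) xs)) \<and>
    (\<forall>w l f. w \<in> words T \<longrightarrow> index_map (arity T w) l f \<longrightarrow> (\<forall>xs \<in> Obj (Pw l A).
      Comp (Und B) (cmp (Sb B w l f) (map (on_ob (fn H)) xs)) (cmp (rho H (wsub T l f w)) xs) =
      Comp (Und B) (cmp (rho H w) (reindex f xs)) (on_ar (fn H) (cmp (Sb A w l f) xs))))"
proof -
  interpret premorphism T A B H by fact
  show ?thesis
    unfolding pseudo_morphism_def
    using fn rho rho_Co_iff[OF _ refl refl] rho_Iu_iff rho_Sb_iff by (auto)
qed

text \<open>The ends of \<open>rho G w\<close> are determined by \<open>fn G\<close>, so once the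
  functors agree only components remain to be compared.\<close>

lemma psmor_eqI:
  assumes G: "premorphism T A B G" and H: "premorphism T A B H"
    and ext: "rho G \<in> extensional (words T)" "rho H \<in> extensional (words T)" and fn: "fn G = fn H"
    and rho: "\<And>w xs. w \<in> words T \<Longrightarrow> xs \<in> Obj (Pw (arity T w) A) \<Longrightarrow> cmp (rho G w) xs = cmp (rho H w) xs"
  shows "G = H"
proof (rule psmor.equality)
  interpret G: premorphism T A B G by fact
  interpret H: premorphism T A B H by fact
  show "rho G = rho H"
  proof (rule extensionalityI[OF ext])
    fix w assume w: "w \<in> words T"
    show "rho G w = rho H w"
      by (rule natural_eqI[OF G.rho_natural[OF w] H.rho_natural[OF w]])
        (simp_all add: G.rho_src H.rho_src G.rho_tgt H.rho_tgt fn w rho)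
  qed
qed (use fn in simp_all)

lemma pseudo_cell_condition_iff:
  assumes G: "premorphism T A B G" and H: "premorphism T A B H"
    and \<alpha>: "is_natural (Und A) (Und B) \<alpha>" "src \<alpha> = fn G" "tgt \<alpha> = fn H" and w: "w \<in> words T"
    and n: "n = arity T w"
  shows "vcomp (Pw n A) (Und B) (rho H w) (hcomp (Pw n A) (Und B) \<alpha> (idPhi T A w)) =
      vcomp (Pw n A) (Und B) (hcomp (Pw n A) (Und B) (idPhi T B w) (npow n (Und A) \<alpha>)) (rho G w) \<longleftrightarrow>
    (\<forall>xs \<in> Obj (Pw n A).
      Comp (Und B) (cmp (rho H w) xs) (cmp \<alpha> (on_ob (Phi A w) xs)) =
      Comp (Und B) (on_ar (Phi B w) (map (cmp \<alpha>) xs)) (cmp (rho G w) xs))"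
proof -
  interpret G: premorphism T A B G by fact
  interpret H: premorphism T A B H by fact
  have "cmp (hcomp (Pw n A) (Und B) \<alpha> (idPhi T A w)) xs = cmp \<alpha> (on_ob (Phi A w) xs)"
    if "xs \<in> Obj (Pw n A)" for xs
    using cmp_hcomp_nid_right[OF \<alpha>(1) G.A.Phi[OF w]] that by (simp add: idPhi_def n)
  moreover have "cmp (hcomp (Pw n A) (Und B) (idPhi T B w) (npow n (Und A) \<alpha>)) xs =
      on_ar (Phi B w) (map (cmp \<alpha>) xs)"
    if "xs \<in> Obj (Pw n A)" for xs
    using cmp_hcomp_nid_left[OF is_natural_npow[OF \<alpha>(1)] G.B.Phi[OF w]] that
    by (simp add: idPhi_def n)
  ultimately show ?thesis
    unfolding vcomp_eq_iff by (simp add: \<alpha> G.rho_src H.rho_tgt w n del: hcomp_sel(3))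
qed

lemma pseudo_cell_iff:
  assumes "lawvere_theory T" "pseudo_algebra T A" "pseudo_algebra T B"
  shows "pseudo_cell T A B G H \<alpha> \<longleftrightarrow> pseudo_morphism T A B G \<and> pseudo_morphism T A B H \<and>
     is_natural (Und A) (Und B) \<alpha> \<and> src \<alpha> = fn G \<and> tgt \<alpha> = fn H \<and>
     (\<forall>w \<in> words T. \<forall>xs \<in> Obj (Pw (arity T w) A).
      Comp (Und B) (cmp (rho H w) xs) (cmp \<alpha> (on_ob (Phi A w) xs)) =
      Comp (Und B) (on_ar (Phi B w) (map (cmp \<alpha>) xs)) (cmp (rho G w) xs))"
  using pseudo_cell_condition_iff[OF pseudo_morphism_premorphism[OF assms]
      pseudo_morphism_premorphism[OF assms] _ _ _ _ refl]
  unfolding pseudo_cell_def Let_def by blast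

section \<open>Composition of morphisms\<close>

locale composable_premorphisms =
  G: premorphism T A B G + H: premorphism T B D H
  for T :: "'t lawvere" and A :: "('t, 'o, 'a) psalg" and B :: "('t, 'p, 'b) psalg"
    and D :: "('t, 'q, 'c) psalg" and G :: "('t, 'o, 'a, 'p, 'b) psmor"
    and H :: "('t, 'p, 'b, 'q, 'c) psmor"
begin

abbreviation HG where "HG \<equiv> psmor_comp T A B D H G"

lemma fn_comp: "fn HG = fcomp (Und A) (fn H) (fn G)"
  by (simp add: psmor_comp_def)

lemma map_fn_Obj: "xs \<in> Obj (Pw n A) \<Longrightarrow> map (on_ob (fn G)) xs \<in> Obj (Pw n B)"
  using functor_rules(1)[OF G.fpow_fn] by fastforce

lemma cmp_rho_comp:
  assumes w: "w \<in> words T" and xs: "xs \<in> Obj (Pw (arity T w) A)"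
  shows "cmp (rho HG w) xs =
    Comp (Und D) (cmp (rho H w) (map (on_ob (fn G)) xs)) (on_ar (fn H) (cmp (rho G w) xs))"
  using cmp_hcomp_nid_right[OF H.rho_natural[OF w] G.fpow_fn xs]
    cmp_hcomp_nid_left[OF G.rho_natural[OF w] H.fn xs] w xs
  by (simp add: psmor_comp_def Let_def del: hcomp_sel(3))

lemma premorphism_comp: "premorphism T A D HG"
proof -
  have "natural_iso (Pw n A) (Und D) (fcomp (Pw n A) (fn HG) (Phi A w))
        (fcomp (Pw n A) (Phi D w) (fpow n (Und A) (fn HG))) (rho HG w)"
    if w: "w \<in> words T" and n: "n = arity T w" for w n
  proof -
    note Gw = G.rho_natural[OF w, folded n] and Hw = H.rho_natural[OF w, folded n]
    note PA = G.A.Phi[OF w, folded n] and PB = G.B.Phi[OF w, folded n] and PD = H.B.Phi[OF w, folded n]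
    let ?s = "hcomp (Pw n A) (Und D) (rho H w) (nid (Pw n A) (Pw n B) (fpow n (Und A) (fn G)))"
    let ?t = "hcomp (Pw n A) (Und D) (nid (Und B) (Und D) (fn H)) (rho G w)"
    have r: "rho HG w = vcomp (Pw n A) (Und D) ?s ?t"
      using w n by (simp add: psmor_comp_def Let_def)
    \<comment> \<open>The two halves meet at \<open>fn H\<close> after \<open>Phi B w\<close> after
      the power of \<open>fn G\<close>, bracketed in two ways.\<close>
    have st: "tgt ?t = src ?s"
      by (simp add: G.rho_tgt H.rho_src w n fcomp_assoc[OF G.fpow_fn])
    have nat: "is_natural (Pw n A) (Und D) (rho HG w)"
      unfolding r using st
      by (intro is_natural_vcomp is_natural_hcomp[OF is_natural_nid[OF G.fpow_fn] Hw]
          is_natural_hcomp[OF Gw is_natural_nid[OF H.fn]])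
    have src: "src (rho HG w) = fcomp (Pw n A) (fn HG) (Phi A w)"
      unfolding r fn_comp by (simp add: G.rho_src w fcomp_assoc[OF PA] n[symmetric])
    have tgt: "tgt (rho HG w) = fcomp (Pw n A) (Phi D w) (fpow n (Und A) (fn HG))"
      unfolding r fn_comp vcomp_sel hcomp_sel H.rho_tgt[OF w] n[symmetric] nid_sel
    proof (rule ftr_eqI[of _ "Obj (Pw n A)" _ "Arr (Pw n A)"])
      fix xs assume xs: "xs \<in> Obj (Pw n A)"
      then have e: "map (on_ob (fcomp (Und A) (fn H) (fn G))) xs = map (on_ob (fn H)) (map (on_ob (fn G)) xs)"
        by (auto simp: pow_sel)
      show "on_ob (fcomp (Pw n A) (fcomp (Pw n B) (Phi D w) (fpow n (Und B) (fn H)))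
            (fpow n (Und A) (fn G))) xs =
          on_ob (fcomp (Pw n A) (Phi D w) (fpow n (Und A) (fcomp (Und A) (fn H) (fn G)))) xs"
        using xs map_fn_Obj[OF xs] by (simp add: e del: map_map)
    next
      fix xs assume xs: "xs \<in> Arr (Pw n A)"
      then have e: "map (on_ar (fcomp (Und A) (fn H) (fn G))) xs = map (on_ar (fn H)) (map (on_ar (fn G)) xs)"
        by (auto simp: pow_sel)
      show "on_ar (fcomp (Pw n A) (fcomp (Pw n B) (Phi D w) (fpow n (Und B) (fn H)))
            (fpow n (Und A) (fn G))) xs =
          on_ar (fcomp (Pw n A) (Phi D w) (fpow n (Und A) (fcomp (Und A) (fn H) (fn G)))) xs"
        using xs functor_rules(2)[OF G.fpow_fn xs] by (simp add: e del: map_map)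
    qed simp_all
    have "iso (Und D) (cmp (rho HG w) xs)" if xs: "xs \<in> Obj (Pw n A)" for xs
    proof -
      note xs' = xs[unfolded n] and ys = map_fn_Obj[OF xs, unfolded n]
      show ?thesis
        unfolding cmp_rho_comp[OF w xs']
        using functor_rules[OF H.fn] G.rho_rules[OF w xs'] H.rho_rules[OF w ys]
        by (intro iso_Comp H.B.Und natural_isoD(4)[OF H.rho[OF w] ys] iso_functor[OF H.fn]
            natural_isoD(4)[OF G.rho[OF w] xs']) simp
    qed
    with nat src tgt show ?thesis by (simp add: natural_iso_def)
  qed
  then show ?thesis
    by (intro premorphism.intro premorphism_axioms.intro) (auto simp: fn_comp
      intro: is_functor_fcomp[OF G.fn H.fn] G.lawvere_theory_axioms G.A.pseudo_algebra_axioms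
        H.B.pseudo_algebra_axioms)
qed

end

text \<open>The diagram behind the \<open>Co\<close> equation of a composite: \<open>1\<close> is
  the equation for the second morphism, \<open>2\<close> the image under it of the equation for the
  first, and \<open>3\<close> a naturality square of its \<open>rho\<close>. Stated for arbitrary
  arrows, the many composability conditions stay short.\<close>

lemma coherence_pasting:
  assumes "category Z"
    and "a1 \<in> Arr Z" "a2 \<in> Arr Z" "a3 \<in> Arr Z" "b1 \<in> Arr Z" "b2 \<in> Arr Z" "b3 \<in> Arr Z"
      "d1 \<in> Arr Z" "d2 \<in> Arr Z" "d3 \<in> Arr Z" "e1 \<in> Arr Z" "e2 \<in> Arr Z"
    and "Dom Z a1 = Cod Z a2" "Dom Z a2 = Cod Z a3" "Dom Z b1 = Cod Z b2" "Dom Z b2 = Cod Z b3"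
      "Dom Z b3 = Cod Z a3" "Dom Z d1 = Cod Z d2" "Dom Z d2 = Cod Z d3" "Dom Z b2 = Cod Z d1"
      "Dom Z b1 = Cod Z e1" "Dom Z e1 = Cod Z e2" "Dom Z e2 = Cod Z d2"
    and 1: "Comp Z a1 a2 = Comp Z b1 (Comp Z b2 b3)"
    and 2: "Comp Z b3 a3 = Comp Z d1 (Comp Z d2 d3)"
    and 3: "Comp Z b2 d1 = Comp Z e1 e2"
  shows "Comp Z a1 (Comp Z a2 a3) = Comp Z (Comp Z b1 e1) (Comp Z (Comp Z e2 d2) d3)"
proof -
  note [simp] = cat_rules[OF assms(1)] assms(2-23)
  have "Comp Z a1 (Comp Z a2 a3) = Comp Z (Comp Z a1 a2) a3" by simp
  also have "\<dots> = Comp Z b1 (Comp Z b2 (Comp Z b3 a3))" unfolding 1 using assms(16,17) by simp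
  also have "\<dots> = Comp Z b1 (Comp Z (Comp Z b2 d1) (Comp Z d2 d3))" unfolding 2 using assms(20) by simp
  also have "\<dots> = Comp Z (Comp Z b1 e1) (Comp Z (Comp Z e2 d2) d3)" unfolding 3 using assms(21) by simp
  finally show ?thesis .
qed

text \<open>Each equation for the composite results from the equation for \<open>H\<close> at the
  image of the list under \<open>G\<close>, pasted with the image under \<open>H\<close> of the
  equation for \<open>G\<close>. For \<open>Co\<close> a naturality square of \<open>rho H w\<close>
  has to be inserted, because this transformation occurs at two different lists.\<close>

lemma pseudo_morphism_comp:
  assumes TAB: "lawvere_theory T" "pseudo_algebra T A" "pseudo_algebra T B" "pseudo_algebra T D"
    and G: "pseudo_morphism T A B G" and H: "pseudo_morphism T B D H"
  shows "pseudo_morphism T A D (psmor_comp T A B D H G)"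
proof -
  interpret composable_premorphisms T A B D G H
    by (intro composable_premorphisms.intro pseudo_morphism_premorphism assms)
  note [simp] = cat_rules[OF H.B.Und] functor_rules[OF H.fn] functor_rules[OF G.fn]
  note Gc = G[unfolded pseudo_morphism_iff[OF G.premorphism_axioms], THEN conjunct2]
  note G_Co = Gc[THEN conjunct1, rule_format]
    and G_Iu = Gc[THEN conjunct2, THEN conjunct1, rule_format]
    and G_Sb = Gc[THEN conjunct2, THEN conjunct2, rule_format]
  note Hc = H[unfolded pseudo_morphism_iff[OF H.premorphism_axioms], THEN conjunct2]
  note H_Co = Hc[THEN conjunct1, rule_format]
    and H_Iu = Hc[THEN conjunct2, THEN conjunct1, rule_format]
    and H_Sb = Hc[THEN conjunct2, THEN conjunct2, rule_format]
  show ?thesis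
    unfolding pseudo_morphism_iff[OF premorphism_comp]
  proof (intro conjI allI impI ballI)
    show "rho HG \<in> extensional (words T)" by (simp add: psmor_comp_def)
  next
    fix w ws xs assume c: "composable T w ws" and xs: "xs \<in> Obj (Pw (sum_list (map (arity T) ws)) A)"
    let ?ns = "map (arity T) ws"
    let ?xs = "\<lambda>i. reindex (block ?ns i) xs"
    let ?ys = "map (on_ob (fn G)) xs"
    let ?y = "\<lambda>i. reindex (block ?ns i) ?ys"
    let ?cA = "cmp (Co A w ws) xs" and ?cB = "cmp (Co B w ws) ?ys"
    let ?ps = "map (\<lambda>i. on_ob (Phi A (ws ! i)) (?xs i)) [0..<length ws]"
    let ?qs = "map (\<lambda>i. on_ob (Phi B (ws ! i)) (?y i)) [0..<length ws]"
    let ?rG = "map (\<lambda>i. cmp (rho G (ws ! i)) (?xs i)) [0..<length ws]"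
    let ?rH = "map (\<lambda>i. cmp (rho H (ws ! i)) (?y i)) [0..<length ws]"
    note cD = composableD[OF c] and \<gamma> = G.wgamma_word[OF c]
    note tG = G.Co_typing[OF c xs] and tH = H.Co_typing[OF c map_fn_Obj[OF xs]]
    note ps = tG(1) and rGs = tG(2,12,13) and cA = tG(4-6)
    have bl: "index_map (arity T (ws ! i)) (sum_list ?ns) (block ?ns i)" if "i < length ws" for i
      using index_map_block[of i ?ns] that by simp
    have x: "?xs i \<in> Obj (Pw (arity T (ws ! i)) A)" if "i < length ws" for i
      by (rule reindex_pow(1)[OF bl[OF that] xs])
    have yx: "?y i = map (on_ob (fn G)) (?xs i)" if "i < length ws" for i
      using index_mapD(3)[OF bl[OF that]] xs by (simp add: reindex_map pow_sel)
    have xs\<gamma>: "xs \<in> Obj (Pw (arity T (wgamma T w ws)) A)" and ys\<gamma>: "?ys \<in> Obj (Pw (arity T (wgamma T w ws)) B)"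
      using xs tH(3) map_fn_Obj[OF xs] by (simp_all add: \<gamma>)
    have zs: "map (on_ob (fn H)) (map (on_ob (fn G)) as) = map (on_ob (fn HG)) as"
      if "as \<in> Obj (Pw n A)" for as n
      using that by (auto simp: fn_comp pow_sel)
    note hrG = functor_rules(2-4)[OF H.fpow_fn rGs(1), unfolded rGs(2,3)]
    have hr: "on_ar (fpow (arity T w) (Und B) (fn H)) ?rG = map (on_ar (fn H)) ?rG"
      "on_ob (fpow (arity T w) (Und B) (fn H)) (map (on_ob (fn G)) ?ps) = map (on_ob (fn HG)) ?ps"
      "on_ob (fpow (arity T w) (Und B) (fn H)) ?qs = map (on_ob (fn H)) ?qs"
      by (simp_all only: fpow_sel(2)[OF rGs(1)] fpow_sel(1)[OF map_fn_Obj[OF ps]] fpow_sel(1)[OF tH(1)] zs[OF ps])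
    note hrG = hrG[unfolded hr]
    note PhiD = functor_rules[OF H.B.Phi[OF cD(1)]]
    note PhiD_hrG = PhiD(2-4)[OF hrG(1), unfolded hrG(2,3)]
    note rGw = G.rho_rules[OF cD(1) ps]
    note rG\<gamma> = G.rho_rules[OF \<gamma>(1) xs\<gamma>] and rH\<gamma> = H.rho_rules[OF \<gamma>(1) ys\<gamma>]
    note rHq = H.rho_rules[OF cD(1) tH(1)] and rHp = H.rho_rules[OF cD(1) map_fn_Obj[OF ps], unfolded zs[OF ps]]
    note typing = cA tG(7-11) tH(4-11)[unfolded zs[OF xs]] rG\<gamma> rH\<gamma>[unfolded zs[OF xs]] rGw PhiD_hrG rHq rHp
    \<comment> \<open>The required equation with the \<open>rho\<close> of the composite written
      out, and with the image of the list of inner components already split into its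
      \<open>H\<close> and \<open>G\<close> parts.\<close>
    have "Comp (Und D) (cmp (Co D w ws) (map (on_ob (fn HG)) xs))
        (Comp (Und D) (cmp (rho H (wgamma T w ws)) ?ys) (on_ar (fn H) (cmp (rho G (wgamma T w ws)) xs))) =
      Comp (Und D) (Comp (Und D) (on_ar (Phi D w) ?rH) (on_ar (Phi D w) (map (on_ar (fn H)) ?rG)))
        (Comp (Und D) (Comp (Und D) (cmp (rho H w) (map (on_ob (fn G)) ?ps)) (on_ar (fn H) (cmp (rho G w) ?ps)))
          (on_ar (fn H) (on_ar (fn G) ?cA)))"
    proof (rule coherence_pasting[OF H.B.Und])
      show "Comp (Und D) (cmp (Co D w ws) (map (on_ob (fn HG)) xs)) (cmp (rho H (wgamma T w ws)) ?ys) =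
          Comp (Und D) (on_ar (Phi D w) ?rH) (Comp (Und D) (cmp (rho H w) ?qs) (on_ar (fn H) ?cB))"
        using H_Co[OF c map_fn_Obj[OF xs]] unfolding zs[OF xs] .
      have "Comp (Und B) ?cB (cmp (rho G (wgamma T w ws)) xs) =
          Comp (Und B) (on_ar (Phi B w) ?rG) (Comp (Und B) (cmp (rho G w) ?ps) (on_ar (fn G) ?cA))"
        by (rule G_Co[OF c xs])
      then have "on_ar (fn H) (Comp (Und B) ?cB (cmp (rho G (wgamma T w ws)) xs)) =
          on_ar (fn H) (Comp (Und B) (on_ar (Phi B w) ?rG) (Comp (Und B) (cmp (rho G w) ?ps) (on_ar (fn G) ?cA)))"
        by (rule arg_cong)
      then show "Comp (Und D) (on_ar (fn H) ?cB) (on_ar (fn H) (cmp (rho G (wgamma T w ws)) xs)) =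
          Comp (Und D) (on_ar (fn H) (on_ar (Phi B w) ?rG))
            (Comp (Und D) (on_ar (fn H) (cmp (rho G w) ?ps)) (on_ar (fn H) (on_ar (fn G) ?cA)))"
        using typing cat_rules(6-8)[OF G.B.Und] by (simp del: map_map)
      \<comment> \<open>Naturality of \<open>rho H w\<close> at the list \<open>?rG\<close>, which
        is an arrow of a power of \<open>Und B\<close>.\<close>
      show "Comp (Und D) (cmp (rho H w) ?qs) (on_ar (fn H) (on_ar (Phi B w) ?rG)) =
          Comp (Und D) (on_ar (Phi D w) (map (on_ar (fn H)) ?rG)) (cmp (rho H w) (map (on_ob (fn G)) ?ps))"
        using H.rho_naturality[OF cD(1) rGs(1)] rGs(2,3) unfolding pow_sel by (simp only:)
    qed (use typing in \<open>simp_all del: map_map\<close>)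
    \<comment> \<open>The components of the composite on the blocks form a composite in the power of
      \<open>Und D\<close>, and \<open>Phi D w\<close> preserves it.\<close>
    moreover have "on_ar (Phi D w) (map (\<lambda>i. cmp (rho HG (ws ! i)) (?xs i)) [0..<length ws]) =
        Comp (Und D) (on_ar (Phi D w) ?rH) (on_ar (Phi D w) (map (on_ar (fn H)) ?rG))"
    proof -
      have "map (\<lambda>i. cmp (rho HG (ws ! i)) (?xs i)) [0..<length ws] =
        Comp (Pw (arity T w) D) ?rH (map (on_ar (fn H)) ?rG)"
      proof (rule nth_equalityI)
        fix i assume "i < length (map (\<lambda>i. cmp (rho HG (ws ! i)) (?xs i)) [0..<length ws])"
        then have i: "i < length ws" by simp
        show "map (\<lambda>i. cmp (rho HG (ws ! i)) (?xs i)) [0..<length ws] ! i =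
          Comp (Pw (arity T w) D) ?rH (map (on_ar (fn H)) ?rG) ! i"
          using cmp_rho_comp[OF cD(2)[OF i] x[OF i]] yx[OF i] i by (simp add: pow_sel)
      qed (simp add: pow_sel)
      moreover have "Dom (Pw (arity T w) D) ?rH = Cod (Pw (arity T w) D) (map (on_ar (fn H)) ?rG)"
        unfolding tH(12) hrG(3) ..
      ultimately show ?thesis using PhiD(6)[OF hrG(1) tH(2)] by (simp only:)
    qed
    moreover have "on_ar (fn HG) ?cA = on_ar (fn H) (on_ar (fn G) ?cA)"
      using cA by (simp add: fn_comp)
    ultimately show "Comp (Und D) (cmp (Co D w ws) (map (on_ob (fn HG)) xs)) (cmp (rho HG (wgamma T w ws)) xs) =
      Comp (Und D) (on_ar (Phi D w) (map (\<lambda>i. cmp (rho HG (ws ! i)) (?xs i)) [0..<length ws]))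
        (Comp (Und D) (cmp (rho HG w) ?ps) (on_ar (fn HG) ?cA))"
      unfolding cmp_rho_comp[OF \<gamma>(1) xs\<gamma>] cmp_rho_comp[OF cD(1) ps] by (simp only:)
  next
    fix xs assume xs: "xs \<in> Obj (Pw (Suc 0) A)"
    let ?ys = "map (on_ob (fn G)) xs"
    have ys: "?ys \<in> Obj (Pw (Suc 0) B)" by (rule map_fn_Obj[OF xs])
    note u = G.unit_word
    have zs: "map (on_ob (fn H)) ?ys = map (on_ob (fn HG)) xs" "map (on_ob (fn HG)) xs \<in> Obj (Pw (Suc 0) D)"
      using xs functor_rules(1)[OF premorphism.fpow_fn[OF premorphism_comp] xs]
      by (auto simp: fn_comp pow_sel)
    have xs': "xs \<in> Obj (Pw (arity T (unit_word T)) A)" and ys': "?ys \<in> Obj (Pw (arity T (unit_word T)) B)"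
      using xs ys by (simp_all add: u)
    have [simp]: "cmp (Iu A) xs \<in> Arr (Und A)"
      using natural_rules(1)[OF natural_isoD(1)[OF G.A.Iu[unfolded One_nat_def]] xs] .
    have [simp]: "cmp (Iu B) ?ys \<in> Arr (Und B)"
      "Dom (Und B) (cmp (Iu B) ?ys) = on_ob (Phi B (unit_word T)) ?ys"
      using natural_rules(1,2)[OF natural_isoD(1)[OF G.B.Iu[unfolded One_nat_def]] ys] natural_isoD(2)[OF G.B.Iu[unfolded One_nat_def]] by simp_all
    have [simp]: "cmp (Iu D) (map (on_ob (fn HG)) xs) \<in> Arr (Und D)"
      "Dom (Und D) (cmp (Iu D) (map (on_ob (fn HG)) xs)) = on_ob (Phi D (unit_word T)) (map (on_ob (fn HG)) xs)"
      using natural_rules(1,2)[OF natural_isoD(1)[OF H.B.Iu[unfolded One_nat_def]] zs(2)] natural_isoD(2)[OF H.B.Iu[unfolded One_nat_def]] by simp_all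
    note [simp] = G.rho_rules[OF u(1) xs'] and rH = H.rho_rules[OF u(1) ys']
    note [simp] = rH(1,2) rH(3)[unfolded zs(1)]
    have 1: "Comp (Und D) (cmp (Iu D) (map (on_ob (fn HG)) xs)) (cmp (rho H (unit_word T)) ?ys) =
        on_ar (fn H) (cmp (Iu B) ?ys)"
      using H_Iu[OF ys] unfolding zs(1) .
    have 2: "Comp (Und B) (cmp (Iu B) ?ys) (cmp (rho G (unit_word T)) xs) = on_ar (fn G) (cmp (Iu A) xs)"
      by (rule G_Iu[OF xs])
    have "Comp (Und D) (cmp (Iu D) (map (on_ob (fn HG)) xs)) (cmp (rho HG (unit_word T)) xs) =
      Comp (Und D) (Comp (Und D) (cmp (Iu D) (map (on_ob (fn HG)) xs)) (cmp (rho H (unit_word T)) ?ys))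
        (on_ar (fn H) (cmp (rho G (unit_word T)) xs))"
      unfolding cmp_rho_comp[OF u(1) xs'] by (simp del: map_map)
    also have "\<dots> = on_ar (fn H) (Comp (Und B) (cmp (Iu B) ?ys) (cmp (rho G (unit_word T)) xs))"
      unfolding 1 by simp
    also have "\<dots> = on_ar (fn HG) (cmp (Iu A) xs)" unfolding 2 by (simp add: fn_comp)
    finally show "Comp (Und D) (cmp (Iu D) (map (on_ob (fn HG)) xs)) (cmp (rho HG (unit_word T)) xs) =
      on_ar (fn HG) (cmp (Iu A) xs)" .
  next
    fix w l f xs assume w: "w \<in> words T" and f: "index_map (arity T w) l f" and xs: "xs \<in> Obj (Pw l A)"
    let ?ys = "map (on_ob (fn G)) xs" and ?v = "wsub T l f w"
    note u = G.wsub_word[OF w f]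
    have ys: "?ys \<in> Obj (Pw l B)" by (rule map_fn_Obj[OF xs])
    have zs: "map (on_ob (fn H)) ?ys = map (on_ob (fn HG)) xs" "map (on_ob (fn HG)) xs \<in> Obj (Pw l D)"
      using xs functor_rules(1)[OF premorphism.fpow_fn[OF premorphism_comp] xs]
      by (auto simp: fn_comp pow_sel)
    have xs': "xs \<in> Obj (Pw (arity T ?v) A)" and ys': "?ys \<in> Obj (Pw (arity T ?v) B)"
      using xs ys by (simp_all add: u)
    have fx: "reindex f xs \<in> Obj (Pw (arity T w) A)" and fy: "reindex f ?ys \<in> Obj (Pw (arity T w) B)"
      by (rule reindex_pow(1)[OF f] xs ys)+
    have fyx: "reindex f ?ys = map (on_ob (fn G)) (reindex f xs)"
      using index_mapD(3)[OF f] xs by (simp add: reindex_map pow_sel)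
    note sa = natural_isoD[OF G.A.Sb[OF w f]] and sb = natural_isoD[OF G.B.Sb[OF w f]]
      and sd = natural_isoD[OF H.B.Sb[OF w f]]
    have [simp]: "cmp (Sb A w l f) xs \<in> Arr (Und A)"
      "Cod (Und A) (cmp (Sb A w l f) xs) = on_ob (Phi A w) (reindex f xs)"
      using natural_rules(1,3)[OF sa(1) xs] xs sa(3) by simp_all
    have [simp]: "cmp (Sb B w l f) ?ys \<in> Arr (Und B)"
      "Dom (Und B) (cmp (Sb B w l f) ?ys) = on_ob (Phi B ?v) ?ys"
      "Cod (Und B) (cmp (Sb B w l f) ?ys) = on_ob (Phi B w) (reindex f ?ys)"
      using natural_rules[OF sb(1) ys] ys sb(2,3) by simp_all
    have [simp]: "cmp (Sb D w l f) (map (on_ob (fn HG)) xs) \<in> Arr (Und D)"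
      "Dom (Und D) (cmp (Sb D w l f) (map (on_ob (fn HG)) xs)) = on_ob (Phi D ?v) (map (on_ob (fn HG)) xs)"
      using natural_rules(1,2)[OF sd(1) zs(2)] sd(2) by simp_all
    note [simp] = G.rho_rules[OF u(1) xs'] and rH = H.rho_rules[OF u(1) ys']
    note [simp] = rH(1,2) rH(3)[unfolded zs(1)] and rGf = G.rho_rules[OF w fx]
    note [simp] = rGf(1,2) rGf(3)[folded fyx] H.rho_rules[OF w fy]
    have 1: "Comp (Und D) (cmp (Sb D w l f) (map (on_ob (fn HG)) xs)) (cmp (rho H ?v) ?ys) =
        Comp (Und D) (cmp (rho H w) (reindex f ?ys)) (on_ar (fn H) (cmp (Sb B w l f) ?ys))"
      using H_Sb[OF w f ys] unfolding zs(1) .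
    have 2: "Comp (Und B) (cmp (Sb B w l f) ?ys) (cmp (rho G ?v) xs) =
        Comp (Und B) (cmp (rho G w) (reindex f xs)) (on_ar (fn G) (cmp (Sb A w l f) xs))"
      by (rule G_Sb[OF w f xs])
    have "Comp (Und D) (cmp (Sb D w l f) (map (on_ob (fn HG)) xs)) (cmp (rho HG ?v) xs) =
      Comp (Und D) (Comp (Und D) (cmp (Sb D w l f) (map (on_ob (fn HG)) xs)) (cmp (rho H ?v) ?ys))
        (on_ar (fn H) (cmp (rho G ?v) xs))"
      unfolding cmp_rho_comp[OF u(1) xs'] by (simp del: map_map)
    also have "\<dots> = Comp (Und D) (cmp (rho H w) (reindex f ?ys))
        (on_ar (fn H) (Comp (Und B) (cmp (Sb B w l f) ?ys) (cmp (rho G ?v) xs)))"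
      unfolding 1 by simp
    also have "\<dots> = Comp (Und D) (cmp (rho HG w) (reindex f xs)) (on_ar (fn HG) (cmp (Sb A w l f) xs))"
      unfolding 2 cmp_rho_comp[OF w fx] fyx[symmetric] by (simp add: fn_comp)
    finally show "Comp (Und D) (cmp (Sb D w l f) (map (on_ob (fn HG)) xs)) (cmp (rho HG ?v) xs) =
        Comp (Und D) (cmp (rho HG w) (reindex f xs)) (on_ar (fn HG) (cmp (Sb A w l f) xs))" .
  qed
qed

section \<open>The 2-category of pseudo algebras\<close>

lemma psalg_hom_sel [simp]:
  "Obj (psalg_hom T A B) = {H. pseudo_morphism T A B H}"
  "(G, H, \<alpha>) \<in> Arr (psalg_hom T A B) \<longleftrightarrow> pseudo_cell T A B G H \<alpha>"
  "Dom (psalg_hom T A B) (G, H, \<alpha>) = G" "Cod (psalg_hom T A B) (G, H, \<alpha>) = H"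
  "Idn (psalg_hom T A B) H = (H, H, nid (Und A) (Und B) (fn H))"
  "Comp (psalg_hom T A B) (H, K, \<beta>) (G, H', \<alpha>) = (G, K, vcomp (Und A) (Und B) \<beta> \<alpha>)"
  by (simp_all add: psalg_hom_def)

lemma (in premorphism) nid_cell:
  assumes w: "w \<in> words T" and xs: "xs \<in> Obj (Pw (arity T w) A)"
  shows "on_ar (Phi B w) (map (cmp (nid (Und A) (Und B) (fn H))) xs) =
    Idn (Und B) (on_ob (Phi B w) (map (on_ob (fn H)) xs))"
proof -
  have "map (cmp (nid (Und A) (Und B) (fn H))) xs = Idn (Pw (arity T w) B) (map (on_ob (fn H)) xs)"
    using xs by (auto simp: pow_sel)
  moreover have "map (on_ob (fn H)) xs \<in> Obj (Pw (arity T w) B)"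
    using functor_rules(1)[OF fpow_fn xs] xs by simp
  ultimately show ?thesis using functor_rules(5)[OF B.Phi[OF w]] by simp
qed

lemma pseudo_cell_nid:
  assumes TAB: "lawvere_theory T" "pseudo_algebra T A" "pseudo_algebra T B"
    and H: "pseudo_morphism T A B H"
  shows "pseudo_cell T A B H H (nid (Und A) (Und B) (fn H))"
proof -
  interpret premorphism T A B H by (rule pseudo_morphism_premorphism[OF TAB H])
  have "is_natural (Und A) (Und B) (nid (Und A) (Und B) (fn H))" by (rule is_natural_nid[OF fn])
  moreover have "Comp (Und B) (cmp (rho H w) xs)
      (cmp (nid (Und A) (Und B) (fn H)) (on_ob (Phi A w) xs)) =
    Comp (Und B) (on_ar (Phi B w) (map (cmp (nid (Und A) (Und B) (fn H))) xs)) (cmp (rho H w) xs)"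
    if w: "w \<in> words T" and xs: "xs \<in> Obj (Pw (arity T w) A)" for w xs
    unfolding nid_cell[OF w xs]
    using rho_rules[OF w xs] functor_rules(1)[OF A.Phi[OF w] xs] by (simp add: cat_rules[OF B.Und])
  ultimately show ?thesis unfolding pseudo_cell_iff[OF TAB] using H by simp
qed

text \<open>The squares for \<alpha> and \<beta> are placed next to each other;
  \<open>Phi B w\<close> takes the composite of the two lists of components to a composite in
  \<open>Und B\<close>.\<close>

lemma pseudo_cell_vcomp:
  assumes TAB: "lawvere_theory T" "pseudo_algebra T A" "pseudo_algebra T B"
    and \<alpha>: "pseudo_cell T A B G H \<alpha>" and \<beta>: "pseudo_cell T A B H K \<beta>"
  shows "pseudo_cell T A B G K (vcomp (Und A) (Und B) \<beta> \<alpha>)"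
proof -
  note ca = \<alpha>[unfolded pseudo_cell_iff[OF TAB]] and cb = \<beta>[unfolded pseudo_cell_iff[OF TAB]]
  interpret G: premorphism T A B G using pseudo_morphism_premorphism[OF TAB] ca by blast
  interpret H: premorphism T A B H using pseudo_morphism_premorphism[OF TAB] ca by blast
  interpret K: premorphism T A B K using pseudo_morphism_premorphism[OF TAB] cb by blast
  have na: "is_natural (Und A) (Und B) \<alpha>" and nb: "is_natural (Und A) (Und B) \<beta>"
    and st: "src \<alpha> = fn G" "tgt \<alpha> = fn H" "src \<beta> = fn H" "tgt \<beta> = fn K" using ca cb by auto
  note [simp] = cat_rules[OF G.B.Und] st natural_rules[OF na] natural_rules[OF nb]
  have "Comp (Und B) (cmp (rho K w) xs) (Comp (Und B) (cmp \<beta> (on_ob (Phi A w) xs)) (cmp \<alpha> (on_ob (Phi A w) xs))) =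
      Comp (Und B) (on_ar (Phi B w) (map (cmp (vcomp (Und A) (Und B) \<beta> \<alpha>)) xs)) (cmp (rho G w) xs)"
    if w: "w \<in> words T" and xs: "xs \<in> Obj (Pw (arity T w) A)" for w xs
  proof -
    let ?\<alpha> = "map (cmp \<alpha>) xs" and ?\<beta> = "map (cmp \<beta>) xs"
    note [simp] = G.rho_rules[OF w xs] H.rho_rules[OF w xs] K.rho_rules[OF w xs]
      functor_rules(1)[OF G.A.Phi[OF w] xs]
    have l: "?\<alpha> \<in> Arr (Pw (arity T w) B)" "?\<beta> \<in> Arr (Pw (arity T w) B)"
      "Dom (Pw (arity T w) B) ?\<alpha> = map (on_ob (fn G)) xs" "Cod (Pw (arity T w) B) ?\<alpha> = map (on_ob (fn H)) xs"
      "Dom (Pw (arity T w) B) ?\<beta> = map (on_ob (fn H)) xs" "Cod (Pw (arity T w) B) ?\<beta> = map (on_ob (fn K)) xs"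
      using xs by (auto simp: pow_sel)
    note [simp] = functor_rules(2,3,4)[OF G.B.Phi[OF w] l(1)] functor_rules(2,3,4)[OF G.B.Phi[OF w] l(2)] l(3-6)
    have m: "map (cmp (vcomp (Und A) (Und B) \<beta> \<alpha>)) xs = Comp (Pw (arity T w) B) ?\<beta> ?\<alpha>"
      using xs by (auto simp: pow_sel list_eq_iff_nth_eq subset_set_conv_nth)
    have "on_ar (Phi B w) (map (cmp (vcomp (Und A) (Und B) \<beta> \<alpha>)) xs) =
        Comp (Und B) (on_ar (Phi B w) ?\<beta>) (on_ar (Phi B w) ?\<alpha>)"
      unfolding m by (rule functor_rules(6)[OF G.B.Phi[OF w] l(1,2)]) simp
    moreover have "Comp (Und B) (cmp (rho H w) xs) (cmp \<alpha> (on_ob (Phi A w) xs)) =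
        Comp (Und B) (on_ar (Phi B w) ?\<alpha>) (cmp (rho G w) xs)" using ca w xs by blast
    moreover have "Comp (Und B) (Comp (Und B) (cmp (rho K w) xs) (cmp \<beta> (on_ob (Phi A w) xs))) (cmp \<alpha> (on_ob (Phi A w) xs)) =
        Comp (Und B) (Comp (Und B) (on_ar (Phi B w) ?\<beta>) (cmp (rho H w) xs)) (cmp \<alpha> (on_ob (Phi A w) xs))"
      using cb w xs by simp
    ultimately show ?thesis by simp
  qed
  moreover have "on_ob (Phi A w) xs \<in> Obj (Und A)" if "w \<in> words T" "xs \<in> Obj (Pw (arity T w) A)" for w xs
    using functor_rules(1)[OF G.A.Phi[OF that(1)] that(2)] .
  ultimately show ?thesis
    unfolding pseudo_cell_iff[OF TAB] using ca cb is_natural_vcomp[OF na nb] by simp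
qed

lemma category_psalg_hom:
  fixes T :: "'t lawvere" and A :: "('t, 'o, 'a) psalg" and B :: "('t, 'p, 'b) psalg"
  assumes TAB: "lawvere_theory T" "pseudo_algebra T A" "pseudo_algebra T B"
  shows "category (psalg_hom T A B)"
proof
  fix f g h :: "('t, 'o, 'a, 'p, 'b) pscell" and x y z w
  let ?C = "psalg_hom T A B"
  obtain fs ft fa where f: "f = (fs, ft, fa)" by (cases f)
  obtain gs gt ga where g: "g = (gs, gt, ga)" by (cases g)
  obtain hs ht ha where h: "h = (hs, ht, ha)" by (cases h)
  show "f \<in> Arr ?C \<Longrightarrow> Dom ?C f \<in> Obj ?C" "f \<in> Arr ?C \<Longrightarrow> Cod ?C f \<in> Obj ?C"
    by (auto simp: f pseudo_cell_def)
  show "x \<in> Obj ?C \<Longrightarrow> Idn ?C x \<in> hom ?C x x"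
    using pseudo_cell_nid[OF TAB] by (simp add: hom_iff)
  show "f \<in> hom ?C x y \<Longrightarrow> g \<in> hom ?C y z \<Longrightarrow> Comp ?C g f \<in> hom ?C x z"
    using pseudo_cell_vcomp[OF TAB] by (auto simp: hom_iff f g)
  show "f \<in> hom ?C x y \<Longrightarrow> Comp ?C (Idn ?C y) f = f" "f \<in> hom ?C x y \<Longrightarrow> Comp ?C f (Idn ?C x) = f"
    by (auto simp: hom_iff f pseudo_cell_def vcomp_nid)
  show "f \<in> hom ?C w x \<Longrightarrow> g \<in> hom ?C x y \<Longrightarrow> h \<in> hom ?C y z \<Longrightarrow>
      Comp ?C h (Comp ?C g f) = Comp ?C (Comp ?C h g) f"
    by (auto simp: hom_iff f g h pseudo_cell_def vcomp_assoc)
qed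

text \<open>Four squares for the horizontal composite of 2-cells: \<open>1\<close> is naturality of
  the outer transformation, \<open>2\<close> its cell condition, \<open>3\<close> the image of the
  inner cell condition under the source of the outer cell, and \<open>4\<close> naturality of the
  \<open>rho\<close> of that source.\<close>

lemma hcomp_pasting:
  assumes "category Z"
    and "a \<in> Arr Z" "b \<in> Arr Z" "c \<in> Arr Z" "d \<in> Arr Z" "e \<in> Arr Z" "f \<in> Arr Z"
      "x \<in> Arr Z" "y \<in> Arr Z" "u \<in> Arr Z" "v \<in> Arr Z" "r \<in> Arr Z" "s \<in> Arr Z"
    and "Dom Z a = Cod Z b" "Dom Z b = Cod Z c" "Dom Z c = Cod Z d" "Dom Z a = Cod Z e"
      "Dom Z e = Cod Z f" "Dom Z f = Cod Z d" "Dom Z x = Cod Z y" "Dom Z y = Cod Z u"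
      "Dom Z u = Cod Z v" "Dom Z x = Cod Z r" "Dom Z r = Cod Z s" "Dom Z s = Cod Z v"
    and 1: "Comp Z b c = Comp Z e f" and 2: "Comp Z a e = Comp Z x y"
    and 3: "Comp Z f d = Comp Z u v" and 4: "Comp Z y u = Comp Z r s"
  shows "Comp Z (Comp Z a b) (Comp Z c d) = Comp Z (Comp Z x r) (Comp Z s v)"
proof -
  note assoc = cat_rules(11)[OF assms(1)]
  note [simp] = cat_rules(1-8)[OF assms(1)] assms(2-13)
  have "Comp Z (Comp Z a b) (Comp Z c d) = Comp Z a (Comp Z (Comp Z b c) d)"
    using assms(14-16) by (simp add: assoc)
  also have "\<dots> = Comp Z (Comp Z a e) (Comp Z f d)"
    unfolding 1 using assms(17-19) by (simp add: assoc)
  also have "\<dots> = Comp Z x (Comp Z (Comp Z y u) v)"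
    unfolding 2 3 using assms(20-22) by (simp add: assoc)
  also have "\<dots> = Comp Z (Comp Z x r) (Comp Z s v)"
    unfolding 4 using assms(23-25) by (simp add: assoc)
  finally show ?thesis .
qed

lemma pseudo_cell_hcomp:
  assumes T: "lawvere_theory T" "pseudo_algebra T A" "pseudo_algebra T B" "pseudo_algebra T D"
    and \<alpha>: "pseudo_cell T A B G G' \<alpha>" and \<beta>: "pseudo_cell T B D H H' \<beta>"
  shows "pseudo_cell T A D (psmor_comp T A B D H G) (psmor_comp T A B D H' G')
    (hcomp (Und A) (Und D) \<beta> \<alpha>)"
proof -
  note ca = \<alpha>[unfolded pseudo_cell_iff[OF T(1-3)]] and cb = \<beta>[unfolded pseudo_cell_iff[OF T(1,3,4)]]
  interpret c1: composable_premorphisms T A B D G H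
    using ca cb by (intro composable_premorphisms.intro pseudo_morphism_premorphism T) auto
  interpret c2: composable_premorphisms T A B D G' H'
    using ca cb by (intro composable_premorphisms.intro pseudo_morphism_premorphism T) auto
  have na: "is_natural (Und A) (Und B) \<alpha>" and nb: "is_natural (Und B) (Und D) \<beta>"
    and st: "src \<alpha> = fn G" "tgt \<alpha> = fn G'" "src \<beta> = fn H" "tgt \<beta> = fn H'" using ca cb by auto
  note [simp] = st natural_rules[OF na] natural_rules[OF nb]
    functor_rules[OF c1.G.fn] functor_rules[OF c1.H.fn] functor_rules[OF c2.G.fn] functor_rules[OF c2.H.fn]
  have "Comp (Und D) (cmp (rho c2.HG w) xs) (cmp (hcomp (Und A) (Und D) \<beta> \<alpha>) (on_ob (Phi A w) xs)) =
      Comp (Und D) (on_ar (Phi D w) (map (cmp (hcomp (Und A) (Und D) \<beta> \<alpha>)) xs)) (cmp (rho c1.HG w) xs)"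
    if w: "w \<in> words T" and xs: "xs \<in> Obj (Pw (arity T w) A)" for w xs
  proof -
    let ?P = "Pw (arity T w) D"
    let ?ys = "map (on_ob (fn G)) xs" and ?ys' = "map (on_ob (fn G')) xs" and ?\<phi> = "on_ob (Phi A w) xs"
    have ys: "?ys \<in> Obj (Pw (arity T w) B)" "?ys' \<in> Obj (Pw (arity T w) B)"
      by (rule c1.map_fn_Obj[OF xs] c2.map_fn_Obj[OF xs])+
    have \<phi>: "?\<phi> \<in> Obj (Und A)" by (rule functor_rules(1)[OF c1.G.A.Phi[OF w] xs])
    have \<psi>: "on_ob (Phi B w) ?ys' \<in> Obj (Und B)" by (rule functor_rules(1)[OF c1.G.B.Phi[OF w] ys(2)])
    note [simp] = c1.G.rho_rules[OF w xs] c2.G.rho_rules[OF w xs]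
      c1.H.rho_rules[OF w ys(1)] c1.H.rho_rules[OF w ys(2)] c2.H.rho_rules[OF w ys(2)] \<phi> \<psi>
    have a: "map (cmp \<alpha>) xs \<in> Arr (Pw (arity T w) B)"
      "map (Dom (Und B)) (map (cmp \<alpha>) xs) = ?ys" "map (Cod (Und B)) (map (cmp \<alpha>) xs) = ?ys'"
      using xs by (auto simp: pow_sel)
    have ha: "map (on_ar (fn H)) (map (cmp \<alpha>) xs) \<in> Arr ?P"
      "Dom ?P (map (on_ar (fn H)) (map (cmp \<alpha>) xs)) = map (on_ob (fn H)) ?ys"
      "Cod ?P (map (on_ar (fn H)) (map (cmp \<alpha>) xs)) = map (on_ob (fn H)) ?ys'"
      using xs by (auto simp: pow_sel)
    have b: "map (cmp \<beta>) ?ys' \<in> Arr ?P"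
      "Dom ?P (map (cmp \<beta>) ?ys') = map (on_ob (fn H)) ?ys'"
      "Cod ?P (map (cmp \<beta>) ?ys') = map (on_ob (fn H')) ?ys'"
      using xs by (auto simp: pow_sel)
    note fB = functor_rules(2-4)[OF c1.G.B.Phi[OF w] a(1), unfolded pow_sel a(2,3)]
    note fD = functor_rules(2-4)[OF c1.H.B.Phi[OF w] ha(1), unfolded ha(2,3)]
      functor_rules(2-4)[OF c1.H.B.Phi[OF w] b(1), unfolded b(2,3)]
    have ca': "Comp (Und B) (cmp (rho G' w) xs) (cmp \<alpha> ?\<phi>) =
        Comp (Und B) (on_ar (Phi B w) (map (cmp \<alpha>) xs)) (cmp (rho G w) xs)"
      using ca w xs by blast
    have "Comp (Und D) (Comp (Und D) (cmp (rho H' w) ?ys') (on_ar (fn H') (cmp (rho G' w) xs)))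
        (Comp (Und D) (cmp \<beta> (on_ob (fn G') ?\<phi>)) (on_ar (fn H) (cmp \<alpha> ?\<phi>))) =
      Comp (Und D) (Comp (Und D) (on_ar (Phi D w) (map (cmp \<beta>) ?ys'))
          (on_ar (Phi D w) (map (on_ar (fn H)) (map (cmp \<alpha>) xs))))
        (Comp (Und D) (cmp (rho H w) ?ys) (on_ar (fn H) (cmp (rho G w) xs)))"
    proof (rule hcomp_pasting[OF c1.H.B.Und])
      show "Comp (Und D) (on_ar (fn H') (cmp (rho G' w) xs)) (cmp \<beta> (on_ob (fn G') ?\<phi>)) =
          Comp (Und D) (cmp \<beta> (on_ob (Phi B w) ?ys')) (on_ar (fn H) (cmp (rho G' w) xs))"
        using naturality[OF nb, of "cmp (rho G' w) xs"] by (simp del: map_map)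
      show "Comp (Und D) (cmp (rho H' w) ?ys') (cmp \<beta> (on_ob (Phi B w) ?ys')) =
          Comp (Und D) (on_ar (Phi D w) (map (cmp \<beta>) ?ys')) (cmp (rho H w) ?ys')"
        using cb w ys(2) by blast
      have "on_ar (fn H) (Comp (Und B) (cmp (rho G' w) xs) (cmp \<alpha> ?\<phi>)) =
          on_ar (fn H) (Comp (Und B) (on_ar (Phi B w) (map (cmp \<alpha>) xs)) (cmp (rho G w) xs))"
        by (simp only: ca')
      then show "Comp (Und D) (on_ar (fn H) (cmp (rho G' w) xs)) (on_ar (fn H) (cmp \<alpha> ?\<phi>)) =
          Comp (Und D) (on_ar (fn H) (on_ar (Phi B w) (map (cmp \<alpha>) xs))) (on_ar (fn H) (cmp (rho G w) xs))"
        using fB by (simp del: map_map)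
      show "Comp (Und D) (cmp (rho H w) ?ys') (on_ar (fn H) (on_ar (Phi B w) (map (cmp \<alpha>) xs))) =
          Comp (Und D) (on_ar (Phi D w) (map (on_ar (fn H)) (map (cmp \<alpha>) xs))) (cmp (rho H w) ?ys)"
        using c1.H.rho_naturality[OF w a(1)] unfolding a(2,3) .
    qed (use fB fD in \<open>simp_all del: map_map\<close>)
    \<comment> \<open>Taken entrywise, the components of the horizontal composite are a composite in
      the power of \<open>Und D\<close>, which \<open>Phi D w\<close> splits.\<close>
    moreover have "map (cmp (hcomp (Und A) (Und D) \<beta> \<alpha>)) xs =
        Comp ?P (map (cmp \<beta>) ?ys') (map (on_ar (fn H)) (map (cmp \<alpha>) xs))"
      using xs by (auto simp: pow_sel list_eq_iff_nth_eq subset_set_conv_nth)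
    moreover have "on_ar (Phi D w) (Comp ?P (map (cmp \<beta>) ?ys') (map (on_ar (fn H)) (map (cmp \<alpha>) xs))) =
        Comp (Und D) (on_ar (Phi D w) (map (cmp \<beta>) ?ys'))
          (on_ar (Phi D w) (map (on_ar (fn H)) (map (cmp \<alpha>) xs)))"
      by (rule functor_rules(6)[OF c1.H.B.Phi[OF w] ha(1) b(1)]) (simp only: b ha)
    ultimately show ?thesis
      unfolding c1.cmp_rho_comp[OF w xs] c2.cmp_rho_comp[OF w xs] hcomp_sel(3)[OF \<phi>] st by (simp only:)
  qed
  then show ?thesis
    unfolding pseudo_cell_iff[OF T(1,2,4)]
    using is_natural_hcomp[OF na nb] ca cb pseudo_morphism_comp[OF T]
    by (simp add: c1.fn_comp c2.fn_comp del: hcomp_sel(3))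
qed

lemma fn_psmor_id: "fn (psmor_id T C) = fid (Und C)"
  by (simp add: psmor_id_def)

lemma rho_psmor_id:
  assumes "w \<in> words T" "xs \<in> Obj (Pw (arity T w) C)"
  shows "cmp (rho (psmor_id T C) w) xs = Idn (Und C) (on_ob (Phi C w) xs)"
  using assms by (simp add: psmor_id_def idPhi_def)

lemma premorphism_id:
  assumes T: "lawvere_theory T" "pseudo_algebra T A"
  shows "premorphism T A A (psmor_id T A)"
proof -
  interpret lawvere_theory T by fact
  interpret A: pseudo_algebra T A by fact
  have "fpow n (Und A) (fid (Und A)) = fid (Pw n A)" for n
    by (rule ftr_eqI[of _ "Obj (Pw n A)" _ "Arr (Pw n A)"]) (simp_all, auto simp: pow_sel intro!: map_idI)
  then have "natural_iso (Pw (arity T w) A) (Und A)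
      (fcomp (Pw (arity T w) A) (fid (Und A)) (Phi A w))
      (fcomp (Pw (arity T w) A) (Phi A w) (fpow (arity T w) (Und A) (fid (Und A))))
      (idPhi T A w)" if w: "w \<in> words T" for w
    using A.is_natural_idPhi[OF w] A.Phi[OF w] functor_rules(1)[OF A.Phi[OF w]]
    by (auto simp: natural_iso_def fcomp_fid idPhi_def intro!: iso_Idn A.Und)
  then show ?thesis
    by unfold_locales (auto simp: psmor_id_def is_functor_fid A.Und)
qed

text \<open>All components of \<open>rho\<close> are identities, and \<open>Phi A w\<close>
  preserves lists of identities, so every equation collapses to the unit laws.\<close>

lemma pseudo_morphism_id:
  assumes T: "lawvere_theory T" "pseudo_algebra T A"
  shows "pseudo_morphism T A A (psmor_id T A)"
proof -
  interpret premorphism T A A "psmor_id T A" by (rule premorphism_id[OF T])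
  note [simp] = cat_rules[OF A.Und]
  note fn' = fn_psmor_id
  have m: "map (on_ob (fn (psmor_id T A))) xs = xs" if "xs \<in> Obj (Pw n A)" for xs n
    using that by (auto simp: fn' pow_sel intro!: map_idI)
  note r = rho_psmor_id
  show ?thesis
    unfolding pseudo_morphism_iff[OF premorphism_axioms]
  proof (intro conjI allI impI ballI)
    show "rho (psmor_id T A) \<in> extensional (words T)" by (simp add: psmor_id_def)
  next
    fix w ws xs assume c: "composable T w ws" and xs: "xs \<in> Obj (Pw (sum_list (map (arity T) ws)) A)"
    let ?ns = "map (arity T) ws"
    let ?xs = "\<lambda>i. reindex (block ?ns i) xs"
    let ?ps = "map (\<lambda>i. on_ob (Phi A (ws ! i)) (?xs i)) [0..<length ws]"
    note cD = composableD[OF c] and \<gamma> = wgamma_word[OF c]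
    note ps = Co_typing(1)[OF c xs] and cA = Co_typing(4-6)[OF c xs]
    have x: "?xs i \<in> Obj (Pw (arity T (ws ! i)) A)" if "i < length ws" for i
      using reindex_pow(1)[OF index_map_block[of i ?ns] xs] that by simp
    have "map (\<lambda>i. cmp (rho (psmor_id T A) (ws ! i)) (?xs i)) [0..<length ws] =
        Idn (Pw (arity T w) A) ?ps"
      using r[OF cD(2) x] by (auto simp: pow_sel)
    then have "on_ar (Phi A w) (map (\<lambda>i. cmp (rho (psmor_id T A) (ws ! i)) (?xs i)) [0..<length ws]) =
        Idn (Und A) (on_ob (Phi A w) ?ps)"
      using functor_rules(5)[OF A.Phi[OF cD(1)] ps] by simp
    then show "Comp (Und A) (cmp (Co A w ws) (map (on_ob (fn (psmor_id T A))) xs))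
        (cmp (rho (psmor_id T A) (wgamma T w ws)) xs) =
      Comp (Und A) (on_ar (Phi A w) (map (\<lambda>i. cmp (rho (psmor_id T A) (ws ! i)) (?xs i)) [0..<length ws]))
       (Comp (Und A) (cmp (rho (psmor_id T A) w) ?ps) (on_ar (fn (psmor_id T A)) (cmp (Co A w ws) xs)))"
      using cA xs ps by (simp add: r cD \<gamma> m[OF xs, unfolded fn'] fn')
  next
    fix xs assume xs: "xs \<in> Obj (Pw (Suc 0) A)"
    have "cmp (Iu A) xs \<in> Arr (Und A)" "Dom (Und A) (cmp (Iu A) xs) = on_ob (Phi A (unit_word T)) xs"
      using natural_rules(1,2)[OF natural_isoD(1)[OF A.Iu[unfolded One_nat_def]] xs] natural_isoD(2)[OF A.Iu[unfolded One_nat_def]] by simp_all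
    then show "Comp (Und A) (cmp (Iu A) (map (on_ob (fn (psmor_id T A))) xs))
        (cmp (rho (psmor_id T A) (unit_word T)) xs) = on_ar (fn (psmor_id T A)) (cmp (Iu A) xs)"
      using xs by (simp add: r unit_word m[OF xs, unfolded fn'] fn')
  next
    fix w l f xs assume w: "w \<in> words T" and f: "index_map (arity T w) l f" and xs: "xs \<in> Obj (Pw l A)"
    note sa = natural_isoD[OF A.Sb[OF w f]]
    have "cmp (Sb A w l f) xs \<in> Arr (Und A)" "Dom (Und A) (cmp (Sb A w l f) xs) = on_ob (Phi A (wsub T l f w)) xs"
      "Cod (Und A) (cmp (Sb A w l f) xs) = on_ob (Phi A w) (reindex f xs)"
      using natural_rules[OF sa(1) xs] xs sa(2,3) by simp_all
    then show "Comp (Und A) (cmp (Sb A w l f) (map (on_ob (fn (psmor_id T A))) xs))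
        (cmp (rho (psmor_id T A) (wsub T l f w)) xs) =
      Comp (Und A) (cmp (rho (psmor_id T A) w) (reindex f xs))
        (on_ar (fn (psmor_id T A)) (cmp (Sb A w l f) xs))"
      using xs reindex_pow(1)[OF f xs] by (simp add: r w wsub_word[OF w f] m[OF xs, unfolded fn'] fn')
  qed
qed

text \<open>On components both sides are the composite of \<open>rho K\<close>, the image of
  \<open>rho H\<close> and the image of \<open>rho G\<close>, bracketed differently.\<close>

lemma psmor_comp_assoc:
  assumes T: "lawvere_theory T" "pseudo_algebra T A" "pseudo_algebra T B" "pseudo_algebra T D"
      "pseudo_algebra T E"
    and G: "pseudo_morphism T A B G" and H: "pseudo_morphism T B D H" and K: "pseudo_morphism T D E K"
  shows "psmor_comp T A D E K (psmor_comp T A B D H G) = psmor_comp T A B E (psmor_comp T B D E K H) G"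
proof -
  interpret HG: composable_premorphisms T A B D G H
    by (intro composable_premorphisms.intro pseudo_morphism_premorphism T G H)
  interpret KH: composable_premorphisms T B D E H K
    by (intro composable_premorphisms.intro pseudo_morphism_premorphism T K H)
  interpret l: composable_premorphisms T A D E HG.HG K
    by (intro composable_premorphisms.intro HG.premorphism_comp KH.H.premorphism_axioms)
  interpret r: composable_premorphisms T A B E G KH.HG
    by (intro composable_premorphisms.intro KH.premorphism_comp HG.G.premorphism_axioms)
  note [simp] = cat_rules[OF KH.H.B.Und] functor_rules[OF KH.H.fn] functor_rules[OF HG.H.fn]
  show ?thesis
  proof (rule psmor_eqI[OF l.premorphism_comp r.premorphism_comp])
    show "fn l.HG = fn r.HG"
      by (simp add: l.fn_comp r.fn_comp HG.fn_comp KH.fn_comp fcomp_assoc[OF HG.G.fn])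
    fix w xs assume w: "w \<in> words T" and xs: "xs \<in> Obj (Pw (arity T w) A)"
    let ?ys = "map (on_ob (fn G)) xs"
    have ys: "?ys \<in> Obj (Pw (arity T w) B)" by (rule HG.map_fn_Obj[OF xs])
    have zs: "map (on_ob (fn HG.HG)) xs = map (on_ob (fn H)) ?ys"
      using xs by (auto simp: HG.fn_comp pow_sel)
    note [simp] = HG.G.rho_rules[OF w xs] HG.H.rho_rules[OF w ys]
      KH.H.rho_rules[OF w KH.map_fn_Obj[OF ys]]
    show "cmp (rho l.HG w) xs = cmp (rho r.HG w) xs"
      unfolding l.cmp_rho_comp[OF w xs] r.cmp_rho_comp[OF w xs] HG.cmp_rho_comp[OF w xs]
        KH.cmp_rho_comp[OF w ys] zs KH.fn_comp
      by (simp del: map_map)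
  qed (simp_all add: psmor_comp_def)
qed

lemma psmor_comp_id:
  fixes T :: "'t lawvere" and A :: "('t, 'o, 'a) psalg" and B :: "('t, 'p, 'b) psalg"
  assumes T: "lawvere_theory T" "pseudo_algebra T A" "pseudo_algebra T B"
    and H: "pseudo_morphism T A B H"
  shows "psmor_comp T A B B (psmor_id T B) H = H" "psmor_comp T A A B H (psmor_id T A) = H"
proof -
  note pr = pseudo_morphism_premorphism[OF T H]
  interpret l: composable_premorphisms T A B B H "psmor_id T B"
    by (intro composable_premorphisms.intro premorphism_id T pr)
  interpret r: composable_premorphisms T A A B "psmor_id T A" H
    by (intro composable_premorphisms.intro premorphism_id T pr)
  have ext: "rho H \<in> extensional (words T)" using H by (simp add: pseudo_morphism_def)
  note [simp] = fn_psmor_id rho_psmor_id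
  note [simp] = cat_rules[OF l.G.B.Und] functor_rules[OF l.G.fn]
  show "l.HG = H"
  proof (rule psmor_eqI[OF l.premorphism_comp pr _ ext])
    show "fn l.HG = fn H" by (simp add: l.fn_comp fcomp_fid[OF l.G.fn])
    fix w xs assume w: "w \<in> words T" and xs: "xs \<in> Obj (Pw (arity T w) A)"
    show "cmp (rho l.HG w) xs = cmp (rho H w) xs"
      unfolding l.cmp_rho_comp[OF w xs] rho_psmor_id[OF w l.map_fn_Obj[OF xs]] fn_psmor_id
      using l.G.rho_rules[OF w xs] by simp
  qed (simp add: psmor_comp_def)
  show "r.HG = H"
  proof (rule psmor_eqI[OF r.premorphism_comp pr _ ext])
    show "fn r.HG = fn H" by (simp add: r.fn_comp fcomp_fid[OF l.G.fn])
    fix w xs assume w: "w \<in> words T" and xs: "xs \<in> Obj (Pw (arity T w) A)"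
    have m: "map (on_ob (fid (Und A))) xs = xs"
      using xs by (auto simp: pow_sel intro!: map_idI)
    show "cmp (rho r.HG w) xs = cmp (rho H w) xs"
      unfolding r.cmp_rho_comp[OF w xs] rho_psmor_id[OF w xs] fn_psmor_id m
      using l.G.rho_rules[OF w xs] functor_rules(1)[OF l.G.A.Phi[OF w] xs] by simp
  qed (simp add: psmor_comp_def)
qed

lemma PsAlg_sel [simp]:
  "Ob (PsAlg elts T) = {A. pseudo_algebra T A \<and> small_category elts (Und A)}"
  "HomCat (PsAlg elts T) = psalg_hom T" "Unit1 (PsAlg elts T) = psmor_id T"
  "Comp1 (PsAlg elts T) = psmor_comp T"
  "Comp2 (PsAlg elts T) A B D (H, H', \<beta>) (G, G', \<alpha>) =
    (psmor_comp T A B D H G, psmor_comp T A B D H' G', hcomp (Und A) (Und D) \<beta> \<alpha>)"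
  by (simp_all add: PsAlg_def)

lemma fn_psmor_comp: "fn (psmor_comp T A B D H G) = fcomp (Und A) (fn H) (fn G)"
  by (simp add: psmor_comp_def)

text \<open>A 2-cell carries its source and target morphism, so an equation between 2-cells splits
  into laws for the composition of morphisms and laws for composites of transformations.\<close>

lemma two_category_PsAlg:
  fixes elts :: "'u \<Rightarrow> 'u set" and T :: "'t lawvere"
  assumes T: "lawvere_theory T"
  shows "two_category (PsAlg elts T)"
proof -
  have cellD: "is_natural (Und A) (Und B) \<alpha>" "src \<alpha> = fn G" "tgt \<alpha> = fn H"
    "pseudo_morphism T A B G" "pseudo_morphism T A B H"
    if "pseudo_cell T A B G H \<alpha>" for A B :: "('t, 'u, 'u) psalg" and G H \<alpha>
    using that by (auto simp: pseudo_cell_def)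
  have fnD: "is_functor (Und A) (Und B) (fn H)" if "pseudo_morphism T A B H"
    for A B :: "('t, 'u, 'u) psalg" and H
    using that by (simp add: pseudo_morphism_def)
  show ?thesis
    by (rule two_category.intro)
      (auto simp: hom_iff category_psalg_hom[OF T] pseudo_morphism_id[OF T] pseudo_morphism_comp[OF T]
      pseudo_cell_hcomp[OF T] psmor_comp_assoc[OF T] psmor_comp_id[OF T] fn_psmor_id fn_psmor_comp
      hcomp_nid hcomp_assoc hcomp_id interchange_law cellD fnD)
qed

section \<open>Cotensor products from evaluation cones\<close>

context two_category
begin

lemma Comp2_rules:
  assumes "A \<in> Ob C" "B \<in> Ob C" "D \<in> Ob C" "\<alpha> \<in> Arr (HomCat C A B)" "\<beta> \<in> Arr (HomCat C B D)"
  shows "Comp2 C A B D \<beta> \<alpha> \<in> Arr (HomCat C A D)"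
    "Dom (HomCat C A D) (Comp2 C A B D \<beta> \<alpha>) = Comp1 C A B D (Dom (HomCat C B D) \<beta>) (Dom (HomCat C A B) \<alpha>)"
    "Cod (HomCat C A D) (Comp2 C A B D \<beta> \<alpha>) = Comp1 C A B D (Cod (HomCat C B D) \<beta>) (Cod (HomCat C A B) \<alpha>)"
  using Comp2[OF assms(1-3), of \<alpha> _ _ \<beta>] assms(4,5) by (auto simp: hom_iff)

text \<open>Interchange, oriented so that the simplifier merges a composite of horizontal composites
  factor by factor; identities in either factor then cancel.\<close>

lemma Comp2_Comp:
  assumes "A \<in> Ob C" "B \<in> Ob C" "D \<in> Ob C"
    and "\<alpha> \<in> Arr (HomCat C A B)" "\<alpha>' \<in> Arr (HomCat C A B)"
      "Dom (HomCat C A B) \<alpha>' = Cod (HomCat C A B) \<alpha>"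
    and "\<beta> \<in> Arr (HomCat C B D)" "\<beta>' \<in> Arr (HomCat C B D)"
      "Dom (HomCat C B D) \<beta>' = Cod (HomCat C B D) \<beta>"
  shows "Comp (HomCat C A D) (Comp2 C A B D \<beta>' \<alpha>') (Comp2 C A B D \<beta> \<alpha>) =
    Comp2 C A B D (Comp (HomCat C B D) \<beta>' \<beta>) (Comp (HomCat C A B) \<alpha>' \<alpha>)"
  using interchange[OF assms(1-3), of \<alpha> _ _ \<alpha>' _ \<beta> _ _ \<beta>'] assms(4-) by (auto simp: hom_iff)

lemma repr_fun_sel [simp]:
  "g \<in> Obj (HomCat C B P) \<Longrightarrow> on_ob (repr_fun C P A B h) g = Comp1 C A B P g h"
  "\<beta> \<in> Arr (HomCat C B P) \<Longrightarrow> on_ar (repr_fun C P A B h) \<beta> = Comp2 C A B P \<beta> (Idn (HomCat C A B) h)"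
  "on_ob (repr_fun C P A B h) \<in> extensional (Obj (HomCat C B P))"
  "on_ar (repr_fun C P A B h) \<in> extensional (Arr (HomCat C B P))"
  by (simp_all add: repr_fun_def)

lemma is_functor_repr_fun:
  assumes AB: "A \<in> Ob C" "B \<in> Ob C" "P \<in> Ob C" and h: "h \<in> Obj (HomCat C A B)"
  shows "is_functor (HomCat C B P) (HomCat C A P) (repr_fun C P A B h)"
proof -
  note [simp] = AB h HomCat Comp2_rules Comp1 cat_rules[OF HomCat] Comp2_Idn Comp2_Comp
  show ?thesis by (rule functorI) simp_all
qed

end

text \<open>By the Yoneda lemma, 2-natural families of functors from \<open>C(A,P)\<close> to
  \<open>Cat(J, C(A,F))\<close> correspond to functors from \<open>J\<close> to
  \<open>C(P,F)\<close>, obtained as the value at the identity of \<open>P\<close>. Starting from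
  such a functor \<epsilon>, all naturality holds in any 2-category, and only bijectivity is
  particular to pseudo algebras.\<close>

locale evaluation_cone = two_category C
  for C :: "('o, 'h, 'k) two_cat" +
  fixes J :: "('j, 'i) cat" and F P :: 'o and \<epsilon> :: "('j, 'i, 'h, 'k) ftr"
  assumes F: "F \<in> Ob C" and P: "P \<in> Ob C" and \<epsilon>: "is_functor J (HomCat C P F) \<epsilon>"
begin

definition cone_ob :: "'o \<Rightarrow> 'h \<Rightarrow> ('j, 'i, 'h, 'k) ftr" where
  "cone_ob A H = fcomp J (repr_fun C F A P H) \<epsilon>"

definition cone_ar :: "'o \<Rightarrow> 'k \<Rightarrow> ('j, 'i, 'h, 'k) ntr" where
  "cone_ar A \<alpha> = \<lparr>src = cone_ob A (Dom (HomCat C A P) \<alpha>), tgt = cone_ob A (Cod (HomCat C A P) \<alpha>),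
     cmp = (\<lambda>j\<in>Obj J. Comp2 C A P F (Idn (HomCat C P F) (on_ob \<epsilon> j)) \<alpha>)\<rparr>"

definition cone :: "'o \<Rightarrow> ('h, 'k, ('j, 'i, 'h, 'k) ftr, ('j, 'i, 'h, 'k) ntr) ftr" where
  "cone A = \<lparr>on_ob = (\<lambda>H\<in>Obj (HomCat C A P). cone_ob A H), on_ar = (\<lambda>\<alpha>\<in>Arr (HomCat C A P). cone_ar A \<alpha>)\<rparr>"

lemma cone_sel [simp]:
  "j \<in> Obj J \<Longrightarrow> on_ob (cone_ob A H) j = Comp1 C A P F (on_ob \<epsilon> j) H"
  "u \<in> Arr J \<Longrightarrow> on_ar (cone_ob A H) u = Comp2 C A P F (on_ar \<epsilon> u) (Idn (HomCat C A P) H)"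
  "src (cone_ar A \<alpha>) = cone_ob A (Dom (HomCat C A P) \<alpha>)"
  "tgt (cone_ar A \<alpha>) = cone_ob A (Cod (HomCat C A P) \<alpha>)"
  "j \<in> Obj J \<Longrightarrow> cmp (cone_ar A \<alpha>) j = Comp2 C A P F (Idn (HomCat C P F) (on_ob \<epsilon> j)) \<alpha>"
  "cmp (cone_ar A \<alpha>) \<in> extensional (Obj J)"
  "H \<in> Obj (HomCat C A P) \<Longrightarrow> on_ob (cone A) H = cone_ob A H"
  "\<alpha> \<in> Arr (HomCat C A P) \<Longrightarrow> on_ar (cone A) \<alpha> = cone_ar A \<alpha>"
  "on_ob (cone A) \<in> extensional (Obj (HomCat C A P))" "on_ar (cone A) \<in> extensional (Arr (HomCat C A P))"
  by (simp_all add: cone_ob_def cone_ar_def cone_def functor_rules[OF \<epsilon>])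

lemma is_functor_cone_ob:
  assumes "A \<in> Ob C" "H \<in> Obj (HomCat C A P)"
  shows "is_functor J (HomCat C A F) (cone_ob A H)"
  unfolding cone_ob_def by (intro is_functor_fcomp[OF \<epsilon> is_functor_repr_fun] assms F P)

lemma is_natural_cone_ar:
  assumes A: "A \<in> Ob C" and \<alpha>: "\<alpha> \<in> Arr (HomCat C A P)"
  shows "is_natural J (HomCat C A F) (cone_ar A \<alpha>)"
proof -
  note [simp] = A \<alpha> F P HomCat cat_rules[OF HomCat] functor_rules[OF \<epsilon>] Comp2_rules Comp2_Comp
    cat_rules[OF functor_dom[OF \<epsilon>]]
  \<comment> \<open>By interchange both ways around the square for an arrow \<open>u\<close> of
    \<open>J\<close> equal the horizontal composite of \<open>on_ar \<epsilon> u\<close> with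
    \<alpha>.\<close>
  show ?thesis by (rule naturalI) (simp_all add: is_functor_cone_ob)
qed

lemma is_functor_cone:
  assumes A: "A \<in> Ob C"
  shows "is_functor (HomCat C A P) (fun_cat J (HomCat C A F)) (cone A)"
proof (rule functorI)
  note [simp] = A F P HomCat cat_rules[OF HomCat] functor_rules[OF \<epsilon>] Comp2_rules Comp2_Comp
  show "category (HomCat C A P)" "category (fun_cat J (HomCat C A F))"
    by (simp_all add: category_fun_cat functor_dom[OF \<epsilon>])
  fix H assume H: "H \<in> Obj (HomCat C A P)"
  show "on_ar (cone A) (Idn (HomCat C A P) H) = Idn (fun_cat J (HomCat C A F)) (on_ob (cone A) H)"
    using H by (intro ntr_eqI[of _ _ "Obj J"]) (simp_all add: Comp2_Idn)
next
  note [simp] = A F P HomCat cat_rules[OF HomCat] functor_rules[OF \<epsilon>] Comp2_rules Comp2_Comp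
  fix f g assume "f \<in> Arr (HomCat C A P)" "g \<in> Arr (HomCat C A P)"
    "Dom (HomCat C A P) g = Cod (HomCat C A P) f"
  then show "on_ar (cone A) (Comp (HomCat C A P) g f) =
      Comp (fun_cat J (HomCat C A F)) (on_ar (cone A) g) (on_ar (cone A) f)"
    by (intro ntr_eqI[of _ _ "Obj J"]) simp_all
qed (simp_all add: A is_functor_cone_ob is_natural_cone_ar cat_rules[OF HomCat[OF A P]])

lemma cone_ob_Comp1:
  assumes AB: "A \<in> Ob C" "B \<in> Ob C" and h: "h \<in> Obj (HomCat C A B)" and g: "g \<in> Obj (HomCat C B P)"
  shows "cone_ob A (Comp1 C A B P g h) = fcomp J (repr_fun C F A B h) (cone_ob B g)"
proof -
  note [simp] = AB h g F P HomCat cat_rules[OF HomCat] functor_rules[OF \<epsilon>] Comp2_rules Comp1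
  show ?thesis
  proof (rule functor_eqI)
    show "is_functor J (HomCat C A F) (cone_ob A (Comp1 C A B P g h))"
      by (rule is_functor_cone_ob) simp_all
    show "is_functor J (HomCat C A F) (fcomp J (repr_fun C F A B h) (cone_ob B g))"
      by (rule is_functor_fcomp[OF is_functor_cone_ob is_functor_repr_fun]) simp_all
  qed (simp_all add: Comp1_assoc Comp2_assoc[symmetric] Comp2_Idn)
qed

text \<open>Naturality in 1-cells is associativity: the evaluations compose from one side and
  \<open>h\<close> from the other.\<close>

lemma cone_repr_fun:
  assumes A: "A \<in> Ob C" and B: "B \<in> Ob C" and h: "h \<in> Obj (HomCat C A B)"
  shows "fcomp (HomCat C B P) (cone A) (repr_fun C P A B h) =
    fcomp (HomCat C B P) (power_fun J (HomCat C B F) (HomCat C A F) (repr_fun C F A B h)) (cone B)"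
proof -
    note [simp] = A B h F P HomCat cat_rules[OF HomCat] functor_rules[OF \<epsilon>] Comp2_rules Comp1
    let ?R = "power_fun J (HomCat C B F) (HomCat C A F) (repr_fun C F A B h)"
    show ?thesis
        proof (rule ftr_eqI[of _ "Obj (HomCat C B P)" _ "Arr (HomCat C B P)"])
      fix g assume "g \<in> Obj (HomCat C B P)"
      then show "on_ob (fcomp (HomCat C B P) (cone A) (repr_fun C P A B h)) g =
          on_ob (fcomp (HomCat C B P) ?R (cone B)) g"
        by (simp add: power_fun_def is_functor_cone_ob cone_ob_Comp1)
    next
      fix \<beta> assume b: "\<beta> \<in> Arr (HomCat C B P)"
      have "cone_ar A (Comp2 C A B P \<beta> (Idn (HomCat C A B) h)) =
        hcomp J (HomCat C A F) (nid (HomCat C B F) (HomCat C A F) (repr_fun C F A B h)) (cone_ar B \<beta>)"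
        using b by (intro ntr_eqI[of _ _ "Obj J"])
          (simp_all add: cone_ob_Comp1 Comp2_assoc[symmetric] Comp1_assoc)
      then show "on_ar (fcomp (HomCat C B P) (cone A) (repr_fun C P A B h)) \<beta> =
          on_ar (fcomp (HomCat C B P) ?R (cone B)) \<beta>"
        using b by (simp add: power_fun_def is_natural_cone_ar)
    qed simp_all
qed

text \<open>The naturality conditions hold for any cone, so bijectivity on 1-cells and on 2-cells at
  each object is all that remains to be supplied.\<close>

lemma is_cotensor_of_cone:
  assumes ob: "\<And>A. A \<in> Ob C \<Longrightarrow>
      bij_betw (cone_ob A) (Obj (HomCat C A P)) {K. is_functor J (HomCat C A F) K}"
    and ar: "\<And>A. A \<in> Ob C \<Longrightarrow>
      bij_betw (cone_ar A) (Arr (HomCat C A P)) {\<tau>. is_natural J (HomCat C A F) \<tau>}"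
  shows "is_cotensor C J F P"
  unfolding is_cotensor_def
proof (intro conjI exI[of _ cone])
  show "two_category C" by (rule two_category_axioms)
  show "category J" by (rule functor_dom[OF \<epsilon>])
  show "two_natural_iso C (repr C P) (power J (repr C F)) cone"
    unfolding two_natural_iso_def
  proof (intro conjI ballI)
    fix A assume A: "A \<in> Ob C"
    have "iso_of_categories (HomCat C A P) (fun_cat J (HomCat C A F)) (cone A)"
    proof (rule iso_of_categoriesI[OF is_functor_cone[OF A]])
      show "bij_betw (on_ob (cone A)) (Obj (HomCat C A P)) (Obj (fun_cat J (HomCat C A F)))"
        using ob[OF A] unfolding fun_cat_sel by (simp cong: bij_betw_cong)
      show "bij_betw (on_ar (cone A)) (Arr (HomCat C A P)) (Arr (fun_cat J (HomCat C A F)))"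
        using ar[OF A] unfolding fun_cat_sel by (simp cong: bij_betw_cong)
    qed
    then show "iso_of_categories (val (repr C P) A) (val (power J (repr C F)) A) (cone A)"
      by (simp add: repr_def power_def)
  next
    fix A B h assume "A \<in> Ob C" "B \<in> Ob C" "h \<in> Obj (HomCat C A B)"
    from cone_repr_fun[OF this]
    show "fcomp (val (repr C P) B) (cone A) (on1 (repr C P) A B h) =
        fcomp (val (repr C P) B) (on1 (power J (repr C F)) A B h) (cone B)"
      by (simp add: repr_def power_def)
  next
    fix A B \<alpha> assume A: "A \<in> Ob C" and B: "B \<in> Ob C" and \<alpha>: "\<alpha> \<in> Arr (HomCat C A B)"
    note [simp] = A B \<alpha> F P HomCat cat_rules[OF HomCat] functor_rules[OF \<epsilon>] Comp2_rules Comp1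
    let ?h = "Dom (HomCat C A B) \<alpha>" and ?h' = "Cod (HomCat C A B) \<alpha>"
    define R where "R = on2 (repr C F) A B \<alpha>"
    have R: "src R = repr_fun C F A B ?h" "tgt R = repr_fun C F A B ?h'"
      "g \<in> Obj (HomCat C B F) \<Longrightarrow> cmp R g = Comp2 C A B F (Idn (HomCat C B F) g) \<alpha>" for g
      by (simp_all add: R_def repr_def)
    show "hcomp (val (repr C P) B) (val (power J (repr C F)) A)
        (nid (val (repr C P) A) (val (power J (repr C F)) A) (cone A)) (on2 (repr C P) A B \<alpha>) =
      hcomp (val (repr C P) B) (val (power J (repr C F)) A) (on2 (power J (repr C F)) A B \<alpha>)
        (nid (val (repr C P) B) (val (power J (repr C F)) B) (cone B))" (is "?l = ?r")
    proof (rule ntr_eqI[of _ _ "Obj (HomCat C B P)"])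
      show "src ?l = src ?r" "tgt ?l = tgt ?r"
        using cone_repr_fun[OF A B, of ?h] cone_repr_fun[OF A B, of ?h']
        by (simp_all add: repr_def power_def)
      show "cmp ?l \<in> extensional (Obj (HomCat C B P))" "cmp ?r \<in> extensional (Obj (HomCat C B P))"
        by (simp_all add: repr_def power_def)
      fix g assume g: "g \<in> Obj (HomCat C B P)"
      \<comment> \<open>Both sides have the same component at \<open>g\<close>, the cone of the
        2-cell obtained by whiskering \<alpha> with \<open>g\<close>.\<close>
      let ?c = "cone_ar A (Comp2 C A B P (Idn (HomCat C B P) g) \<alpha>)"
      have "is_natural J (HomCat C A F) ?c" using g by (intro is_natural_cone_ar) simp_all
      then have l: "cmp ?l g = ?c" using g by (simp add: repr_def power_def vcomp_nid)
      have "cmp ?r g = vcomp J (HomCat C A F)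
          (hcomp J (HomCat C A F) R (nid J (HomCat C B F) (cone_ob B g)))
          (hcomp J (HomCat C A F) (nid (HomCat C B F) (HomCat C A F) (repr_fun C F A B ?h))
            (nid J (HomCat C B F) (cone_ob B g)))"
        using g by (simp add: repr_def power_def power_fun_def is_functor_cone_ob is_natural_nid R_def)
      also have "\<dots> = ?c"
        using g by (intro ntr_eqI[of _ _ "Obj J"])
          (simp_all add: R cone_ob_Comp1 Comp2_assoc Comp2_Idn Comp1_assoc)
      finally show "cmp ?l g = cmp ?r g" using l by simp
    qed
  qed
qed (rule F P)+

end

section \<open>Functor categories inside the universe\<close>

text \<open>Transport of structure along two injections into arbitrary types. The structure maps
  decode, compute in \<open>C\<close> and encode again, so the laws of \<open>E\<close> are those of
  \<open>C\<close>.\<close>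

lemma transported_category:
  assumes C: "category C" and f: "inj_on f (Obj C)" and g: "inj_on g (Arr C)"
  obtains E e where "Obj E = f ` Obj C" "Arr E = g ` Arr C" "iso_of_categories C E e"
proof -
  define f' g' where "f' = the_inv_into (Obj C) f" and "g' = the_inv_into (Arr C) g"
  note [simp] = cat_rules[OF C]
  have [simp]: "f' (f x) = x" if "x \<in> Obj C" for x
    using that by (simp add: f'_def the_inv_into_f_f[OF f])
  have [simp]: "g' (g x) = x" if "x \<in> Arr C" for x
    using that by (simp add: g'_def the_inv_into_f_f[OF g])
  define E where "E = \<lparr>Obj = f ` Obj C, Arr = g ` Arr C, Dom = \<lambda>a. f (Dom C (g' a)),
    Cod = \<lambda>a. f (Cod C (g' a)), Idn = \<lambda>x. g (Idn C (f' x)), Comp = \<lambda>b a. g (Comp C (g' b) (g' a))\<rparr>"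
  have E: "category E"
  proof
  qed (auto simp: E_def hom_iff inj_on_eq_iff[OF f])
  define e where "e = \<lparr>on_ob = restrict f (Obj C), on_ar = restrict g (Arr C)\<rparr>"
  have "is_functor C E e"
    by (rule functorI[OF C E]) (auto simp: e_def E_def)
  then have "iso_of_categories C E e"
    using f g by (intro iso_of_categoriesI)
      (auto simp: e_def E_def bij_betw_def inj_on_restrict_eq)
  with that[of E e] show ?thesis by (simp add: E_def)
qed

context universe
begin

text \<open>\<open>inv\<close> is total, but the range of \<open>elts\<close> consists of the small
  collections, so \<open>mk\<close> names a collection only if it is small.\<close>

definition mk :: "'u set \<Rightarrow> 'u" where
  "mk = inv elts"

lemma elts_mk: "small elts S \<Longrightarrow> elts (mk S) = S"
  unfolding mk_def small_def by (rule f_inv_into_f)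

lemma mk_eq_iff: "small elts S \<Longrightarrow> small elts R \<Longrightarrow> mk S = mk R \<longleftrightarrow> S = R"
  by (metis elts_mk)

lemma small_single: "small elts {x}"
  using pairing[of x x] by simp

lemma small_Un:
  assumes "small elts S" "small elts R"
  shows "small elts (S \<union> R)"
  using union[OF pairing[of "mk S" "mk R"]] by (simp add: elts_mk assms)

text \<open>Kuratowski's ordered pair.\<close>

definition opair :: "'u \<Rightarrow> 'u \<Rightarrow> 'u" where
  "opair x y = mk {mk {x}, mk {x, y}}"

lemma opair_eq_iff [simp]: "opair x y = opair x' y' \<longleftrightarrow> x = x' \<and> y = y'"
  unfolding opair_def mk_eq_iff[OF pairing pairing] doubleton_eq_iff mk_eq_iff[OF small_single small_single]
    mk_eq_iff[OF small_single pairing] mk_eq_iff[OF pairing small_single]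
  by (auto simp: doubleton_eq_iff)

definition otimes :: "'u set \<Rightarrow> 'u set \<Rightarrow> 'u set" where
  "otimes S R = {opair x y |x y. x \<in> S \<and> y \<in> R}"

text \<open>A Kuratowski pair of elements of \<open>S\<close> and \<open>R\<close> is a set of
  subsets of their union, so the product sits inside the double power set of the union.\<close>

lemma small_otimes:
  assumes "small elts S" "small elts R"
  shows "small elts (otimes S R)"
  using powerset[OF powerset[OF small_Un[OF assms]]]
  by (rule separation) (auto simp: otimes_def opair_def elts_mk pairing small_single)

definition graph :: "'u set \<Rightarrow> ('u \<Rightarrow> 'u) \<Rightarrow> 'u" where
  "graph S f = mk ((\<lambda>x. opair x (f x)) ` S)"

text \<open>The graph records the values on \<open>S\<close>, and an extensional function is
  \<open>undefined\<close> elsewhere. Here the convention of extensional functors and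
  transformations makes the coding faithful.\<close>

lemma graph_inj:
  assumes S: "small elts S" and f: "f \<in> extensional S" and g: "g \<in> extensional S"
    and eq: "graph S f = graph S g"
  shows "f = g"
proof (rule extensionalityI[OF f g])
  fix x assume "x \<in> S"
  moreover have "(\<lambda>x. opair x (f x)) ` S = (\<lambda>x. opair x (g x)) ` S"
    using eq unfolding graph_def mk_eq_iff[OF replacement[OF S] replacement[OF S]] .
  ultimately have "opair x (f x) \<in> (\<lambda>x. opair x (g x)) ` S" by blast
  then show "f x = g x" by auto
qed

definition graphs :: "'u set \<Rightarrow> 'u set \<Rightarrow> 'u set" where
  "graphs S R = {graph S f |f. f \<in> S \<rightarrow> R}"

text \<open>A graph is a subset of the product of \<open>S\<close> and \<open>R\<close>, hence an
  element of its power set.\<close>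

lemma small_graphs:
  assumes "small elts S" "small elts R"
  shows "small elts (graphs S R)"
  using powerset[OF small_otimes[OF assms]]
  by (rule separation)
    (auto simp: graphs_def graph_def elts_mk[OF replacement[OF assms(1)]] otimes_def Pi_iff)

text \<open>A functor is coded as the pair of its two graphs. Smallness comes from the sets of all
  graphs between the given small sets, whose products contain every code.\<close>

lemma functor_category_small:
  assumes J: "small_category elts J" and X: "small_category elts X"
  obtains E e where "small_category elts E" "iso_of_categories (fun_cat J X) E e"
proof -
  have cat: "category J" "category X"
    and sm: "small elts (Obj J)" "small elts (Arr J)" "small elts (Obj X)" "small elts (Arr X)"
    using J X by (auto simp: small_category_def)
  define cf where "cf F = opair (graph (Obj J) (on_ob F)) (graph (Arr J) (on_ar F))"
    for F :: "('u, 'u, 'u, 'u) ftr"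
  \<comment> \<open>The components alone do not determine the ends of a transformation, so codes of
    both ends are stored with them.\<close>
  define cn where "cn \<tau> = opair (opair (cf (src \<tau>)) (cf (tgt \<tau>))) (graph (Obj J) (cmp \<tau>))"
    for \<tau> :: "('u, 'u, 'u, 'u) ntr"
  define S where "S = otimes (graphs (Obj J) (Obj X)) (graphs (Arr J) (Arr X))"
  have cfI: "F = G" if "is_functor J X F" "is_functor J X G" "cf F = cf G" for F G
  proof (rule ftr.equality)
    show "on_ob F = on_ob G"
      using that(3) by (intro graph_inj[OF sm(1) functor_ext_ob[OF that(1)] functor_ext_ob[OF that(2)]])
        (simp add: cf_def)
    show "on_ar F = on_ar G"
      using that(3) by (intro graph_inj[OF sm(2) functor_ext_ar[OF that(1)] functor_ext_ar[OF that(2)]])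
        (simp add: cf_def)
  qed simp
  have cfS: "cf F \<in> S" if "is_functor J X F" for F
    using functor_rules[OF that] unfolding S_def otimes_def graphs_def cf_def by blast
  have f: "inj_on cf (Obj (fun_cat J X))" using cfI by (auto simp: inj_on_def)
  have g: "inj_on cn (Arr (fun_cat J X))"
  proof (rule inj_onI)
    fix \<sigma> \<tau> assume st: "\<sigma> \<in> Arr (fun_cat J X)" "\<tau> \<in> Arr (fun_cat J X)" and e: "cn \<sigma> = cn \<tau>"
    have "cmp \<sigma> = cmp \<tau>"
      using st e graph_inj[OF sm(1)] by (auto simp: cn_def dest: natural_ext)
    moreover have "src \<sigma> = src \<tau>" "tgt \<sigma> = tgt \<tau>"
      using st e by (auto simp: cn_def intro!: cfI natural_src natural_tgt)
    ultimately show "\<sigma> = \<tau>" by (intro ntr.equality) simp_all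
  qed
  obtain E e where Ob: "Obj E = cf ` Obj (fun_cat J X)" and Ar: "Arr E = cn ` Arr (fun_cat J X)"
    and e: "iso_of_categories (fun_cat J X) E e"
    using transported_category[OF category_fun_cat[OF cat] f g] by blast
  have S: "small elts S"
    unfolding S_def by (intro small_otimes small_graphs sm)
  have "Obj E \<subseteq> S" using cfS by (auto simp: Ob)
  then have "small elts (Obj E)" by (rule separation[OF S])
  moreover have "Arr E \<subseteq> otimes (otimes S S) (graphs (Obj J) (Arr X))"
  proof
    fix a assume "a \<in> Arr E"
    then obtain \<tau> where \<tau>: "is_natural J X \<tau>" and a: "a = cn \<tau>" by (auto simp: Ar)
    have "cf (src \<tau>) \<in> S" "cf (tgt \<tau>) \<in> S"
      using \<tau> by (auto intro: cfS natural_src natural_tgt)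
    moreover have "cmp \<tau> \<in> Obj J \<rightarrow> Arr X" using natural_rules(1)[OF \<tau>] by blast
    ultimately show "a \<in> otimes (otimes S S) (graphs (Obj J) (Arr X))"
      unfolding a cn_def otimes_def graphs_def by blast
  qed
  then have "small elts (Arr E)"
    by (rule separation[OF small_otimes[OF small_otimes[OF S S] small_graphs[OF sm(1,4)]]])
  moreover have "category E"
    using e by (auto simp: iso_of_categories_def dest: functor_cod)
  ultimately show ?thesis using that e by (simp add: small_category_def)
qed

end

section \<open>Maps into a functor category\<close>

text \<open>Only mutually inverse functors between the functor category and \<open>E\<close> are
  visible here, so nothing below depends on how functors were coded.\<close>

locale power_category =
  fixes J :: "('j, 'i) cat" and X :: "('x, 'y) cat" and E :: "('p, 'q) cat"
    and enc :: "(('j, 'i, 'x, 'y) ftr, ('j, 'i, 'x, 'y) ntr, 'p, 'q) ftr"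
    and ev :: "('p, 'q, ('j, 'i, 'x, 'y) ftr, ('j, 'i, 'x, 'y) ntr) ftr"
  assumes J: "category J" and X: "category X"
    and enc: "is_functor (fun_cat J X) E enc" and ev: "is_functor E (fun_cat J X) ev"
    and ev_enc: "fcomp (fun_cat J X) ev enc = fid (fun_cat J X)"
    and enc_ev: "fcomp E enc ev = fid E"
begin

lemma E: "category E"
  by (rule functor_dom[OF ev])

text \<open>
  Objects \<open>e\<close> and arrows \<open>a\<close> of \<open>E\<close> code functors \<open>J \<rightarrow> X\<close> and transformations: \<open>ob e j\<close>, \<open>mo e u\<close> and
  \<open>co a j\<close> are the values at objects \<open>j\<close> and arrows \<open>u\<close> of \<open>J\<close>, and the components.
\<close>

definition ob :: "'p \<Rightarrow> 'j \<Rightarrow> 'x" where "ob e = on_ob (on_ob ev e)"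
definition mo :: "'p \<Rightarrow> 'i \<Rightarrow> 'y" where "mo e = on_ar (on_ob ev e)"
definition co :: "'q \<Rightarrow> 'j \<Rightarrow> 'y" where "co a = cmp (on_ar ev a)"

lemma is_functor_ev: "e \<in> Obj E \<Longrightarrow> is_functor J X (on_ob ev e)"
  using functor_rules(1)[OF ev] by simp

lemma is_natural_ev: "a \<in> Arr E \<Longrightarrow> is_natural J X (on_ar ev a)"
  using functor_rules(2)[OF ev] by simp

lemma ev_src_tgt: "a \<in> Arr E \<Longrightarrow> src (on_ar ev a) = on_ob ev (Dom E a)"
  "a \<in> Arr E \<Longrightarrow> tgt (on_ar ev a) = on_ob ev (Cod E a)"
  using functor_rules(3,4)[OF ev] by simp_all

lemma ev_enc_sel: "is_functor J X K \<Longrightarrow> on_ob ev (on_ob enc K) = K"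
  "is_natural J X \<tau> \<Longrightarrow> on_ar ev (on_ar enc \<tau>) = \<tau>"
  using fcomp_sel(1)[of K "fun_cat J X" ev enc] fcomp_sel(2)[of \<tau> "fun_cat J X" ev enc]
  by (simp_all add: ev_enc)

lemma enc_ev_sel: "e \<in> Obj E \<Longrightarrow> on_ob enc (on_ob ev e) = e"
  "a \<in> Arr E \<Longrightarrow> on_ar enc (on_ar ev a) = a"
  using fcomp_sel(1)[of e E enc ev] fcomp_sel(2)[of a E enc ev] by (simp_all add: enc_ev)

lemma enc_in: "is_functor J X K \<Longrightarrow> on_ob enc K \<in> Obj E"
  "is_natural J X \<tau> \<Longrightarrow> on_ar enc \<tau> \<in> Arr E"
  "is_natural J X \<tau> \<Longrightarrow> Dom E (on_ar enc \<tau>) = on_ob enc (src \<tau>)"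
  "is_natural J X \<tau> \<Longrightarrow> Cod E (on_ar enc \<tau>) = on_ob enc (tgt \<tau>)"
  using functor_rules[OF enc] by simp_all

lemma ob_mo_rules:
  assumes "e \<in> Obj E"
  shows "j \<in> Obj J \<Longrightarrow> ob e j \<in> Obj X"
    and "u \<in> Arr J \<Longrightarrow> mo e u \<in> Arr X"
    and "u \<in> Arr J \<Longrightarrow> Dom X (mo e u) = ob e (Dom J u)"
    and "u \<in> Arr J \<Longrightarrow> Cod X (mo e u) = ob e (Cod J u)"
    and "j \<in> Obj J \<Longrightarrow> mo e (Idn J j) = Idn X (ob e j)"
    and "\<lbrakk>u \<in> Arr J; v \<in> Arr J; Dom J v = Cod J u\<rbrakk> \<Longrightarrow> mo e (Comp J v u) = Comp X (mo e v) (mo e u)"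
  using functor_rules[OF is_functor_ev[OF assms]] by (simp_all add: ob_def mo_def)

lemma co_rules:
  assumes "a \<in> Arr E"
  shows "j \<in> Obj J \<Longrightarrow> co a j \<in> Arr X"
    and "j \<in> Obj J \<Longrightarrow> Dom X (co a j) = ob (Dom E a) j"
    and "j \<in> Obj J \<Longrightarrow> Cod X (co a j) = ob (Cod E a) j"
  using natural_rules[OF is_natural_ev[OF assms]] by (simp_all add: co_def ob_def ev_src_tgt assms)

lemma co_Idn: "e \<in> Obj E \<Longrightarrow> j \<in> Obj J \<Longrightarrow> co (Idn E e) j = Idn X (ob e j)"
  using functor_rules(5)[OF ev] by (simp add: co_def ob_def)

lemma co_Comp: "\<lbrakk>a \<in> Arr E; b \<in> Arr E; Dom E b = Cod E a; j \<in> Obj J\<rbrakk> \<Longrightarrow>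
    co (Comp E b a) j = Comp X (co b j) (co a j)"
  using functor_rules(6)[OF ev, of a b] by (simp add: co_def)

lemma co_naturality:
  assumes "a \<in> Arr E" "u \<in> Arr J"
  shows "Comp X (co a (Cod J u)) (mo (Dom E a) u) = Comp X (mo (Cod E a) u) (co a (Dom J u))"
  using naturality[OF is_natural_ev[OF assms(1)] assms(2)]
  by (simp add: co_def mo_def ev_src_tgt assms)

lemma Obj_eqI:
  assumes "e \<in> Obj E" "e' \<in> Obj E" "\<And>j. j \<in> Obj J \<Longrightarrow> ob e j = ob e' j"
    and "\<And>u. u \<in> Arr J \<Longrightarrow> mo e u = mo e' u"
  shows "e = e'"
proof -
  have "on_ob ev e = on_ob ev e'"
    by (rule functor_eqI[OF is_functor_ev is_functor_ev])
      (use assms in \<open>simp_all add: ob_def mo_def\<close>)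
  then show ?thesis using assms(1,2) enc_ev_sel(1) by metis
qed

lemma Arr_eqI:
  assumes "a \<in> Arr E" "a' \<in> Arr E" "Dom E a = Dom E a'" "Cod E a = Cod E a'"
    and "\<And>j. j \<in> Obj J \<Longrightarrow> co a j = co a' j"
  shows "a = a'"
proof -
  have "on_ar ev a = on_ar ev a'"
    by (rule natural_eqI[OF is_natural_ev is_natural_ev])
      (use assms in \<open>simp_all add: ev_src_tgt co_def\<close>)
  then show ?thesis using assms(1,2) enc_ev_sel(2) by metis
qed

text \<open>A total operation; it yields an arrow of \<open>E\<close> with the prescribed ends and
  components when the family \<open>t\<close> is well typed and natural in \<open>J\<close>, as
  shown next.\<close>

definition arrow :: "'p \<Rightarrow> 'p \<Rightarrow> ('j \<Rightarrow> 'y) \<Rightarrow> 'q" where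
  "arrow e e' t = on_ar enc \<lparr>src = on_ob ev e, tgt = on_ob ev e', cmp = restrict t (Obj J)\<rparr>"

lemma arrow_rules:
  assumes e: "e \<in> Obj E" "e' \<in> Obj E"
    and t: "\<And>j. j \<in> Obj J \<Longrightarrow> t j \<in> Arr X" "\<And>j. j \<in> Obj J \<Longrightarrow> Dom X (t j) = ob e j"
      "\<And>j. j \<in> Obj J \<Longrightarrow> Cod X (t j) = ob e' j"
    and nat: "\<And>u. u \<in> Arr J \<Longrightarrow> Comp X (t (Cod J u)) (mo e u) = Comp X (mo e' u) (t (Dom J u))"
  shows "arrow e e' t \<in> Arr E" "Dom E (arrow e e' t) = e" "Cod E (arrow e e' t) = e'"
    "j \<in> Obj J \<Longrightarrow> co (arrow e e' t) j = t j"
proof -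
  have "is_natural J X \<lparr>src = on_ob ev e, tgt = on_ob ev e', cmp = restrict t (Obj J)\<rparr>"
    by (rule naturalI) (use assms in \<open>simp_all add: is_functor_ev ob_def mo_def cat_rules[OF J]\<close>)
  note r = enc_in(2-4)[OF this] ev_enc_sel(2)[OF this]
  show "arrow e e' t \<in> Arr E" "Dom E (arrow e e' t) = e" "Cod E (arrow e e' t) = e'"
    "j \<in> Obj J \<Longrightarrow> co (arrow e e' t) j = t j"
    using r by (simp_all add: arrow_def co_def enc_ev_sel e)
qed

text \<open>A transformation with invertible components is invertible: the inverses are chosen at
  each \<open>j\<close>, and their naturality follows from that of \<open>a\<close>.\<close>

lemma iso_E:
  assumes a: "a \<in> Arr E" and i: "\<And>j. j \<in> Obj J \<Longrightarrow> iso X (co a j)"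
  shows "iso E a"
proof -
  note [simp] = cat_rules[OF X] cat_rules[OF J] cat_rules[OF E] a
  have "\<exists>g. g \<in> Arr X \<and> Dom X g = ob (Cod E a) j \<and> Cod X g = ob (Dom E a) j \<and>
      Comp X g (co a j) = Idn X (ob (Dom E a) j) \<and> Comp X (co a j) g = Idn X (ob (Cod E a) j)"
    if j: "j \<in> Obj J" for j
    using isoE[OF i[OF j]] co_rules[OF a j] by metis
  then obtain b where [simp]: "\<And>j. j \<in> Obj J \<Longrightarrow> b j \<in> Arr X"
      "\<And>j. j \<in> Obj J \<Longrightarrow> Dom X (b j) = ob (Cod E a) j" "\<And>j. j \<in> Obj J \<Longrightarrow> Cod X (b j) = ob (Dom E a) j"
    and b: "\<And>j. j \<in> Obj J \<Longrightarrow> Comp X (b j) (co a j) = Idn X (ob (Dom E a) j)"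
      "\<And>j. j \<in> Obj J \<Longrightarrow> Comp X (co a j) (b j) = Idn X (ob (Cod E a) j)"
    by metis
  note [simp] = co_rules[OF a] ob_mo_rules
  have nat: "Comp X (b (Cod J u)) (mo (Cod E a) u) = Comp X (mo (Dom E a) u) (b (Dom J u))"
    if [simp]: "u \<in> Arr J" for u
  proof -
    \<comment> \<open>An identity, written as \<open>co a\<close> after \<open>b\<close>, is
      inserted at \<open>Dom J u\<close>; naturality of \<open>a\<close> moves \<open>co a\<close>
      to \<open>Cod J u\<close>, where it cancels against \<open>b\<close>.\<close>
    have "Comp X (b (Cod J u)) (mo (Cod E a) u) =
        Comp X (b (Cod J u)) (Comp X (mo (Cod E a) u) (Comp X (co a (Dom J u)) (b (Dom J u))))"
      by (simp add: b)
    also have "\<dots> = Comp X (b (Cod J u)) (Comp X (Comp X (mo (Cod E a) u) (co a (Dom J u))) (b (Dom J u)))"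
      by simp
    also have "\<dots> = Comp X (Comp X (b (Cod J u)) (co a (Cod J u))) (Comp X (mo (Dom E a) u) (b (Dom J u)))"
      unfolding co_naturality[OF a that, symmetric] by simp
    also have "\<dots> = Comp X (mo (Dom E a) u) (b (Dom J u))"
      unfolding b(1)[OF cat_rules(2)[OF J that]] by simp
    finally show ?thesis .
  qed
  have ar: "arrow (Cod E a) (Dom E a) b \<in> Arr E" "Dom E (arrow (Cod E a) (Dom E a) b) = Cod E a"
    "Cod E (arrow (Cod E a) (Dom E a) b) = Dom E a"
    "\<And>j. j \<in> Obj J \<Longrightarrow> co (arrow (Cod E a) (Dom E a) b) j = b j"
    by (rule arrow_rules; simp add: nat)+
  show ?thesis
  proof (rule isoI[OF a ar(1-3)])
    show "Comp E (arrow (Cod E a) (Dom E a) b) a = Idn E (Dom E a)"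
      by (rule Arr_eqI) (simp_all add: ar co_Idn co_Comp b)
    show "Comp E a (arrow (Cod E a) (Dom E a) b) = Idn E (Cod E a)"
      by (rule Arr_eqI) (simp_all add: ar co_Idn co_Comp b)
  qed
qed

text \<open>Evaluation at an object of \<open>J\<close>, as a functor on the coded functor category.
  An arrow \<open>u\<close> of \<open>J\<close> induces the transformation \<open>tr u\<close>
  between two such evaluations.\<close>

definition pt :: "'j \<Rightarrow> ('p, 'q, 'x, 'y) ftr" where
  "pt j = \<lparr>on_ob = (\<lambda>e\<in>Obj E. ob e j), on_ar = (\<lambda>a\<in>Arr E. co a j)\<rparr>"

definition tr :: "'i \<Rightarrow> ('p, 'q, 'x, 'y) ntr" where
  "tr u = \<lparr>src = pt (Dom J u), tgt = pt (Cod J u), cmp = (\<lambda>e\<in>Obj E. mo e u)\<rparr>"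

lemma pt_sel [simp]: "e \<in> Obj E \<Longrightarrow> on_ob (pt j) e = ob e j" "a \<in> Arr E \<Longrightarrow> on_ar (pt j) a = co a j"
  "on_ob (pt j) \<in> extensional (Obj E)" "on_ar (pt j) \<in> extensional (Arr E)"
  by (simp_all add: pt_def)

lemma tr_sel [simp]: "src (tr u) = pt (Dom J u)" "tgt (tr u) = pt (Cod J u)"
  "e \<in> Obj E \<Longrightarrow> cmp (tr u) e = mo e u" "cmp (tr u) \<in> extensional (Obj E)"
  by (simp_all add: tr_def)

lemma is_functor_pt: "j \<in> Obj J \<Longrightarrow> is_functor E X (pt j)"
  by (rule functorI) (simp_all add: E X ob_mo_rules co_rules co_Idn co_Comp cat_rules[OF E])

lemma is_natural_tr: "u \<in> Arr J \<Longrightarrow> is_natural E X (tr u)"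
  by (rule naturalI)
    (simp_all add: is_functor_pt cat_rules[OF E] cat_rules[OF J] ob_mo_rules co_naturality)

text \<open>Exponential transposition: functors from \<open>A\<close> into a functor category on
  \<open>J\<close> are the same as functors from \<open>J\<close> into the functors from
  \<open>A\<close>. The local \<open>s x\<close> is the functor on \<open>J\<close> obtained by
  fixing \<open>x\<close>.\<close>

definition lift_ftr :: "('o, 'a) cat \<Rightarrow> ('j \<Rightarrow> ('o, 'a, 'x, 'y) ftr) \<Rightarrow> ('i \<Rightarrow> ('o, 'a, 'x, 'y) ntr) \<Rightarrow>
    ('o, 'a, 'p, 'q) ftr" where
  "lift_ftr A K \<kappa> =
    (let s = (\<lambda>x. \<lparr>on_ob = (\<lambda>j\<in>Obj J. on_ob (K j) x), on_ar = (\<lambda>u\<in>Arr J. cmp (\<kappa> u) x)\<rparr>) in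
      \<lparr>on_ob = (\<lambda>x\<in>Obj A. on_ob enc (s x)),
       on_ar = (\<lambda>f\<in>Arr A. arrow (on_ob enc (s (Dom A f))) (on_ob enc (s (Cod A f))) (\<lambda>j. on_ar (K j) f))\<rparr>)"

lemma lift_ftr:
  assumes A: "category A" and K: "\<And>j. j \<in> Obj J \<Longrightarrow> is_functor A X (K j)"
    and \<kappa>: "\<And>u. u \<in> Arr J \<Longrightarrow> is_natural A X (\<kappa> u)"
      "\<And>u. u \<in> Arr J \<Longrightarrow> src (\<kappa> u) = K (Dom J u)" "\<And>u. u \<in> Arr J \<Longrightarrow> tgt (\<kappa> u) = K (Cod J u)"
    and Idn: "\<And>j x. j \<in> Obj J \<Longrightarrow> x \<in> Obj A \<Longrightarrow> cmp (\<kappa> (Idn J j)) x = Idn X (on_ob (K j) x)"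
    and Comp: "\<And>u v x. \<lbrakk>u \<in> Arr J; v \<in> Arr J; Dom J v = Cod J u; x \<in> Obj A\<rbrakk> \<Longrightarrow>
      cmp (\<kappa> (Comp J v u)) x = Comp X (cmp (\<kappa> v) x) (cmp (\<kappa> u) x)"
  shows "is_functor A E (lift_ftr A K \<kappa>)"
    "\<lbrakk>x \<in> Obj A; j \<in> Obj J\<rbrakk> \<Longrightarrow> ob (on_ob (lift_ftr A K \<kappa>) x) j = on_ob (K j) x"
    "\<lbrakk>x \<in> Obj A; u \<in> Arr J\<rbrakk> \<Longrightarrow> mo (on_ob (lift_ftr A K \<kappa>) x) u = cmp (\<kappa> u) x"
    "\<lbrakk>f \<in> Arr A; j \<in> Obj J\<rbrakk> \<Longrightarrow> co (on_ar (lift_ftr A K \<kappa>) f) j = on_ar (K j) f"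
proof -
  note [simp] = cat_rules[OF A] cat_rules[OF J] cat_rules[OF X] cat_rules[OF E] functor_rules[OF K]
    natural_rules[OF \<kappa>(1)] \<kappa>(2,3) Idn Comp
  define s where "s x = \<lparr>on_ob = (\<lambda>j\<in>Obj J. on_ob (K j) x), on_ar = (\<lambda>u\<in>Arr J. cmp (\<kappa> u) x)\<rparr>" for x
  have s: "is_functor J X (s x)" if "x \<in> Obj A" for x
    by (rule functorI) (use that in \<open>simp_all add: J X s_def\<close>)
  have e: "on_ob enc (s x) \<in> Obj E" "j \<in> Obj J \<Longrightarrow> ob (on_ob enc (s x)) j = on_ob (K j) x"
    "u \<in> Arr J \<Longrightarrow> mo (on_ob enc (s x)) u = cmp (\<kappa> u) x" if "x \<in> Obj A" for x j u
    using ev_enc_sel(1)[OF s[OF that]] enc_in(1)[OF s[OF that]]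
    by (simp_all add: ob_def mo_def) (simp_all add: s_def)
  \<comment> \<open>The naturality square of \<open>\<kappa> u\<close> at \<open>f\<close>, read the
    other way round: the arrows \<open>on_ar (K j) f\<close> are natural in \<open>j\<close>, hence
    the components of an arrow of \<open>E\<close>.\<close>
  have nat: "Comp X (on_ar (K (Cod J u)) f) (cmp (\<kappa> u) (Dom A f)) =
      Comp X (cmp (\<kappa> u) (Cod A f)) (on_ar (K (Dom J u)) f)" if "u \<in> Arr J" "f \<in> Arr A" for u f
    using naturality[OF \<kappa>(1)[OF that(1)] that(2)] that by simp
  have ar: "arrow (on_ob enc (s (Dom A f))) (on_ob enc (s (Cod A f))) (\<lambda>j. on_ar (K j) f) \<in> Arr E"
    "Dom E (arrow (on_ob enc (s (Dom A f))) (on_ob enc (s (Cod A f))) (\<lambda>j. on_ar (K j) f)) = on_ob enc (s (Dom A f))"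
    "Cod E (arrow (on_ob enc (s (Dom A f))) (on_ob enc (s (Cod A f))) (\<lambda>j. on_ar (K j) f)) = on_ob enc (s (Cod A f))"
    "j \<in> Obj J \<Longrightarrow> co (arrow (on_ob enc (s (Dom A f))) (on_ob enc (s (Cod A f))) (\<lambda>j. on_ar (K j) f)) j = on_ar (K j) f"
    if "f \<in> Arr A" for f j
    using that by (auto intro!: arrow_rules simp: e nat)
  have sel: "x \<in> Obj A \<Longrightarrow> on_ob (lift_ftr A K \<kappa>) x = on_ob enc (s x)"
    "f \<in> Arr A \<Longrightarrow> on_ar (lift_ftr A K \<kappa>) f =
      arrow (on_ob enc (s (Dom A f))) (on_ob enc (s (Cod A f))) (\<lambda>j. on_ar (K j) f)"
    "on_ob (lift_ftr A K \<kappa>) \<in> extensional (Obj A)" "on_ar (lift_ftr A K \<kappa>) \<in> extensional (Arr A)" for x f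
    by (simp_all add: lift_ftr_def s_def)
  show "is_functor A E (lift_ftr A K \<kappa>)"
  proof (rule functorI)
    fix x assume x: "x \<in> Obj A"
    show "on_ar (lift_ftr A K \<kappa>) (Idn A x) = Idn E (on_ob (lift_ftr A K \<kappa>) x)"
      by (rule Arr_eqI) (use x ar[of "Idn A x"] in \<open>simp_all add: sel e co_Idn\<close>)
  next
    fix f g assume fg: "f \<in> Arr A" "g \<in> Arr A" "Dom A g = Cod A f"
    show "on_ar (lift_ftr A K \<kappa>) (Comp A g f) =
        Comp E (on_ar (lift_ftr A K \<kappa>) g) (on_ar (lift_ftr A K \<kappa>) f)"
      unfolding sel(2)[OF fg(1)] sel(2)[OF fg(2)] sel(2)[OF cat_rules(6)[OF A fg]]
      by (rule Arr_eqI) (use fg ar[of g] ar[of f] ar[of "Comp A g f"] in \<open>simp_all add: e co_Comp\<close>)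
  qed (simp_all add: A E sel e ar)
  show "\<lbrakk>x \<in> Obj A; j \<in> Obj J\<rbrakk> \<Longrightarrow> ob (on_ob (lift_ftr A K \<kappa>) x) j = on_ob (K j) x"
    "\<lbrakk>x \<in> Obj A; u \<in> Arr J\<rbrakk> \<Longrightarrow> mo (on_ob (lift_ftr A K \<kappa>) x) u = cmp (\<kappa> u) x"
    "\<lbrakk>f \<in> Arr A; j \<in> Obj J\<rbrakk> \<Longrightarrow> co (on_ar (lift_ftr A K \<kappa>) f) j = on_ar (K j) f"
    by (simp_all add: sel e ar)
qed

definition lift_ntr :: "('o, 'a) cat \<Rightarrow> ('o, 'a, 'p, 'q) ftr \<Rightarrow> ('o, 'a, 'p, 'q) ftr \<Rightarrow>
    ('j \<Rightarrow> 'o \<Rightarrow> 'y) \<Rightarrow> ('o, 'a, 'p, 'q) ntr" where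
  "lift_ntr A G G' t = \<lparr>src = G, tgt = G',
    cmp = (\<lambda>x\<in>Obj A. arrow (on_ob G x) (on_ob G' x) (\<lambda>j. t j x))\<rparr>"

lemma lift_ntr_sel [simp]: "src (lift_ntr A G G' t) = G" "tgt (lift_ntr A G G' t) = G'"
  "cmp (lift_ntr A G G' t) \<in> extensional (Obj A)"
  by (simp_all add: lift_ntr_def)

text \<open>The two naturality conditions have different duties: \<open>natJ\<close> makes each
  component an arrow of \<open>E\<close>, and \<open>natA\<close> makes these arrows natural in
  \<open>A\<close>.\<close>

lemma lift_ntr:
  assumes G: "is_functor A E G" and G': "is_functor A E G'"
    and t: "\<And>j x. j \<in> Obj J \<Longrightarrow> x \<in> Obj A \<Longrightarrow> t j x \<in> Arr X"
      "\<And>j x. j \<in> Obj J \<Longrightarrow> x \<in> Obj A \<Longrightarrow> Dom X (t j x) = ob (on_ob G x) j"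
      "\<And>j x. j \<in> Obj J \<Longrightarrow> x \<in> Obj A \<Longrightarrow> Cod X (t j x) = ob (on_ob G' x) j"
    and natJ: "\<And>u x. u \<in> Arr J \<Longrightarrow> x \<in> Obj A \<Longrightarrow>
      Comp X (t (Cod J u) x) (mo (on_ob G x) u) = Comp X (mo (on_ob G' x) u) (t (Dom J u) x)"
    and natA: "\<And>j f. j \<in> Obj J \<Longrightarrow> f \<in> Arr A \<Longrightarrow>
      Comp X (t j (Cod A f)) (co (on_ar G f) j) = Comp X (co (on_ar G' f) j) (t j (Dom A f))"
  shows "is_natural A E (lift_ntr A G G' t)"
    "\<lbrakk>x \<in> Obj A; j \<in> Obj J\<rbrakk> \<Longrightarrow> co (cmp (lift_ntr A G G' t) x) j = t j x"
proof -
  note [simp] = functor_rules[OF G] functor_rules[OF G'] t natJ cat_rules[OF functor_dom[OF G]]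
    cat_rules[OF E]
  have ar: "arrow (on_ob G x) (on_ob G' x) (\<lambda>j. t j x) \<in> Arr E"
    "Dom E (arrow (on_ob G x) (on_ob G' x) (\<lambda>j. t j x)) = on_ob G x"
    "Cod E (arrow (on_ob G x) (on_ob G' x) (\<lambda>j. t j x)) = on_ob G' x"
    "j \<in> Obj J \<Longrightarrow> co (arrow (on_ob G x) (on_ob G' x) (\<lambda>j. t j x)) j = t j x"
    if "x \<in> Obj A" for x j
    using that by (auto intro!: arrow_rules)
  have sel: "x \<in> Obj A \<Longrightarrow> cmp (lift_ntr A G G' t) x = arrow (on_ob G x) (on_ob G' x) (\<lambda>j. t j x)" for x
    by (simp add: lift_ntr_def)
  show "is_natural A E (lift_ntr A G G' t)"
  proof (rule naturalI)
    fix f assume f: "f \<in> Arr A"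
    then show "Comp E (cmp (lift_ntr A G G' t) (Cod A f)) (on_ar (src (lift_ntr A G G' t)) f) =
        Comp E (on_ar (tgt (lift_ntr A G G' t)) f) (cmp (lift_ntr A G G' t) (Dom A f))"
      by (intro Arr_eqI) (simp_all add: sel ar co_Comp natA)
  qed (simp_all add: G G' sel ar)
  show "\<lbrakk>x \<in> Obj A; j \<in> Obj J\<rbrakk> \<Longrightarrow> co (cmp (lift_ntr A G G' t) x) j = t j x"
    by (simp add: sel ar)
qed

text \<open>An object of \<open>E\<close> codes a functor, not just a family of objects, so its
  values on arrows of \<open>J\<close> have to be compared too; arrows of \<open>E\<close> with
  equal ends are told apart by their components alone.\<close>

lemma functor_E_eqI:
  assumes G: "is_functor A E G" and G': "is_functor A E G'"
    and ob: "\<And>x j. x \<in> Obj A \<Longrightarrow> j \<in> Obj J \<Longrightarrow> ob (on_ob G x) j = ob (on_ob G' x) j"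
    and mo: "\<And>x u. x \<in> Obj A \<Longrightarrow> u \<in> Arr J \<Longrightarrow> mo (on_ob G x) u = mo (on_ob G' x) u"
    and co: "\<And>f j. f \<in> Arr A \<Longrightarrow> j \<in> Obj J \<Longrightarrow> co (on_ar G f) j = co (on_ar G' f) j"
  shows "G = G'"
proof (rule functor_eqI[OF G G'])
  note [simp] = functor_rules[OF G] functor_rules[OF G'] cat_rules[OF functor_dom[OF G]]
  show *: "on_ob G x = on_ob G' x" if "x \<in> Obj A" for x
    using that by (intro Obj_eqI) (simp_all add: ob mo)
  show "on_ar G f = on_ar G' f" if "f \<in> Arr A" for f
    using that by (intro Arr_eqI) (simp_all add: * co)
qed

lemma natural_E_eqI:
  assumes s: "is_natural A E \<sigma>" and t: "is_natural A E \<tau>" and e: "src \<sigma> = src \<tau>" "tgt \<sigma> = tgt \<tau>"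
    and co: "\<And>x j. x \<in> Obj A \<Longrightarrow> j \<in> Obj J \<Longrightarrow> co (cmp \<sigma> x) j = co (cmp \<tau> x) j"
  shows "\<sigma> = \<tau>"
  by (rule natural_eqI[OF s t e], rule Arr_eqI)
    (simp_all add: natural_rules[OF s] natural_rules[OF t] e co)

end

section \<open>Pointwise lifting of the endomorphism theory\<close>

context power_category
begin

lemma map_ob: "es \<in> Obj (pow n E) \<Longrightarrow> j \<in> Obj J \<Longrightarrow> map (\<lambda>e. ob e j) es \<in> Obj (pow n X)"
  "as \<in> Arr (pow n E) \<Longrightarrow> j \<in> Obj J \<Longrightarrow> map (\<lambda>a. co a j) as \<in> Arr (pow n X)"
  "es \<in> Obj (pow n E) \<Longrightarrow> u \<in> Arr J \<Longrightarrow> map (\<lambda>e. mo e u) es \<in> Arr (pow n X)"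
  by (auto simp: pow_sel ob_mo_rules co_rules)

lemma map_ob_Dom_Cod:
  "as \<in> Arr (pow n E) \<Longrightarrow> j \<in> Obj J \<Longrightarrow>
    Dom (pow n X) (map (\<lambda>a. co a j) as) = map (\<lambda>e. ob e j) (Dom (pow n E) as)"
  "as \<in> Arr (pow n E) \<Longrightarrow> j \<in> Obj J \<Longrightarrow>
    Cod (pow n X) (map (\<lambda>a. co a j) as) = map (\<lambda>e. ob e j) (Cod (pow n E) as)"
  "es \<in> Obj (pow n E) \<Longrightarrow> u \<in> Arr J \<Longrightarrow>
    Dom (pow n X) (map (\<lambda>e. mo e u) es) = map (\<lambda>e. ob e (Dom J u)) es"
  "es \<in> Obj (pow n E) \<Longrightarrow> u \<in> Arr J \<Longrightarrow>
    Cod (pow n X) (map (\<lambda>e. mo e u) es) = map (\<lambda>e. ob e (Cod J u)) es"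
  by (auto simp: pow_sel ob_mo_rules co_rules)

text \<open>\<open>Lf\<close> and \<open>Ln\<close> are the strict map of theories from \<open>End(X)\<close> to \<open>End(E)\<close> and its action on 2-cells.\<close>

definition Lf :: "nat \<Rightarrow> ('x list, 'y list, 'x, 'y) ftr \<Rightarrow> ('p list, 'q list, 'p, 'q) ftr" where
  "Lf n F = lift_ftr (pow n E) (\<lambda>j. fcomp (pow n E) F (fpow n E (pt j)))
    (\<lambda>u. hcomp (pow n E) X (nid (pow n X) X F) (npow n E (tr u)))"

definition Ln :: "nat \<Rightarrow> ('x list, 'y list, 'x, 'y) ntr \<Rightarrow> ('p list, 'q list, 'p, 'q) ntr" where
  "Ln n \<tau> = lift_ntr (pow n E) (Lf n (src \<tau>)) (Lf n (tgt \<tau>)) (\<lambda>j es. cmp \<tau> (map (\<lambda>e. ob e j) es))"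

lemma map_pt: "es \<in> Obj (pow n E) \<Longrightarrow> map (on_ob (pt j)) es = map (\<lambda>e. ob e j) es"
  "as \<in> Arr (pow n E) \<Longrightarrow> map (on_ar (pt j)) as = map (\<lambda>a. co a j) as"
  "es \<in> Obj (pow n E) \<Longrightarrow> map (cmp (tr u)) es = map (\<lambda>e. mo e u) es"
  by (auto simp: pow_sel)

text \<open>The transposed family is \<open>F\<close> after the power of evaluation at
  \<open>j\<close>, with \<open>F\<close> whiskered onto the power of \<open>tr u\<close>; so the
  lifted functor is computed by applying \<open>F\<close> to lists of values.\<close>

lemma Lf:
  assumes F: "is_functor (pow n X) X F"
  shows "is_functor (pow n E) E (Lf n F)"
    "\<lbrakk>es \<in> Obj (pow n E); j \<in> Obj J\<rbrakk> \<Longrightarrow> ob (on_ob (Lf n F) es) j = on_ob F (map (\<lambda>e. ob e j) es)"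
    "\<lbrakk>es \<in> Obj (pow n E); u \<in> Arr J\<rbrakk> \<Longrightarrow> mo (on_ob (Lf n F) es) u = on_ar F (map (\<lambda>e. mo e u) es)"
    "\<lbrakk>as \<in> Arr (pow n E); j \<in> Obj J\<rbrakk> \<Longrightarrow> co (on_ar (Lf n F) as) j = on_ar F (map (\<lambda>a. co a j) as)"
proof -
  note A = category_pow[OF E, of n]
  note [simp] = cat_rules[OF J]
  let ?K = "\<lambda>j. fcomp (pow n E) F (fpow n E (pt j))"
  let ?k = "\<lambda>u. hcomp (pow n E) X (nid (pow n X) X F) (npow n E (tr u))"
  have K: "is_functor (pow n E) X (?K j)" if "j \<in> Obj J" for j
    by (rule is_functor_fcomp[OF is_functor_fpow[OF is_functor_pt[OF that]] F])
  have k: "is_natural (pow n E) X (?k u)" if "u \<in> Arr J" for u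
    by (rule is_natural_hcomp[OF is_natural_npow[OF is_natural_tr[OF that]] is_natural_nid[OF F]])
  have kc: "cmp (?k u) es = on_ar F (map (\<lambda>e. mo e u) es)" if "u \<in> Arr J" "es \<in> Obj (pow n E)" for u es
    using cmp_hcomp_nid_left[OF is_natural_npow[OF is_natural_tr[OF that(1)]] F that(2)] that(2)
    by (simp add: map_pt)
  have Idn: "cmp (?k (Idn J j)) es = Idn X (on_ob (?K j) es)" if j: "j \<in> Obj J" and es: "es \<in> Obj (pow n E)" for j es
  proof -
    \<comment> \<open>Each entry codes a functor on \<open>J\<close> and preserves the identity, so
      the list is an identity of the power, which \<open>F\<close> preserves. Composites are treated
      in the same way below.\<close>
    have "map (\<lambda>e. mo e (Idn J j)) es = Idn (pow n X) (map (\<lambda>e. ob e j) es)"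
      using j es by (auto simp: pow_sel ob_mo_rules)
    then show ?thesis
      using functor_rules(5)[OF F map_ob(1)[OF es j]] j es
      by (simp add: kc map_pt del: hcomp_sel)
  qed
  have Comp: "cmp (?k (Comp J v u)) es = Comp X (cmp (?k v) es) (cmp (?k u) es)"
    if uv: "u \<in> Arr J" "v \<in> Arr J" "Dom J v = Cod J u" and es: "es \<in> Obj (pow n E)" for u v es
  proof -
    have "map (\<lambda>e. mo e (Comp J v u)) es = Comp (pow n X) (map (\<lambda>e. mo e v) es) (map (\<lambda>e. mo e u) es)"
      using uv es by (auto simp: pow_sel ob_mo_rules list_eq_iff_nth_eq subset_set_conv_nth)
    moreover have "Dom (pow n X) (map (\<lambda>e. mo e v) es) = Cod (pow n X) (map (\<lambda>e. mo e u) es)"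
      using uv es by (simp add: map_ob_Dom_Cod)
    ultimately show ?thesis
      using functor_rules(6)[OF F map_ob(3)[OF es uv(1)] map_ob(3)[OF es uv(2)]] uv es
      by (simp add: kc del: hcomp_sel)
  qed
  have st: "src (?k u) = ?K (Dom J u)" "tgt (?k u) = ?K (Cod J u)" for u by simp_all
  note l = lift_ftr[OF A K k st Idn Comp]
  show "is_functor (pow n E) E (Lf n F)" unfolding Lf_def by (rule l(1))
  show "\<lbrakk>es \<in> Obj (pow n E); j \<in> Obj J\<rbrakk> \<Longrightarrow> ob (on_ob (Lf n F) es) j = on_ob F (map (\<lambda>e. ob e j) es)"
    unfolding Lf_def by (subst l(2)) (simp_all add: map_pt)
  show "\<lbrakk>es \<in> Obj (pow n E); u \<in> Arr J\<rbrakk> \<Longrightarrow> mo (on_ob (Lf n F) es) u = on_ar F (map (\<lambda>e. mo e u) es)"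
    unfolding Lf_def by (subst l(3)) (simp_all add: kc del: hcomp_sel)
  show "\<lbrakk>as \<in> Arr (pow n E); j \<in> Obj J\<rbrakk> \<Longrightarrow> co (on_ar (Lf n F) as) j = on_ar F (map (\<lambda>a. co a j) as)"
    unfolding Lf_def by (subst l(4)) (simp_all add: map_pt)
qed

lemma Ln_sel [simp]: "src (Ln n \<tau>) = Lf n (src \<tau>)" "tgt (Ln n \<tau>) = Lf n (tgt \<tau>)"
  by (simp_all add: Ln_def)

text \<open>Naturality of \<tau> is used at two kinds of lists: at the values on an arrow of
  \<open>J\<close>, which makes the components arrows of \<open>E\<close>, and at the components of
  arrows of \<open>E\<close>, which makes the family natural.\<close>

lemma Ln:
  assumes t: "is_natural (pow n X) X \<tau>"
  shows "is_natural (pow n E) E (Ln n \<tau>)"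
    "\<lbrakk>es \<in> Obj (pow n E); j \<in> Obj J\<rbrakk> \<Longrightarrow> co (cmp (Ln n \<tau>) es) j = cmp \<tau> (map (\<lambda>e. ob e j) es)"
proof -
  note Ls = Lf[OF natural_src[OF t]] and Lt = Lf[OF natural_tgt[OF t]]
  note A = category_pow[OF E, of n]
  note [simp] = natural_rules[OF t] Ls Lt map_ob cat_rules[OF J] cat_rules[OF A]
  have natJ: "Comp X (cmp \<tau> (map (\<lambda>e. ob e (Cod J u)) es)) (on_ar (src \<tau>) (map (\<lambda>e. mo e u) es)) =
      Comp X (on_ar (tgt \<tau>) (map (\<lambda>e. mo e u) es)) (cmp \<tau> (map (\<lambda>e. ob e (Dom J u)) es))"
    if "u \<in> Arr J" "es \<in> Obj (pow n E)" for u es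
    using naturality[OF t map_ob(3)[OF that(2,1)]] that by (simp add: map_ob_Dom_Cod)
  have natA: "Comp X (cmp \<tau> (map (\<lambda>e. ob e j) (Cod (pow n E) as))) (on_ar (src \<tau>) (map (\<lambda>a. co a j) as)) =
      Comp X (on_ar (tgt \<tau>) (map (\<lambda>a. co a j) as)) (cmp \<tau> (map (\<lambda>e. ob e j) (Dom (pow n E) as)))"
    if "j \<in> Obj J" "as \<in> Arr (pow n E)" for j as
    using naturality[OF t map_ob(2)[OF that(2,1)]] that by (simp add: map_ob_Dom_Cod)
  show "is_natural (pow n E) E (Ln n \<tau>)"
    "\<lbrakk>es \<in> Obj (pow n E); j \<in> Obj J\<rbrakk> \<Longrightarrow> co (cmp (Ln n \<tau>) es) j = cmp \<tau> (map (\<lambda>e. ob e j) es)"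
    unfolding Ln_def by (rule lift_ntr; simp add: natJ natA)+
qed

lemma Ln_natural_iso:
  assumes "natural_iso (pow n X) X F G \<tau>"
  shows "natural_iso (pow n E) E (Lf n F) (Lf n G) (Ln n \<tau>)"
proof -
  note t = natural_isoD[OF assms]
  show ?thesis
    unfolding natural_iso_def
    using Ln[OF t(1)] t(2,3) natural_rules(1)[OF Ln(1)[OF t(1)]]
    by (auto intro!: iso_E t(4) map_ob)
qed

section \<open>Strictness of the lifting for substitution, unit and composition\<close>

lemma reindex_map_E:
  assumes f: "index_map k l f" and "length es = l"
  shows "reindex f (map h es) = map h (reindex f es)"
  using assms index_mapD(3)[OF f] by (simp add: reindex_map)

text \<open>Evaluating every entry of a list commutes with reindexing it, so substitution is
  preserved strictly and not just up to isomorphism.\<close>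

lemma Lf_fsub:
  assumes f: "index_map k l f" and F: "is_functor (pow k X) X F"
  shows "Lf l (fsub X l f F) = fsub E l f (Lf k F)"
proof -
  note fs = is_functor_fsub[OF f X F]
  note L = Lf[OF F] and Ls = Lf[OF fs]
  have len: "es \<in> Obj (pow l E) \<Longrightarrow> length es = l" "as \<in> Arr (pow l E) \<Longrightarrow> length as = l" for es as
    by (auto simp: pow_sel)
  note [simp] = L Ls map_ob reindex_pow[OF f] len reindex_map_E[OF f]
  show ?thesis
    by (rule functor_E_eqI[OF Ls(1) is_functor_fsub[OF f E L(1)]]) simp_all
qed

lemma Ln_nsub:
  assumes f: "index_map k l f" and t: "is_natural (pow k X) X \<tau>"
  shows "Ln l (nsub X l f \<tau>) = nsub E l f (Ln k \<tau>)"
proof -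
  note ns = is_natural_nsub[OF f X t]
  have len: "es \<in> Obj (pow l E) \<Longrightarrow> length es = l" for es by (auto simp: pow_sel)
  note [simp] = Ln[OF t] Ln[OF ns] map_ob reindex_pow[OF f] len reindex_map_E[OF f]
  show ?thesis
    by (rule natural_E_eqI[OF Ln(1)[OF ns] is_natural_nsub[OF f E Ln(1)[OF t]]])
      (simp_all add: Lf_fsub[OF f natural_src[OF t]] Lf_fsub[OF f natural_tgt[OF t]])
qed

lemma Lf_funit: "Lf (Suc 0) (funit X) = funit E"
proof -
  have len: "es \<in> Obj (pow (Suc 0) E) \<Longrightarrow> length es = Suc 0" "as \<in> Arr (pow (Suc 0) E) \<Longrightarrow> length as = Suc 0" for es as
    by (auto simp: pow_sel)
  have F: "is_functor (pow (Suc 0) X) X (funit X)" "is_functor (pow (Suc 0) E) E (funit E)"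
    using is_functor_funit[OF X] is_functor_funit[OF E] by simp_all
  note [simp] = Lf[OF F(1)] map_ob len
  show ?thesis
    by (rule functor_E_eqI[OF Lf(1)[OF F(1)] F(2)]) simp_all
qed

lemma Ln_nid: "is_functor (pow n X) X F \<Longrightarrow> Ln n (nid (pow n X) X F) = nid (pow n E) E (Lf n F)"
  by (rule natural_E_eqI[OF Ln(1)[OF is_natural_nid] is_natural_nid[OF Lf(1)]])
    (simp_all add: Ln is_natural_nid Lf map_ob co_Idn functor_rules(1)[OF Lf(1)])

lemma Ln_vcomp:
  assumes t: "is_natural (pow n X) X \<tau>" and s: "is_natural (pow n X) X \<sigma>" and e: "tgt \<tau> = src \<sigma>"
  shows "Ln n (vcomp (pow n X) X \<sigma> \<tau>) = vcomp (pow n E) E (Ln n \<sigma>) (Ln n \<tau>)"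
proof -
  note v = is_natural_vcomp[OF t s e] and v' = is_natural_vcomp[OF Ln(1)[OF t] Ln(1)[OF s]]
  show ?thesis
    by (rule natural_E_eqI[OF Ln(1)[OF v] v'])
      (simp_all add: e Ln[OF v] Ln[OF s] Ln[OF t] map_ob co_Comp natural_rules[OF Ln(1)[OF s]]
        natural_rules[OF Ln(1)[OF t]])
qed

text \<open>A block of the evaluated list is the evaluation of the block, and evaluating the inner
  values gives the inner operations on evaluated blocks. The argument has the same form for objects,
  for values on arrows of \<open>J\<close> and for components.\<close>

lemma Lf_fgamma:
  assumes len: "length Fs = length ns" and F: "is_functor (pow (length ns) X) X F"
    and Fs: "\<And>i. i < length ns \<Longrightarrow> is_functor (pow (ns ! i) X) X (Fs ! i)"
  shows "Lf (sum_list ns) (fgamma X ns F Fs) = fgamma E ns (Lf (length ns) F) (map2 Lf ns Fs)"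
proof -
  let ?N = "sum_list ns"
  note g = is_functor_fgamma[OF X len F Fs]
  have g': "is_functor (pow ?N E) E (fgamma E ns (Lf (length ns) F) (map2 Lf ns Fs))"
    by (rule is_functor_fgamma[OF E]) (simp_all add: len Lf(1) F Fs)
  have bl: "index_map (ns ! i) ?N (block ns i)" if "i < length ns" for i
    by (rule index_map_block[OF that])
  have l: "es \<in> Obj (pow ?N E) \<Longrightarrow> length es = ?N" "as \<in> Arr (pow ?N E) \<Longrightarrow> length as = ?N" for es as
    by (auto simp: pow_sel)
  have m1: "map (\<lambda>i. on_ob (map2 Lf ns Fs ! i) (reindex (block ns i) es)) [0..<length ns] \<in> Obj (pow (length ns) E)"
    if "es \<in> Obj (pow ?N E)" for es
    using that functor_rules(1)[OF Lf(1)[OF Fs] reindex_pow(1)[OF bl that]] by (auto simp: pow_sel len)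
  have m2: "map (\<lambda>i. on_ar (map2 Lf ns Fs ! i) (reindex (block ns i) as)) [0..<length ns] \<in> Arr (pow (length ns) E)"
    if "as \<in> Arr (pow ?N E)" for as
    using that functor_rules(2)[OF Lf(1)[OF Fs] reindex_pow(2)[OF bl that]] by (auto simp: pow_sel len)
  note s = fgamma_sel len length_map length_zip min.idem
  show ?thesis
  proof (rule functor_E_eqI[OF Lf(1)[OF g] g'])
    fix es j assume es: "es \<in> Obj (pow ?N E)" and j: "j \<in> Obj J"
    have "map (\<lambda>i. on_ob (Fs ! i) (reindex (block ns i) (map (\<lambda>e. ob e j) es))) [0..<length ns] =
        map (\<lambda>e. ob e j) (map (\<lambda>i. on_ob (map2 Lf ns Fs ! i) (reindex (block ns i) es)) [0..<length ns])"
      using Lf(2)[OF Fs reindex_pow(1)[OF bl es] j]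
      by (auto simp: reindex_map_E[OF bl] l(1)[OF es] len)
    then show "ob (on_ob (Lf ?N (fgamma X ns F Fs)) es) j =
        ob (on_ob (fgamma E ns (Lf (length ns) F) (map2 Lf ns Fs)) es) j"
      using es j Lf(2)[OF F m1[OF es] j] by (simp add: Lf(2)[OF g] s map_ob del: map_map)
  next
    fix es u assume es: "es \<in> Obj (pow ?N E)" and u: "u \<in> Arr J"
    have "map (\<lambda>i. on_ar (Fs ! i) (reindex (block ns i) (map (\<lambda>e. mo e u) es))) [0..<length ns] =
        map (\<lambda>e. mo e u) (map (\<lambda>i. on_ob (map2 Lf ns Fs ! i) (reindex (block ns i) es)) [0..<length ns])"
      using Lf(3)[OF Fs reindex_pow(1)[OF bl es] u]
      by (auto simp: reindex_map_E[OF bl] l(1)[OF es] len)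
    then show "mo (on_ob (Lf ?N (fgamma X ns F Fs)) es) u =
        mo (on_ob (fgamma E ns (Lf (length ns) F) (map2 Lf ns Fs)) es) u"
      using es u Lf(3)[OF F m1[OF es] u] by (simp add: Lf(3)[OF g] s map_ob del: map_map)
  next
    fix as j assume as: "as \<in> Arr (pow ?N E)" and j: "j \<in> Obj J"
    have "map (\<lambda>i. on_ar (Fs ! i) (reindex (block ns i) (map (\<lambda>a. co a j) as))) [0..<length ns] =
        map (\<lambda>a. co a j) (map (\<lambda>i. on_ar (map2 Lf ns Fs ! i) (reindex (block ns i) as)) [0..<length ns])"
      using Lf(4)[OF Fs reindex_pow(2)[OF bl as] j]
      by (auto simp: reindex_map_E[OF bl] l(2)[OF as] len)
    then show "co (on_ar (Lf ?N (fgamma X ns F Fs)) as) j =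
        co (on_ar (fgamma E ns (Lf (length ns) F) (map2 Lf ns Fs)) as) j"
      using as j Lf(4)[OF F m2[OF as] j] by (simp add: Lf(4)[OF g] s map_ob del: map_map)
  qed
qed

text \<open>At \<open>j\<close> the component of a horizontal composite is a composite in
  \<open>X\<close>; by \<open>co_Comp\<close> it is the value at \<open>j\<close> of the
  corresponding composite in \<open>E\<close>.\<close>

lemma Ln_ngamma:
  assumes len: "length \<tau>s = length ns" and t: "is_natural (pow (length ns) X) X \<tau>"
    and ts: "\<And>i. i < length ns \<Longrightarrow> is_natural (pow (ns ! i) X) X (\<tau>s ! i)"
  shows "Ln (sum_list ns) (ngamma X ns \<tau> \<tau>s) = ngamma E ns (Ln (length ns) \<tau>) (map2 Ln ns \<tau>s)"
proof -
  let ?N = "sum_list ns"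
  note g = is_natural_ngamma[OF X len t ts]
  have g': "is_natural (pow ?N E) E (ngamma E ns (Ln (length ns) \<tau>) (map2 Ln ns \<tau>s))"
    by (rule is_natural_ngamma[OF E]) (simp_all add: len Ln(1) t ts)
  have bl: "index_map (ns ! i) ?N (block ns i)" if "i < length ns" for i
    by (rule index_map_block[OF that])
  have l: "es \<in> Obj (pow ?N E) \<Longrightarrow> length es = ?N" for es
    by (auto simp: pow_sel)
  have sm: "map2 Lf ns (map src \<tau>s) = map src (map2 Ln ns \<tau>s)" "map2 Lf ns (map tgt \<tau>s) = map tgt (map2 Ln ns \<tau>s)"
    using len by (auto simp: list_eq_iff_nth_eq)
  have src: "Lf ?N (fgamma X ns (src \<tau>) (map src \<tau>s)) =
      fgamma E ns (Lf (length ns) (src \<tau>)) (map src (map2 Ln ns \<tau>s))"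
    unfolding sm(1)[symmetric] by (rule Lf_fgamma) (simp_all add: len natural_src[OF t] natural_src[OF ts])
  have tgt: "Lf ?N (fgamma X ns (tgt \<tau>) (map tgt \<tau>s)) =
      fgamma E ns (Lf (length ns) (tgt \<tau>)) (map tgt (map2 Ln ns \<tau>s))"
    unfolding sm(2)[symmetric] by (rule Lf_fgamma) (simp_all add: len natural_tgt[OF t] natural_tgt[OF ts])
  show ?thesis
  proof (rule natural_E_eqI[OF Ln(1)[OF g] g'])
    fix es j assume es: "es \<in> Obj (pow ?N E)" and j: "j \<in> Obj J"
    let ?x = "\<lambda>i. reindex (block ns i) es"
    let ?m = "map (\<lambda>i. on_ob (tgt (map2 Ln ns \<tau>s ! i)) (?x i)) [0..<length ns]"
    let ?a = "map (\<lambda>i. cmp (map2 Ln ns \<tau>s ! i) (?x i)) [0..<length ns]"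
    note n = natural_rules[OF Ln(1)[OF ts] reindex_pow(1)[OF bl es]]
    have m: "?m \<in> Obj (pow (length ns) E)"
      using functor_rules(1)[OF Lf(1)[OF natural_tgt[OF ts]] reindex_pow(1)[OF bl es]]
      by (auto simp: pow_sel len)
    have a: "?a \<in> Arr (pow (length ns) E)" "Cod (pow (length ns) E) ?a = ?m"
      using n by (auto simp: pow_sel len)
    have m': "map (\<lambda>i. on_ob (tgt (\<tau>s ! i)) (reindex (block ns i) (map (\<lambda>e. ob e j) es))) [0..<length ns] =
        map (\<lambda>e. ob e j) ?m"
      using Lf(2)[OF natural_tgt[OF ts] reindex_pow(1)[OF bl es] j]
      by (auto simp: reindex_map_E[OF bl] l[OF es] len)
    have a': "map (\<lambda>i. cmp (\<tau>s ! i) (reindex (block ns i) (map (\<lambda>e. ob e j) es))) [0..<length ns] =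
        map (\<lambda>a. co a j) ?a"
      using Ln(2)[OF ts reindex_pow(1)[OF bl es] j]
      by (auto simp: reindex_map_E[OF bl] l[OF es] len)
    note ar = natural_rules[OF Ln(1)[OF t] m] functor_rules(2-4)[OF Lf(1)[OF natural_src[OF t]] a(1)]
    have "co (cmp (Ln ?N (ngamma X ns \<tau> \<tau>s)) es) j =
        Comp X (cmp \<tau> (map (\<lambda>e. ob e j) ?m)) (on_ar (src \<tau>) (map (\<lambda>a. co a j) ?a))"
      using es j by (simp only: Ln(2)[OF g] cmp_ngamma map_ob len m' a')
    also have "\<dots> = Comp X (co (cmp (Ln (length ns) \<tau>) ?m) j) (co (on_ar (Lf (length ns) (src \<tau>)) ?a) j)"
      by (simp only: Ln(2)[OF t m j] Lf(4)[OF natural_src[OF t] a(1) j])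
    also have "\<dots> = co (cmp (ngamma E ns (Ln (length ns) \<tau>) (map2 Ln ns \<tau>s)) es) j"
      unfolding cmp_ngamma[OF es] length_map length_zip len min.idem Ln_sel
      by (rule co_Comp[symmetric]) (use ar a(2) j in simp_all)
    finally show "co (cmp (Ln ?N (ngamma X ns \<tau> \<tau>s)) es) j =
        co (cmp (ngamma E ns (Ln (length ns) \<tau>) (map2 Ln ns \<tau>s)) es) j" .
  qed (simp_all add: src tgt)
qed

end

section \<open>The pointwise pseudo algebra\<close>

lemma length_concat_nth:
  "length xss = length ns \<Longrightarrow> \<forall>i < length ns. length (xss ! i) = ns ! i \<Longrightarrow> length (concat xss) = sum_list ns"
proof -
  assume "length xss = length ns" "\<forall>i < length ns. length (xss ! i) = ns ! i"
  then have "map length xss = ns" by (simp add: list_eq_iff_nth_eq)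
  then show ?thesis by (simp add: length_concat)
qed

locale power_algebra = lawvere_theory T + F: pseudo_algebra T F + power_category J "Und F" E enc ev
  for T :: "'t lawvere" and F :: "('t, 'x, 'y) psalg" and J :: "('j, 'i) cat" and E :: "('p, 'q) cat"
    and enc :: "(('j, 'i, 'x, 'y) ftr, ('j, 'i, 'x, 'y) ntr, 'p, 'q) ftr"
    and ev :: "('p, 'q, ('j, 'i, 'x, 'y) ftr, ('j, 'i, 'x, 'y) ntr) ftr"
begin

definition PA :: "('t, 'p, 'q) psalg" where
  "PA = \<lparr>Und = E, Phi = \<lambda>w. Lf (arity T w) (Phi F w),
     Co = \<lambda>w ws. Ln (sum_list (map (arity T) ws)) (Co F w ws), Iu = Ln (Suc 0) (Iu F),
     Sb = \<lambda>w l f. Ln l (Sb F w l f)\<rparr>"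

lemma PA_sel [simp]: "Und PA = E" "Phi PA w = Lf (arity T w) (Phi F w)"
  "Co PA w ws = Ln (sum_list (map (arity T) ws)) (Co F w ws)" "Iu PA = Ln (Suc 0) (Iu F)"
  "Sb PA w l f = Ln l (Sb F w l f)"
  by (simp_all add: PA_def)

lemma idPhi_PA: "w \<in> words T \<Longrightarrow> idPhi T PA w = Ln (arity T w) (idPhi T F w)"
  by (simp add: idPhi_def Ln_nid F.Phi)

lemmas nat_Co = natural_isoD[OF F.Co] and nat_Sb = natural_isoD[OF F.Sb]
  and nat_Iu = natural_isoD[OF F.Iu[unfolded One_nat_def]]

lemma map2_Ln_idPhi:
  assumes "set ws \<subseteq> words T"
  shows "map2 Ln (map (arity T) ws) (map (idPhi T F) ws) = map (idPhi T PA) ws"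
  using assms by (auto simp: list_eq_iff_nth_eq idPhi_PA subset_set_conv_nth)

lemma map2_Lf_Phi: "map2 Lf (map (arity T) ws) (map (Phi F) ws) = map (Phi PA) ws"
  by (auto simp: list_eq_iff_nth_eq)

text \<open>Each coherence axiom equates expressions in \<open>vcomp\<close>, \<open>ngamma\<close>,
  \<open>nsub\<close> and identities, with which \<open>Ln\<close> commutes; so the axiom for
  \<open>PA\<close> is the image of that for \<open>F\<close>. What takes space is the side
  conditions: factors must be composable, and arities computed along different routes must
  coincide.\<close>

lemma pseudo_algebra_PA: "pseudo_algebra T PA"
proof (rule pseudo_algebra.intro)
  show "category (Und PA)" by (simp add: E)
next
  fix w assume "w \<in> words T"
  then show "is_functor (Pw (arity T w) PA) (Und PA) (Phi PA w)" by (simp add: Lf F.Phi)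
next
  fix w ws ns assume c: "composable T w ws" and ns: "ns = map (arity T) ws"
  note cD = composableD[OF c]
  have "Lf (sum_list ns) (fgamma (Und F) ns (Phi F w) (map (Phi F) ws)) =
      fgamma E ns (Lf (length ns) (Phi F w)) (map2 Lf ns (map (Phi F) ws))"
    using F.Phi[OF cD(1)] F.Phi[OF cD(2)] by (intro Lf_fgamma) (simp_all add: ns cD(3))
  then show "natural_iso (Pw (sum_list ns) PA) (Und PA) (Phi PA (wgamma T w ws))
      (fgamma (Und PA) ns (Phi PA w) (map (Phi PA) ws)) (Co PA w ws)"
    using Ln_natural_iso[OF F.Co[OF c ns]] map2_Lf_Phi[of ws]
    by (simp add: ns wgamma_word[OF c] cD(3))
next
  show "natural_iso (Pw 1 PA) (Und PA) (Phi PA (unit_word T)) (funit (Und PA)) (Iu PA)"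
    using Ln_natural_iso[OF F.Iu[unfolded One_nat_def]] by (simp add: unit_word Lf_funit)
next
  fix w l f assume w: "w \<in> words T" and f: "index_map (arity T w) l f"
  show "natural_iso (Pw l PA) (Und PA) (Phi PA (wsub T l f w)) (fsub (Und PA) l f (Phi PA w)) (Sb PA w l f)"
    using Ln_natural_iso[OF F.Sb[OF w f]] by (simp add: wsub_word[OF w f] Lf_fsub[OF f F.Phi[OF w]])
next
  fix w ws wss ns ms
  assume c: "composable T w ws" and len: "length wss = length ws"
    and cs: "\<forall>i < length ws. composable T (ws ! i) (wss ! i)"
    and ns: "ns = map (arity T) (concat wss)" and ms: "ms = map (\<lambda>vs. sum_list (map (arity T) vs)) wss"
  let ?N = "sum_list ns" and ?X = "Und F"
  let ?g = "wgamma T w ws" and ?gs = "map2 (wgamma T) ws wss"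
  note cD = composableD[OF c] and \<gamma> = wgamma_word[OF c]
  \<comment> \<open>The inner words altogether number as many as the arity of \<open>?g\<close>,
    since the \<open>i\<close>-th list in \<open>wss\<close> has as many entries as the arity of
    \<open>ws ! i\<close>.\<close>
  have lc: "length (concat wss) = arity T ?g"
    using cs len \<gamma>(2) length_concat_nth[of wss "map (arity T) ws"] by (simp add: composableD(3))
  have ws': "set (concat wss) \<subseteq> words T"
    using cs len by (fastforce simp: composable_def in_set_conv_nth)
  have c1: "composable T ?g (concat wss)"
    using lc ws' \<gamma>(1) by (simp add: composable_def)
  have gs: "?gs ! i \<in> words T" "arity T (?gs ! i) = ms ! i" if "i < length ws" for i
    using wgamma_word[of "ws ! i" "wss ! i"] cs that len by (simp_all add: ms)
  have lgs: "length ?gs = length ws" "length ms = length ws" using len by (simp_all add: ms)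
  have c2: "composable T w ?gs"
  proof -
    have "set ?gs \<subseteq> words T" unfolding subset_set_conv_nth using gs lgs by auto
    then show ?thesis using cD lgs by (simp add: composable_def)
  qed
  have ags: "map (arity T) ?gs = ms" using gs lgs by (simp add: list_eq_iff_nth_eq)
  \<comment> \<open>Summing the arities list by list or over the concatenation gives the same
    number, so both sides of the axiom live on the same power.\<close>
  have sum: "sum_list ms = ?N"
    unfolding ms ns by (induction wss) auto
  have id: "is_natural (pow (ns ! i) ?X) ?X (map (idPhi T F) (concat wss) ! i)" if "i < length ns" for i
    using that F.is_natural_idPhi[OF nth_in_subset[OF ws']] by (simp add: ns)
  have co: "is_natural (pow (ms ! i) ?X) ?X (map2 (Co F) ws wss ! i)"
    "src (map2 (Co F) ws wss ! i) = Phi F (?gs ! i)" if "i < length ms" for i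
    using that nat_Co(1,2)[OF _ refl, of "ws ! i" "wss ! i"] cs len by (simp_all add: ms)
  have Lns: "length ns = sum_list (map (arity T) ws)" using lc \<gamma>(2) by (simp add: ns)
  have L: "Ln ?N (ngamma ?X ns (Co F w ws) (map (idPhi T F) (concat wss))) =
      ngamma E ns (Ln (length ns) (Co F w ws)) (map (idPhi T PA) (concat wss))"
    unfolding map2_Ln_idPhi[OF ws', folded ns, symmetric]
    by (rule Ln_ngamma) (use id nat_Co(1)[OF c refl] Lns in \<open>simp_all add: ns\<close>)
  have R: "Ln ?N (ngamma ?X ms (idPhi T F w) (map2 (Co F) ws wss)) =
      ngamma E ms (Ln (length ms) (idPhi T F w)) (map2 (Co PA) ws wss)"
  proof -
    have e: "map2 (Co PA) ws wss = map2 Ln ms (map2 (Co F) ws wss)"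
      using len by (auto simp: list_eq_iff_nth_eq ms)
    show ?thesis
      unfolding sum[symmetric] e
      by (rule Ln_ngamma) (use co F.is_natural_idPhi[OF cD(1)] in \<open>simp_all add: lgs len cD(3)\<close>)
  qed
  have natL: "is_natural (pow ?N ?X) ?X (ngamma ?X ns (Co F w ws) (map (idPhi T F) (concat wss)))"
    by (rule is_natural_ngamma[OF X]) (use id nat_Co(1)[OF c refl] Lns in \<open>simp_all add: ns\<close>)
  have natR: "is_natural (pow ?N ?X) ?X (ngamma ?X ms (idPhi T F w) (map2 (Co F) ws wss))"
    unfolding sum[symmetric]
    by (rule is_natural_ngamma[OF X]) (use co F.is_natural_idPhi[OF cD(1)] in \<open>simp_all add: lgs len cD(3)\<close>)
  \<comment> \<open>\<open>Ln_vcomp\<close> requires the functors in the middle of a vertical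
    composite to be equal; this is the case for the left side, and \<open>tr\<close> below treats
    the right side.\<close>
  have tl: "tgt (Co F ?g (concat wss)) = src (ngamma ?X ns (Co F w ws) (map (idPhi T F) (concat wss)))"
    using nat_Co(3)[OF c1 refl] nat_Co(2)[OF c refl] by (simp add: ns comp_def)
  have tr: "tgt (Co F w ?gs) = src (ngamma ?X ms (idPhi T F w) (map2 (Co F) ws wss))"
  proof -
    have e: "map (Phi F) ?gs = map src (map2 (Co F) ws wss)"
      using co(2) by (intro nth_equalityI) (simp_all add: lgs len)
    show ?thesis using nat_Co(3)[OF c2 refl] unfolding ags e by simp
  qed
  have "Ln ?N (vcomp (pow ?N ?X) ?X (ngamma ?X ns (Co F w ws) (map (idPhi T F) (concat wss)))
        (Co F ?g (concat wss))) =
      Ln ?N (vcomp (pow ?N ?X) ?X (ngamma ?X ms (idPhi T F w) (map2 (Co F) ws wss)) (Co F w ?gs))"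
    using F.Co_assoc[OF c len cs ns ms] by simp
  \<comment> \<open>By definition \<open>Co PA w ?gs\<close> is lifted at the sum of the arities of
    \<open>?gs\<close>, that is, at the sum of \<open>ms\<close>.\<close>
  moreover have e: "Co PA w ?gs = Ln ?N (Co F w ?gs)"
    unfolding PA_sel(3) ags sum ..
  ultimately show "vcomp (Pw ?N PA) (Und PA) (ngamma (Und PA) ns (Co PA w ws) (map (idPhi T PA) (concat wss)))
        (Co PA ?g (concat wss)) =
      vcomp (Pw ?N PA) (Und PA) (ngamma (Und PA) ms (idPhi T PA w) (map2 (Co PA) ws wss)) (Co PA w ?gs)"
    using Ln_vcomp[OF nat_Co(1)[OF c1 refl, folded ns] natL tl]
      Ln_vcomp[OF nat_Co(1)[OF c2 refl, unfolded ags sum] natR tr]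
    unfolding e by (simp add: L R ags sum idPhi_PA cD lgs Lns[symmetric] ns[symmetric])
next
  fix w k assume w: "w \<in> words T" and k: "k = arity T w"
  let ?X = "Und F" and ?us = "replicate k (unit_word T)" and ?ns = "replicate k (1 :: nat)"
  let ?I = "replicate k (Iu F)"
  have c: "composable T w ?us" using w unit_word by (auto simp: composable_def k)
  have ns: "map (arity T) ?us = ?ns" "sum_list ?ns = k" by (simp_all add: unit_word sum_list_replicate)
  have I: "is_natural (pow (?ns ! i) ?X) ?X (?I ! i)" if "i < length ?ns" for i
    using that nat_Iu(1) by simp
  have id: "is_natural (pow (length ?ns) ?X) ?X (idPhi T F w)"
    using F.is_natural_idPhi[OF w] by (simp add: k)
  note n = is_natural_ngamma[OF X _ id I]
  have "map2 Ln ?ns ?I = replicate k (Iu PA)" by (simp add: list_eq_iff_nth_eq)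
  then have "Ln k (ngamma ?X ?ns (idPhi T F w) ?I) = ngamma E ?ns (idPhi T PA w) (replicate k (Iu PA))"
    using Ln_ngamma[OF _ id I] by (simp add: ns sum_list_replicate unit_word idPhi_PA w k)
  moreover have "tgt (Co F w ?us) = src (ngamma ?X ?ns (idPhi T F w) ?I)"
    using nat_Co(3)[OF c refl] nat_Iu(2) by (simp add: ns sum_list_replicate unit_word)
  ultimately show "vcomp (Pw k PA) (Und PA) (ngamma (Und PA) ?ns (idPhi T PA w) (replicate k (Iu PA)))
        (Co PA w ?us) = idPhi T PA w"
    using Ln_vcomp[OF nat_Co(1)[OF c refl, unfolded ns] n[unfolded ns]] F.Co_unit_right[OF w k]
    by (simp add: ns sum_list_replicate unit_word idPhi_PA w k)
next
  fix w k assume w: "w \<in> words T" and k: "k = arity T w"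
  let ?X = "Und F"
  have c: "composable T (unit_word T) [w]" using w unit_word by (auto simp: composable_def)
  have id: "is_natural (pow ([k] ! i) ?X) ?X ([idPhi T F w] ! i)" if "i < length [k]" for i
    using that F.is_natural_idPhi[OF w] k by simp
  have I: "is_natural (pow (length [k]) ?X) ?X (Iu F)" using nat_Iu(1) by simp
  have n': "is_natural (pow k ?X) ?X (ngamma ?X [k] (Iu F) [idPhi T F w])"
    using is_natural_ngamma[OF X _ I id] by simp
  have co: "is_natural (pow k ?X) ?X (Co F (unit_word T) [w])"
    using nat_Co(1)[OF c refl] by (simp add: k)
  have "Ln k (ngamma ?X [k] (Iu F) [idPhi T F w]) = ngamma E [k] (Iu PA) [idPhi T PA w]"
    using Ln_ngamma[OF _ I id] by (simp add: idPhi_PA w k)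
  moreover have "tgt (Co F (unit_word T) [w]) = src (ngamma ?X [k] (Iu F) [idPhi T F w])"
    using nat_Co(3)[OF c refl] nat_Iu(2) by (simp add: k)
  ultimately show "vcomp (Pw k PA) (Und PA) (ngamma (Und PA) [k] (Iu PA) [idPhi T PA w])
        (Co PA (unit_word T) [w]) = idPhi T PA w"
    using Ln_vcomp[OF co n'] F.Co_unit_left[OF w k] k w by (simp add: idPhi_PA)
next
  fix w l f ws ns N f'
  assume w: "w \<in> words T" and f: "index_map (arity T w) l f" and l: "length ws = l"
    and ws: "set ws \<subseteq> words T" and ns: "ns = map (arity T) ws" and N: "N = sum_list ns"
    and f': "f' = block_map ns f"
  let ?X = "Und F" and ?fs = "reindex f ws" and ?v = "wsub T l f w"
  note v = wsub_word[OF w f]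
  have ns': "map (arity T) ?fs = reindex f ns" using index_mapD(3)[OF f] by (simp add: ns reindex_map l)
  have c1: "composable T w ?fs"
    using w reindex_Obj[OF f l ws] index_mapD(1)[OF f] by (simp add: composable_def)
  have c2: "composable T ?v ws" using v ws l by (simp add: composable_def)
  note \<gamma> = wgamma_word[OF c1, unfolded ns']
  have ln: "length ns = l" by (simp add: ns l)
  \<comment> \<open>The map of blocks starts from the arity of the composite word, whose inner
    arities are \<open>reindex f ns\<close>.\<close>
  have f'm: "index_map (arity T (wgamma T w ?fs)) N f'"
    using index_map_block_map[of _ ns f] f by (simp add: f' \<gamma> N ln)
  have id: "is_natural (pow (ns ! i) ?X) ?X (map (idPhi T F) ws ! i)" if "i < length ns" for i
    using that F.is_natural_idPhi[OF nth_in_subset[OF ws]] by (simp add: ns)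
  have sb: "is_natural (pow (length ns) ?X) ?X (Sb F w l f)" using nat_Sb(1)[OF w f] ln by simp
  note n = is_natural_ngamma[OF X _ sb id]
  have co: "is_natural (pow (arity T (wgamma T w ?fs)) ?X) ?X (Co F w ?fs)"
    using nat_Co(1)[OF c1 refl] by (simp add: \<gamma> ns')
  have L: "Ln N (vcomp (pow N ?X) ?X (nsub ?X N f' (Co F w ?fs)) (Sb F (wgamma T w ?fs) N f')) =
      vcomp (pow N E) E (nsub E N f' (Co PA w ?fs)) (Sb PA (wgamma T w ?fs) N f')"
    using Ln_vcomp[OF nat_Sb(1)[OF \<gamma>(1) f'm] is_natural_nsub[OF f'm X co]]
      nat_Sb(3)[OF \<gamma>(1) f'm] nat_Co(2)[OF c1 refl] Ln_nsub[OF f'm co]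
    by (simp add: \<gamma>(2) ns')
  have "Ln N (ngamma ?X ns (Sb F w l f) (map (idPhi T F) ws)) =
      ngamma E ns (Ln l (Sb F w l f)) (map (idPhi T PA) ws)"
    using Ln_ngamma[OF _ sb id] map2_Ln_idPhi[OF ws] by (simp add: ln l N ns)
  moreover have "tgt (Co F ?v ws) = src (ngamma ?X ns (Sb F w l f) (map (idPhi T F) ws))"
    using nat_Co(3)[OF c2 refl] nat_Sb(2)[OF w f] by (simp add: ns comp_def)
  ultimately have R: "Ln N (vcomp (pow N ?X) ?X (ngamma ?X ns (Sb F w l f) (map (idPhi T F) ws)) (Co F ?v ws)) =
      vcomp (pow N E) E (ngamma E ns (Sb PA w l f) (map (idPhi T PA) ws)) (Co PA ?v ws)"
    using Ln_vcomp[OF nat_Co(1)[OF c2 ns] n] by (simp add: N ln ns)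
  show "vcomp (Pw N PA) (Und PA) (nsub (Und PA) N f' (Co PA w ?fs)) (Sb PA (wgamma T w ?fs) N f') =
      vcomp (Pw N PA) (Und PA) (ngamma (Und PA) ns (Sb PA w l f) (map (idPhi T PA) ws)) (Co PA ?v ws)"
    using L R F.Co_Sb_outer[OF w f l ws ns N f'] by (simp only: PA_sel(1))
next
  fix w ws gs ms M g
  assume c: "composable T w ws" and lgs: "length gs = length ws" and lms: "length ms = length ws"
    and gm: "\<forall>i < length ws. index_map (arity T (ws ! i)) (ms ! i) (gs ! i)"
    and M: "M = sum_list ms" and g: "g = block_sum ms gs"
  let ?X = "Und F" and ?vs = "map (\<lambda>i. wsub T (ms ! i) (gs ! i) (ws ! i)) [0..<length ws]"
  let ?ss = "map (\<lambda>i. Sb F (ws ! i) (ms ! i) (gs ! i)) [0..<length ws]"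
  note cD = composableD[OF c] and \<gamma> = wgamma_word[OF c]
  note vs = wsub_word[OF cD(2) gm[rule_format]]
  have "set ?vs \<subseteq> words T" using vs(1) by auto
  then have c2: "composable T w ?vs" using cD(1,3) by (simp add: composable_def)
  have avs: "map (arity T) ?vs = ms"
    by (rule nth_equalityI) (simp_all add: vs(2) lms)
  have gI: "index_map (arity T (wgamma T w ws)) M g"
    using index_map_block_sum[of gs "map (arity T) ws" ms] lgs lms gm by (simp add: \<gamma> M g)
  have ss: "is_natural (pow (ms ! i) ?X) ?X (?ss ! i)" if "i < length ms" for i
    using that nat_Sb(1)[OF cD(2) gm[rule_format]] lms by simp
  have id: "is_natural (pow (length ms) ?X) ?X (idPhi T F w)"
    using F.is_natural_idPhi[OF cD(1)] by (simp add: lms cD(3))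
  note n = is_natural_ngamma[OF X _ id ss]
  have co: "is_natural (pow (arity T (wgamma T w ws)) ?X) ?X (Co F w ws)"
    using nat_Co(1)[OF c refl] by (simp add: \<gamma>)
  have L: "Ln M (vcomp (pow M ?X) ?X (nsub ?X M g (Co F w ws)) (Sb F (wgamma T w ws) M g)) =
      vcomp (pow M E) E (nsub E M g (Co PA w ws)) (Sb PA (wgamma T w ws) M g)"
    using Ln_vcomp[OF nat_Sb(1)[OF \<gamma>(1) gI] is_natural_nsub[OF gI X co]]
      nat_Sb(3)[OF \<gamma>(1) gI] nat_Co(2)[OF c refl] Ln_nsub[OF gI co]
    by (simp add: \<gamma>(2))
  have e1: "map (\<lambda>i. Sb PA (ws ! i) (ms ! i) (gs ! i)) [0..<length ws] = map2 Ln ms ?ss"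
    by (rule nth_equalityI) (simp_all add: lms)
  have "Ln M (ngamma ?X ms (idPhi T F w) ?ss) = ngamma E ms (idPhi T PA w) (map2 Ln ms ?ss)"
    using Ln_ngamma[OF _ id ss] by (simp add: lms M idPhi_PA cD(1,3))
  moreover have "tgt (Co F w ?vs) = src (ngamma ?X ms (idPhi T F w) ?ss)"
  proof -
    have e2: "map (Phi F) ?vs = map src ?ss"
      by (rule nth_equalityI) (simp_all add: nat_Sb(2)[OF cD(2) gm[rule_format]])
    show ?thesis
      unfolding nat_Co(3)[OF c2 refl] avs e2 fgamma_ngamma_sel(1) idPhi_sel ..
  qed
  ultimately have R: "Ln M (vcomp (pow M ?X) ?X (ngamma ?X ms (idPhi T F w) ?ss) (Co F w ?vs)) =
      vcomp (pow M E) E (ngamma E ms (idPhi T PA w) (map2 Ln ms ?ss)) (Co PA w ?vs)"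
    using Ln_vcomp[OF nat_Co(1)[OF c2 refl, unfolded avs] n] unfolding PA_sel(3) avs M by (simp only: length_map length_upt lms minus_nat.diff_0)
  show "vcomp (Pw M PA) (Und PA) (nsub (Und PA) M g (Co PA w ws)) (Sb PA (wgamma T w ws) M g) =
      vcomp (Pw M PA) (Und PA)
        (ngamma (Und PA) ms (idPhi T PA w)
          (map (\<lambda>i. Sb PA (ws ! i) (ms ! i) (gs ! i)) [0..<length ws]))
        (Co PA w ?vs)"
    unfolding e1 using L R F.Co_Sb_inner[OF c lgs lms gm M g] by (simp only: PA_sel(1))
next
  fix w l f m g assume w: "w \<in> words T" and f: "index_map (arity T w) l f" and g: "index_map l m g"
  note v = wsub_word[OF w f]
  have g': "index_map (arity T (wsub T l f w)) m g" using g v by simp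
  note sw = nat_Sb[OF w f] and sv = nat_Sb[OF v(1) g']
  show "vcomp (Pw m PA) (Und PA) (nsub (Und PA) m g (Sb PA w l f)) (Sb PA (wsub T l f w) m g) =
      Sb PA w m (reindex f g)"
    using Ln_vcomp[OF sv(1) is_natural_nsub[OF g X sw(1)]] sw(2) sv(3)
    by (simp add: Ln_nsub[OF g sw(1)] F.Sb_comp[OF w f g])
next
  fix w k assume "w \<in> words T" "k = arity T w"
  then show "Sb PA w k [0..<k] = idPhi T PA w" by (simp add: F.Sb_id idPhi_PA)
qed

end

section \<open>Evaluation morphisms\<close>

context power_algebra
begin

lemmas lawvere = lawvere_theory_axioms and F_alg = F.pseudo_algebra_axioms

definition eps :: "'j \<Rightarrow> ('t, 'p, 'q, 'x, 'y) psmor" where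
  "eps j = \<lparr>fn = pt j, rho = (\<lambda>w\<in>words T.
    nid (pow (arity T w) E) (Und F) (fcomp (pow (arity T w) E) (pt j) (Lf (arity T w) (Phi F w))))\<rparr>"

lemma eps_sel [simp]: "fn (eps j) = pt j" "rho (eps j) \<in> extensional (words T)"
  "w \<in> words T \<Longrightarrow> rho (eps j) w =
    nid (pow (arity T w) E) (Und F) (fcomp (pow (arity T w) E) (pt j) (Lf (arity T w) (Phi F w)))"
  by (simp_all add: eps_def)

text \<open>Lifted functors act pointwise, so evaluation commutes with them exactly; hence the
  identity used as \<open>rho (eps j) w\<close> has the required target.\<close>

lemma pt_Lf:
  assumes F: "is_functor (pow n (Und F)) (Und F) G" and j: "j \<in> Obj J"
  shows "fcomp (pow n E) (pt j) (Lf n G) = fcomp (pow n E) G (fpow n E (pt j))"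
  by (rule ftr_eqI[of _ "Obj (pow n E)" _ "Arr (pow n E)"])
    (simp_all add: functor_rules[OF Lf(1)[OF F]] Lf[OF F] map_pt j)

lemma cmp_rho_eps:
  assumes "j \<in> Obj J" "w \<in> words T" "es \<in> Obj (pow (arity T w) E)"
  shows "cmp (rho (eps j) w) es = Idn (Und F) (on_ob (Phi F w) (map (\<lambda>e. ob e j) es))"
  using assms by (simp add: Lf F.Phi functor_rules(1)[OF Lf(1)])

lemma premorphism_eps:
  assumes j: "j \<in> Obj J"
  shows "premorphism T PA F (eps j)"
proof (intro premorphism.intro premorphism_axioms.intro lawvere F_alg pseudo_algebra_PA)
  show "is_functor (Und PA) (Und F) (fn (eps j))" by (simp add: is_functor_pt j)
  fix w assume w: "w \<in> words T"
  note L = Lf[OF F.Phi[OF w]]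
  note f = is_functor_fcomp[OF L(1) is_functor_pt[OF j]]
  show "natural_iso (Pw (arity T w) PA) (Und F) (fcomp (Pw (arity T w) PA) (fn (eps j)) (Phi PA w))
      (fcomp (Pw (arity T w) PA) (Phi F w) (fpow (arity T w) (Und PA) (fn (eps j)))) (rho (eps j) w)"
    using is_natural_nid[OF f] functor_rules(1)[OF f]
    by (auto simp: natural_iso_def w pt_Lf[OF F.Phi[OF w] j] intro!: iso_Idn X)
qed

text \<open>With identities for \<open>rho\<close>, each equation says that the coherence
  isomorphism of \<open>PA\<close>, evaluated at \<open>j\<close>, is that of \<open>F\<close> at
  the evaluated list, which is the formula for the components of \<open>Ln\<close>.\<close>

lemma pseudo_morphism_eps:
  assumes j: "j \<in> Obj J"
  shows "pseudo_morphism T PA F (eps j)"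
  unfolding pseudo_morphism_iff[OF premorphism_eps[OF j]]
proof (intro conjI allI impI ballI)
  show "rho (eps j) \<in> extensional (words T)" by simp
next
  fix w ws es assume c: "composable T w ws" and es: "es \<in> Obj (Pw (sum_list (map (arity T) ws)) PA)"
  interpret premorphism T PA F "eps j" by (rule premorphism_eps[OF j])
  let ?ns = "map (arity T) ws" and ?xs = "map (\<lambda>e. ob e j) es"
  let ?e = "\<lambda>i. reindex (block ?ns i) es" and ?x = "\<lambda>i. reindex (block ?ns i) ?xs"
  let ?ps = "map (\<lambda>i. on_ob (Phi PA (ws ! i)) (?e i)) [0..<length ws]"
  let ?qs = "map (\<lambda>i. on_ob (Phi F (ws ! i)) (?x i)) [0..<length ws]"
  note cD = composableD[OF c] and \<gamma> = wgamma_word[OF c] and co = nat_Co[OF c refl]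
  note ps = Co_typing(1)[OF c es]
  have es: "es \<in> Obj (pow (sum_list ?ns) E)" using es by simp
  have xs: "?xs \<in> Obj (pow (sum_list ?ns) (Und F))" by (rule map_ob(1)[OF es j])
  have bl: "index_map (arity T (ws ! i)) (sum_list ?ns) (block ?ns i)" if "i < length ws" for i
    using index_map_block[of i ?ns] that by simp
  have e: "?e i \<in> Obj (pow (arity T (ws ! i)) E)" if "i < length ws" for i
    by (rule reindex_pow(1)[OF bl[OF that] es])
  have x: "?x i = map (\<lambda>e. ob e j) (?e i)" if "i < length ws" for i
    using es by (intro reindex_map_E[OF bl[OF that]]) (simp add: pow_sel)
  have ps: "?ps \<in> Obj (pow (arity T w) E)" using ps by simp
  have pq: "map (\<lambda>e. ob e j) ?ps = ?qs"
    using Lf(2)[OF F.Phi[OF cD(2)] e j] x by simp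
  have qs: "?qs \<in> Obj (pow (arity T w) (Und F))" using map_ob(1)[OF ps j] unfolding pq .
  have r: "map (\<lambda>i. cmp (rho (eps j) (ws ! i)) (?e i)) [0..<length ws] = Idn (pow (arity T w) (Und F)) ?qs"
    using cmp_rho_eps[OF j cD(2) e] x by (simp add: pow_sel)
  have cA: "cmp (Co F w ws) ?xs \<in> Arr (Und F)" "Dom (Und F) (cmp (Co F w ws) ?xs) = on_ob (Phi F (wgamma T w ws)) ?xs"
    "Cod (Und F) (cmp (Co F w ws) ?xs) = on_ob (Phi F w) ?qs"
    using natural_rules[OF co(1) xs] xs by (simp_all add: co)
  have 1: "cmp (rho (eps j) (wgamma T w ws)) es = Idn (Und F) (on_ob (Phi F (wgamma T w ws)) ?xs)"
    by (rule cmp_rho_eps[OF j \<gamma>(1)]) (use es in \<open>simp add: \<gamma>\<close>)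
  have 2: "cmp (rho (eps j) w) ?ps = Idn (Und F) (on_ob (Phi F w) ?qs)"
    using cmp_rho_eps[OF j cD(1) ps] pq by (simp only:)
  have 3: "on_ar (fn (eps j)) (cmp (Co PA w ws) es) = cmp (Co F w ws) ?xs"
    using Ln(2)[OF co(1) es j] natural_rules(1)[OF Ln(1)[OF co(1)] es] by simp
  have 4: "map (on_ob (fn (eps j))) es = ?xs" using map_pt(1)[OF es] by simp
  show "Comp (Und F) (cmp (Co F w ws) (map (on_ob (fn (eps j))) es)) (cmp (rho (eps j) (wgamma T w ws)) es) =
      Comp (Und F) (on_ar (Phi F w) (map (\<lambda>i. cmp (rho (eps j) (ws ! i)) (?e i)) [0..<length ws]))
        (Comp (Und F) (cmp (rho (eps j) w) ?ps) (on_ar (fn (eps j)) (cmp (Co PA w ws) es)))"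
    unfolding 1 2 3 4 r functor_rules(5)[OF F.Phi[OF cD(1)] qs] using cA by (simp add: cat_rules[OF X])
next
  fix es assume es: "es \<in> Obj (Pw (Suc 0) PA)"
  let ?xs = "map (\<lambda>e. ob e j) es"
  have es: "es \<in> Obj (pow (Suc 0) E)" using es by simp
  have xs: "?xs \<in> Obj (pow (Suc 0) (Und F))" by (rule map_ob(1)[OF es j])
  have 4: "map (on_ob (fn (eps j))) es = ?xs" using map_pt(1)[OF es] by simp
  have 1: "cmp (rho (eps j) (unit_word T)) es = Idn (Und F) (on_ob (Phi F (unit_word T)) ?xs)"
    by (rule cmp_rho_eps[OF j]) (use es in \<open>simp_all add: unit_word\<close>)
  have 3: "on_ar (fn (eps j)) (cmp (Iu PA) es) = cmp (Iu F) ?xs"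
    using Ln(2)[OF nat_Iu(1) es j] natural_rules(1)[OF Ln(1)[OF nat_Iu(1)] es] by simp
  show "Comp (Und F) (cmp (Iu F) (map (on_ob (fn (eps j))) es)) (cmp (rho (eps j) (unit_word T)) es) =
      on_ar (fn (eps j)) (cmp (Iu PA) es)"
    unfolding 1 3 4 using natural_rules[OF nat_Iu(1) xs] by (simp add: cat_rules[OF X] nat_Iu(2))
next
  fix w l f es assume w: "w \<in> words T" and f: "index_map (arity T w) l f" and es: "es \<in> Obj (Pw l PA)"
  let ?xs = "map (\<lambda>e. ob e j) es"
  note sb = nat_Sb[OF w f]
  have es: "es \<in> Obj (pow l E)" using es by simp
  have xs: "?xs \<in> Obj (pow l (Und F))" by (rule map_ob(1)[OF es j])
  have fx: "map (\<lambda>e. ob e j) (reindex f es) = reindex f ?xs"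
    using es by (subst reindex_map_E[OF f]) (simp_all add: pow_sel)
  have 4: "map (on_ob (fn (eps j))) es = ?xs" using map_pt(1)[OF es] by simp
  have 1: "cmp (rho (eps j) (wsub T l f w)) es = Idn (Und F) (on_ob (Phi F (wsub T l f w)) ?xs)"
    by (rule cmp_rho_eps[OF j]) (use es in \<open>simp_all add: wsub_word[OF w f]\<close>)
  have 2: "cmp (rho (eps j) w) (reindex f es) = Idn (Und F) (on_ob (Phi F w) (reindex f ?xs))"
    unfolding fx[symmetric] by (rule cmp_rho_eps[OF j w reindex_pow(1)[OF f es]])
  have 3: "on_ar (fn (eps j)) (cmp (Sb PA w l f) es) = cmp (Sb F w l f) ?xs"
    using Ln(2)[OF sb(1) es j] natural_rules(1)[OF Ln(1)[OF sb(1)] es] by simp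
  show "Comp (Und F) (cmp (Sb F w l f) (map (on_ob (fn (eps j))) es)) (cmp (rho (eps j) (wsub T l f w)) es) =
      Comp (Und F) (cmp (rho (eps j) w) (reindex f es)) (on_ar (fn (eps j)) (cmp (Sb PA w l f) es))"
    unfolding 1 2 3 4 using natural_rules[OF sb(1) xs] xs by (simp add: cat_rules[OF X] sb(2,3))
qed

text \<open>Both \<open>rho\<close> being identities, the cell condition is the formula for the
  values of a lifted functor on arrows of \<open>J\<close>.\<close>

lemma pseudo_cell_tr:
  assumes u: "u \<in> Arr J"
  shows "pseudo_cell T PA F (eps (Dom J u)) (eps (Cod J u)) (tr u)"
  unfolding pseudo_cell_iff[OF lawvere pseudo_algebra_PA F_alg]
proof (intro conjI ballI)
  note [simp] = u cat_rules[OF J]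
  show "is_natural (Und PA) (Und F) (tr u)" by (simp add: is_natural_tr)
  fix w es assume w: "w \<in> words T" and "es \<in> Obj (Pw (arity T w) PA)"
  then have es: "es \<in> Obj (pow (arity T w) E)" by simp
  note L = Lf[OF F.Phi[OF w]]
  note m = map_ob(3)[OF es u] and F = functor_rules[OF F.Phi[OF w]]
  show "Comp (Und F) (cmp (rho (eps (Cod J u)) w) es) (cmp (tr u) (on_ob (Phi PA w) es)) =
      Comp (Und F) (on_ar (Phi F w) (map (cmp (tr u)) es)) (cmp (rho (eps (Dom J u)) w) es)"
    unfolding cmp_rho_eps[OF cat_rules(1)[OF J u] w es] cmp_rho_eps[OF cat_rules(2)[OF J u] w es]
    using functor_rules(1)[OF L(1) es] L(3)[OF es u] F(2-4)[OF m] es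
    by (simp add: map_pt map_ob_Dom_Cod cat_rules[OF X])
qed (simp_all add: pseudo_morphism_eps u cat_rules[OF J])

definition Eps :: "('j, 'i, ('t, 'p, 'q, 'x, 'y) psmor, ('t, 'p, 'q, 'x, 'y) pscell) ftr" where
  "Eps = \<lparr>on_ob = (\<lambda>j\<in>Obj J. eps j), on_ar = (\<lambda>u\<in>Arr J. (eps (Dom J u), eps (Cod J u), tr u))\<rparr>"

lemma Eps_sel [simp]: "j \<in> Obj J \<Longrightarrow> on_ob Eps j = eps j"
  "u \<in> Arr J \<Longrightarrow> on_ar Eps u = (eps (Dom J u), eps (Cod J u), tr u)"
  "on_ob Eps \<in> extensional (Obj J)" "on_ar Eps \<in> extensional (Arr J)"
  by (simp_all add: Eps_def)

text \<open>Functoriality in \<open>J\<close> is checked at each object of \<open>E\<close>, where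
  it is functoriality of the coded functor.\<close>

lemma is_functor_Eps: "is_functor J (psalg_hom T PA F) Eps"
proof (rule functorI)
  note [simp] = cat_rules[OF J]
  show "category (psalg_hom T PA F)" by (rule category_psalg_hom[OF lawvere pseudo_algebra_PA F_alg])
  fix j assume j: "j \<in> Obj J"
  have "tr (Idn J j) = nid E (Und F) (pt j)"
    by (rule natural_eqI[OF is_natural_tr is_natural_nid[OF is_functor_pt]])
      (simp_all add: j ob_mo_rules)
  then show "on_ar Eps (Idn J j) = Idn (psalg_hom T PA F) (on_ob Eps j)" by (simp add: j)
next
  note [simp] = cat_rules[OF J]
  fix u v assume uv: "u \<in> Arr J" "v \<in> Arr J" "Dom J v = Cod J u"
  have "tr (Comp J v u) = vcomp E (Und F) (tr v) (tr u)"
    by (rule natural_eqI[OF is_natural_tr is_natural_vcomp[OF is_natural_tr is_natural_tr]])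
      (simp_all add: uv ob_mo_rules)
  then show "on_ar Eps (Comp J v u) = Comp (psalg_hom T PA F) (on_ar Eps v) (on_ar Eps u)"
    by (simp add: uv)
qed (simp_all add: J cat_rules[OF J] pseudo_morphism_eps pseudo_cell_tr)

text \<open>The \<open>rho\<close> of an evaluation is an identity and drops out. Thus the component
  morphisms of a cone carry exactly the components in \<open>J\<close> of
  \<open>rho H\<close>.\<close>

lemma eps_comp:
  assumes H: "premorphism T A PA H" and j: "j \<in> Obj J"
  shows "fn (psmor_comp T A PA F (eps j) H) = fcomp (Und A) (pt j) (fn H)"
    and "\<lbrakk>w \<in> words T; xs \<in> Obj (Pw (arity T w) A)\<rbrakk> \<Longrightarrow>
      cmp (rho (psmor_comp T A PA F (eps j) H) w) xs = co (cmp (rho H w) xs) j"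
    and "premorphism T A F (psmor_comp T A PA F (eps j) H)"
proof -
  interpret composable_premorphisms T A PA F H "eps j"
    by (intro composable_premorphisms.intro H premorphism_eps j)
  show "fn HG = fcomp (Und A) (pt j) (fn H)" by (simp add: fn_comp)
  show "premorphism T A F HG" by (rule premorphism_comp)
  assume w: "w \<in> words T" and xs: "xs \<in> Obj (Pw (arity T w) A)"
  have ys: "map (on_ob (fn H)) xs \<in> Obj (pow (arity T w) E)" using map_fn_Obj[OF xs] by simp
  show "cmp (rho HG w) xs = co (cmp (rho H w) xs) j"
    unfolding cmp_rho_comp[OF w xs] cmp_rho_eps[OF j w ys]
    using G.rho_rules[OF w xs] ys j
    by (simp add: co_rules cat_rules[OF X] Lf(2)[OF F.Phi[OF w]] del: map_map)
qed

end

section \<open>The universal property\<close>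

locale power_algebra_cone = power_algebra T F J E enc ev + A: pseudo_algebra T A
  for T :: "'t lawvere" and F :: "('t, 'x, 'y) psalg" and J :: "('j, 'i) cat" and E :: "('p, 'q) cat"
    and enc :: "(('j, 'i, 'x, 'y) ftr, ('j, 'i, 'x, 'y) ntr, 'p, 'q) ftr"
    and ev :: "('p, 'q, ('j, 'i, 'x, 'y) ftr, ('j, 'i, 'x, 'y) ntr) ftr"
    and A :: "('t, 'o, 'a) psalg"
begin

lemmas A_alg = A.pseudo_algebra_axioms

text \<open>This is \<open>cone_ob\<close> for the evaluations, spelled out with morphisms of pseudo
  algebras. Working outside \<open>PsAlg\<close> allows the categories involved to have different
  types.\<close>

definition cone_mor where
  "cone_mor H = \<lparr>on_ob = (\<lambda>j\<in>Obj J. psmor_comp T A PA F (eps j) H),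
    on_ar = (\<lambda>u\<in>Arr J. (psmor_comp T A PA F (eps (Dom J u)) H, psmor_comp T A PA F (eps (Cod J u)) H,
      hcomp (Und A) (Und F) (tr u) (nid (Und A) E (fn H))))\<rparr>"

definition cone_cell where
  "cone_cell c = (case c of (G, H, \<alpha>) \<Rightarrow> \<lparr>src = cone_mor G, tgt = cone_mor H,
    cmp = (\<lambda>j\<in>Obj J. (psmor_comp T A PA F (eps j) G, psmor_comp T A PA F (eps j) H,
      hcomp (Und A) (Und F) (nid E (Und F) (pt j)) \<alpha>))\<rparr>)"

section \<open>Morphisms into the power algebra and functors on \<open>J\<close>\<close>

lemma pseudo_morphism_premorphism_PA: "pseudo_morphism T A PA H \<Longrightarrow> premorphism T A PA H"
  by (rule pseudo_morphism_premorphism[OF lawvere A_alg pseudo_algebra_PA])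

lemma fn_functor: "pseudo_morphism T A PA H \<Longrightarrow> is_functor (Und A) E (fn H)"
  by (simp add: pseudo_morphism_def)

lemma cmp_tr_fn:
  assumes H: "is_functor (Und A) E h" and u: "u \<in> Arr J" and x: "x \<in> Obj (Und A)"
  shows "cmp (hcomp (Und A) (Und F) (tr u) (nid (Und A) E h)) x = mo (on_ob h x) u"
  using cmp_hcomp_nid_right[OF is_natural_tr[OF u] H x] functor_rules(1)[OF H x] by simp

text \<open>The morphisms in the cone determine \<open>ob\<close> and \<open>co\<close> of the
  underlying functor and the components of \<open>rho\<close>, while its 2-cells determine
  \<open>mo\<close>; together these determine a morphism into \<open>PA\<close>.\<close>

lemma cone_mor_inj:
  assumes H: "pseudo_morphism T A PA H" and H': "pseudo_morphism T A PA H'"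
    and eq: "cone_mor H = cone_mor H'"
  shows "H = H'"
proof -
  note pH = pseudo_morphism_premorphism_PA[OF H] and pH' = pseudo_morphism_premorphism_PA[OF H']
  note fH = fn_functor[OF H] and fH' = fn_functor[OF H']
  have eqj: "psmor_comp T A PA F (eps j) H = psmor_comp T A PA F (eps j) H'" if "j \<in> Obj J" for j
    using arg_cong[OF eq, of "\<lambda>K. on_ob K j"] that by (simp add: cone_mor_def)
  have equ: "hcomp (Und A) (Und F) (tr u) (nid (Und A) E (fn H)) =
      hcomp (Und A) (Und F) (tr u) (nid (Und A) E (fn H'))" if "u \<in> Arr J" for u
    using arg_cong[OF eq, of "\<lambda>K. on_ar K u"] that by (simp add: cone_mor_def)
  have fj: "fcomp (Und A) (pt j) (fn H) = fcomp (Und A) (pt j) (fn H')" if "j \<in> Obj J" for j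
    using eps_comp(1)[OF pH that] eps_comp(1)[OF pH' that] eqj[OF that] by simp
  have fn: "fn H = fn H'"
  proof (rule functor_E_eqI[OF fH fH'])
    fix x j assume "x \<in> Obj (Und A)" "j \<in> Obj J"
    then show "ob (on_ob (fn H) x) j = ob (on_ob (fn H') x) j"
      using arg_cong[OF fj, of j "\<lambda>K. on_ob K x"] functor_rules(1)[OF fH] functor_rules(1)[OF fH'] by simp
  next
    fix x u assume "x \<in> Obj (Und A)" "u \<in> Arr J"
    then show "mo (on_ob (fn H) x) u = mo (on_ob (fn H') x) u"
      using arg_cong[OF equ, of u "\<lambda>t. cmp t x"] cmp_tr_fn[OF fH, of u x] cmp_tr_fn[OF fH', of u x] by simp
  next
    fix f j assume "f \<in> Arr (Und A)" "j \<in> Obj J"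
    then show "co (on_ar (fn H) f) j = co (on_ar (fn H') f) j"
      using arg_cong[OF fj, of j "\<lambda>K. on_ar K f"] functor_rules(2)[OF fH] functor_rules(2)[OF fH'] by simp
  qed
  interpret H: premorphism T A PA H by (rule pH)
  interpret H': premorphism T A PA H' by (rule pH')
  show ?thesis
  proof (rule psmor_eqI[OF pH pH' _ _ fn])
    show "rho H \<in> extensional (words T)" "rho H' \<in> extensional (words T)"
      using H H' by (simp_all add: pseudo_morphism_def)
    fix w xs assume w: "w \<in> words T" and xs: "xs \<in> Obj (Pw (arity T w) A)"
    note r = H.rho_rules[OF w xs] H'.rho_rules[OF w xs]
    show "cmp (rho H w) xs = cmp (rho H' w) xs"
    proof (rule Arr_eqI)
      fix j assume j: "j \<in> Obj J"
      show "co (cmp (rho H w) xs) j = co (cmp (rho H' w) xs) j"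
        using eps_comp(2)[OF pH j w xs] eps_comp(2)[OF pH' j w xs] eqj[OF j] by simp
    qed (use r fn in simp_all)
  qed
qed

text \<open>The underlying functors and transformations of \<open>K\<close> are transposed to a
  functor \<open>h\<close> into \<open>E\<close>, and the components of \<open>rho\<close> at all
  \<open>j\<close> are assembled into arrows of \<open>E\<close>. Since parallel arrows of
  \<open>E\<close> are compared at each \<open>j\<close>, every coherence equation reduces to the
  one for the morphism \<open>on_ob K j\<close>.\<close>

lemma cone_mor_surj:
  assumes K: "is_functor J (psalg_hom T A F) K"
  shows "\<exists>H. pseudo_morphism T A PA H \<and> cone_mor H = K"
proof -
  let ?X = "Und A" and ?Y = "Und F"
  \<comment> \<open>A 2-cell is a triple; \<open>\<kappa> u\<close> is its transformation, the other
    two entries being the ends dictated by functoriality of \<open>K\<close>.\<close>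
  define \<kappa> where "\<kappa> u = snd (snd (on_ar K u))" for u
  define k where "k j = fn (on_ob K j)" for j
  note [simp] = cat_rules[OF J] cat_rules[OF A.Und]
  note TAF = lawvere A_alg F_alg
  have Kj: "pseudo_morphism T A F (on_ob K j)" if "j \<in> Obj J" for j
    using functor_rules(1)[OF K that] by simp
  note pK = pseudo_morphism_premorphism[OF TAF Kj]
  have Ku: "on_ar K u = (on_ob K (Dom J u), on_ob K (Cod J u), \<kappa> u)"
    and cell: "pseudo_cell T A F (on_ob K (Dom J u)) (on_ob K (Cod J u)) (\<kappa> u)" if u: "u \<in> Arr J" for u
  proof -
    obtain a b c where abc: "on_ar K u = (a, b, c)" by (cases "on_ar K u")
    show e: "on_ar K u = (on_ob K (Dom J u), on_ob K (Cod J u), \<kappa> u)"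
      using functor_rules(3,4)[OF K u] by (simp add: abc \<kappa>_def)
    show "pseudo_cell T A F (on_ob K (Dom J u)) (on_ob K (Cod J u)) (\<kappa> u)"
      using functor_rules(2)[OF K u] unfolding e by simp
  qed
  note cellD = cell[unfolded pseudo_cell_iff[OF TAF]]
  have fk: "is_functor ?X ?Y (k j)" if "j \<in> Obj J" for j
    using Kj[OF that] by (simp add: k_def pseudo_morphism_def)
  have nk: "is_natural ?X ?Y (\<kappa> u)" "src (\<kappa> u) = k (Dom J u)" "tgt (\<kappa> u) = k (Cod J u)" if "u \<in> Arr J" for u
    using cellD[OF that] by (simp_all add: k_def)
  have kI: "cmp (\<kappa> (Idn J j)) x = Idn ?Y (on_ob (k j) x)" if "j \<in> Obj J" "x \<in> Obj ?X" for j x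
    using functor_rules(5)[OF K that(1)] that by (simp add: \<kappa>_def k_def)
  have kC: "cmp (\<kappa> (Comp J v u)) x = Comp ?Y (cmp (\<kappa> v) x) (cmp (\<kappa> u) x)"
    if "u \<in> Arr J" "v \<in> Arr J" "Dom J v = Cod J u" "x \<in> Obj ?X" for u v x
    unfolding \<kappa>_def[of "Comp J v u"] functor_rules(6)[OF K that(1-3)] Ku[OF that(1)] Ku[OF that(2)]
    using that(4) by simp
  note L = lift_ftr[OF A.Und fk nk kI kC]
  define h where "h = lift_ftr ?X k \<kappa>"
  have h: "is_functor ?X E h" "\<lbrakk>x \<in> Obj ?X; j \<in> Obj J\<rbrakk> \<Longrightarrow> ob (on_ob h x) j = on_ob (k j) x"
    "\<lbrakk>x \<in> Obj ?X; u \<in> Arr J\<rbrakk> \<Longrightarrow> mo (on_ob h x) u = cmp (\<kappa> u) x"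
    "\<lbrakk>f \<in> Arr ?X; j \<in> Obj J\<rbrakk> \<Longrightarrow> co (on_ar h f) j = on_ar (k j) f" for x j u f
    unfolding h_def by (rule L; assumption)+
  have hob: "map (\<lambda>e. ob e j) (map (on_ob h) xs) = map (on_ob (k j)) xs"
    if "xs \<in> Obj (Pw n A)" "j \<in> Obj J" for xs n j
    using that by (simp add: pow_sel h(2) subset_iff)
  have hco: "map (\<lambda>a. co a j) (map (on_ar h) as) = map (on_ar (k j)) as"
    if "as \<in> Arr (Pw n A)" "j \<in> Obj J" for as n j
    using that by (simp add: pow_sel h(4) subset_iff)
  have hmo: "map (\<lambda>e. mo e u) (map (on_ob h) xs) = map (cmp (\<kappa> u)) xs"
    if "xs \<in> Obj (Pw n A)" "u \<in> Arr J" for xs n u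
    using that by (simp add: pow_sel h(3) subset_iff)
  \<comment> \<open>The ends are forced by the definition of a morphism; the component at
    \<open>xs\<close> is the arrow of \<open>E\<close> whose value at \<open>j\<close> is that of
    the \<open>rho\<close> of \<open>on_ob K j\<close>.\<close>
  define R where "R w = lift_ntr (Pw (arity T w) A) (fcomp (Pw (arity T w) A) h (Phi A w))
    (fcomp (Pw (arity T w) A) (Lf (arity T w) (Phi F w)) (fpow (arity T w) ?X h))
    (\<lambda>j xs. cmp (rho (on_ob K j) w) xs)" for w
  define H where "H = \<lparr>fn = h, rho = (\<lambda>w\<in>words T. R w)\<rparr>"
  have fnH: "fn H = h" and rhoH: "w \<in> words T \<Longrightarrow> rho H w = R w" for w by (simp_all add: H_def)
  have hx: "map (on_ob h) xs \<in> Obj (pow n E)" if "xs \<in> Obj (Pw n A)" for xs n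
    using functor_rules(1)[OF is_functor_fpow[OF h(1)] that] fpow_sel(1)[OF that, of h] by metis
  have hf: "map (on_ar h) as \<in> Arr (pow n E)" if "as \<in> Arr (Pw n A)" for as n
    using functor_rules(2)[OF is_functor_fpow[OF h(1)] that] fpow_sel(2)[OF that, of h] by metis
  have R: "is_natural (Pw (arity T w) A) E (R w)"
    "\<lbrakk>xs \<in> Obj (Pw (arity T w) A); j \<in> Obj J\<rbrakk> \<Longrightarrow> co (cmp (R w) xs) j = cmp (rho (on_ob K j) w) xs"
    if w: "w \<in> words T" for w xs j
  proof -
    let ?n = "arity T w"
    note P = A.Phi[OF w] and Q = F.Phi[OF w]
    note r = premorphism.rho_rules[OF pK w]
    have 1: "is_functor (Pw ?n A) E (fcomp (Pw ?n A) h (Phi A w))"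
      by (rule is_functor_fcomp[OF P h(1)])
    have 2: "is_functor (Pw ?n A) E (fcomp (Pw ?n A) (Lf ?n (Phi F w)) (fpow ?n ?X h))"
      by (rule is_functor_fcomp[OF is_functor_fpow[OF h(1)] Lf(1)[OF Q]])
    have *: "is_natural (Pw ?n A) E (R w) \<and>
      (\<forall>xs j. xs \<in> Obj (Pw ?n A) \<longrightarrow> j \<in> Obj J \<longrightarrow> co (cmp (R w) xs) j = cmp (rho (on_ob K j) w) xs)"
      unfolding R_def
    proof (intro conjI allI impI)
      \<comment> \<open>This is the cell condition for \<open>\<kappa> u\<close> at
        \<open>xs\<close>: precisely what makes the components of \<open>rho\<close> at the various
        \<open>j\<close> into a transformation in the variable of \<open>J\<close>.\<close>
      have natJ: "Comp ?Y (cmp (rho (on_ob K (Cod J u)) w) xs)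
          (mo (on_ob (fcomp (Pw ?n A) h (Phi A w)) xs) u) =
        Comp ?Y (mo (on_ob (fcomp (Pw ?n A) (Lf ?n (Phi F w)) (fpow ?n ?X h)) xs) u)
          (cmp (rho (on_ob K (Dom J u)) w) xs)" if "u \<in> Arr J" "xs \<in> Obj (Pw ?n A)" for u xs
        using cellD[OF that(1)] w that hx[OF that(2)] functor_rules(1)[OF P that(2)]
        by (simp add: h(3) Lf(3)[OF Q] hmo del: map_map)
      \<comment> \<open>Naturality in lists of arrows of \<open>A\<close> is that of
        \<open>rho\<close> for the single morphism \<open>on_ob K j\<close>.\<close>
      have natA: "Comp ?Y (cmp (rho (on_ob K j) w) (Cod (Pw ?n A) as))
          (co (on_ar (fcomp (Pw ?n A) h (Phi A w)) as) j) =
        Comp ?Y (co (on_ar (fcomp (Pw ?n A) (Lf ?n (Phi F w)) (fpow ?n ?X h)) as) j)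
          (cmp (rho (on_ob K j) w) (Dom (Pw ?n A) as))" if "j \<in> Obj J" "as \<in> Arr (Pw ?n A)" for j as
        using premorphism.rho_naturality[OF pK[OF that(1)] w that(2)] that hf[OF that(2)]
          functor_rules(2)[OF P that(2)]
        by (simp add: h(4) Lf(4)[OF Q] hco k_def[symmetric] pow_sel(3,4) del: map_map)
      have t: "cmp (rho (on_ob K j) w) xs \<in> Arr ?Y"
        "Dom ?Y (cmp (rho (on_ob K j) w) xs) = ob (on_ob (fcomp (Pw ?n A) h (Phi A w)) xs) j"
        "Cod ?Y (cmp (rho (on_ob K j) w) xs) =
          ob (on_ob (fcomp (Pw ?n A) (Lf ?n (Phi F w)) (fpow ?n ?X h)) xs) j"
        if "j \<in> Obj J" "xs \<in> Obj (Pw ?n A)" for j xs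
        using r[OF that] that hx[OF that(2)] functor_rules(1)[OF P that(2)]
        by (simp_all add: h(2) Lf(2)[OF Q] hob k_def[symmetric] del: map_map)
      note l = lift_ntr[OF 1 2 t natJ natA]
      show "is_natural (Pw ?n A) E (lift_ntr (Pw ?n A) (fcomp (Pw ?n A) h (Phi A w))
        (fcomp (Pw ?n A) (Lf ?n (Phi F w)) (fpow ?n ?X h)) (\<lambda>j xs. cmp (rho (on_ob K j) w) xs))"
        by (rule l(1))
      fix xs j assume "xs \<in> Obj (Pw ?n A)" "j \<in> Obj J"
      then show "co (cmp (lift_ntr (Pw ?n A) (fcomp (Pw ?n A) h (Phi A w))
        (fcomp (Pw ?n A) (Lf ?n (Phi F w)) (fpow ?n ?X h)) (\<lambda>j xs. cmp (rho (on_ob K j) w) xs)) xs) j =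
        cmp (rho (on_ob K j) w) xs" by - (rule l(2))
    qed
    show "is_natural (Pw ?n A) E (R w)" using * by blast
    show "\<lbrakk>xs \<in> Obj (Pw ?n A); j \<in> Obj J\<rbrakk> \<Longrightarrow> co (cmp (R w) xs) j = cmp (rho (on_ob K j) w) xs"
      using * by blast
  qed
  have pH: "premorphism T A PA H"
  proof (intro premorphism.intro premorphism_axioms.intro lawvere A_alg pseudo_algebra_PA)
    show "is_functor (Und A) (Und PA) (fn H)" by (simp add: fnH h)
    fix w assume w: "w \<in> words T"
    \<comment> \<open>Invertibility in \<open>E\<close> is tested at each \<open>j\<close>, where it
      is part of \<open>on_ob K j\<close> being a morphism.\<close>
    have "iso E (cmp (R w) xs)" if xs: "xs \<in> Obj (Pw (arity T w) A)" for xs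
    proof (rule iso_E)
      show "cmp (R w) xs \<in> Arr E" by (rule natural_rules(1)[OF R(1)[OF w] xs])
      fix j assume j: "j \<in> Obj J"
      show "iso ?Y (co (cmp (R w) xs) j)"
        unfolding R(2)[OF w xs j] by (rule natural_isoD(4)[OF premorphism.rho[OF pK[OF j] w] xs])
    qed
    then show "natural_iso (Pw (arity T w) A) (Und PA) (fcomp (Pw (arity T w) A) (fn H) (Phi A w))
        (fcomp (Pw (arity T w) A) (Phi PA w) (fpow (arity T w) ?X (fn H))) (rho H w)"
      using R(1)[OF w] by (simp add: natural_iso_def fnH rhoH[OF w]) (simp add: R_def)
  qed
  interpret H: premorphism T A PA H by (rule pH)
  have rj: "co (cmp (rho H w) xs) j = cmp (rho (on_ob K j) w) xs"
    if "w \<in> words T" "xs \<in> Obj (Pw (arity T w) A)" "j \<in> Obj J" for w xs j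
    using R(2)[OF that] rhoH[OF that(1)] by simp
  note [simp] = cat_rules[OF E]
  have rH: "cmp (rho H w) xs \<in> Arr E"
    "Dom E (cmp (rho H w) xs) = on_ob h (on_ob (Phi A w) xs)"
    "Cod E (cmp (rho H w) xs) = on_ob (Lf (arity T w) (Phi F w)) (map (on_ob h) xs)"
    if "w \<in> words T" "xs \<in> Obj (Pw (arity T w) A)" for w xs
    using H.rho_rules[OF that] by (simp_all add: fnH)
  have mH: "pseudo_morphism T A PA H"
    unfolding pseudo_morphism_iff[OF pH]
  proof (intro conjI allI impI ballI)
    show "rho H \<in> extensional (words T)" by (simp add: H_def)
  next
    fix w ws xs assume c: "composable T w ws" and xs: "xs \<in> Obj (Pw (sum_list (map (arity T) ws)) A)"
    let ?ns = "map (arity T) ws"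
    let ?ps = "map (\<lambda>i. on_ob (Phi A (ws ! i)) (reindex (block ?ns i) xs)) [0..<length ws]"
    let ?rs = "map (\<lambda>i. cmp (rho H (ws ! i)) (reindex (block ?ns i) xs)) [0..<length ws]"
    let ?hs = "map (on_ob h) xs" and ?g = "wgamma T w ws"
    note cD = composableD[OF c] and \<gamma> = wgamma_word[OF c]
    note t = H.Co_typing[OF c xs, unfolded fnH PA_sel(1)]
    have xs\<gamma>: "xs \<in> Obj (Pw (arity T ?g) A)" using xs \<gamma> by simp
    have x: "reindex (block ?ns i) xs \<in> Obj (Pw (arity T (ws ! i)) A)" if "i < length ws" for i
      using reindex_pow(1)[OF index_map_block[of i ?ns] xs] that by simp
    note r1 = rH[OF \<gamma>(1) xs\<gamma>] and r2 = rH[OF cD(1) t(1)]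
    have cE: "cmp (Co PA w ws) ?hs \<in> Arr E"
      "Dom E (cmp (Co PA w ws) ?hs) = Cod E (cmp (rho H ?g) xs)"
      "Cod E (on_ar (Phi PA w) ?rs) = Cod E (cmp (Co PA w ws) ?hs)"
      "on_ar (Phi PA w) ?rs \<in> Arr E"
      "Dom E (on_ar (Phi PA w) ?rs) = Cod E (cmp (rho H w) ?ps)"
      "?rs \<in> Arr (pow (arity T w) E)" "?hs \<in> Obj (pow (sum_list ?ns) E)"
      using t r1(3) r2(3) by (simp_all only: PA_sel(2))
    have hc: "on_ar h (cmp (Co A w ws) xs) \<in> Arr E"
      "Dom E (on_ar h (cmp (Co A w ws) xs)) = on_ob h (on_ob (Phi A ?g) xs)"
      "Cod E (on_ar h (cmp (Co A w ws) xs)) = Dom E (cmp (rho H w) ?ps)"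
      using functor_rules(2-4)[OF h(1) t(4)] r2(2) by (simp_all only: t(5,6))
    have r: "Comp E (cmp (rho H w) ?ps) (on_ar h (cmp (Co A w ws) xs)) \<in> Arr E"
      "Dom E (Comp E (cmp (rho H w) ?ps) (on_ar h (cmp (Co A w ws) xs))) = on_ob h (on_ob (Phi A ?g) xs)"
      "Cod E (Comp E (cmp (rho H w) ?ps) (on_ar h (cmp (Co A w ws) xs))) = Cod E (cmp (rho H w) ?ps)"
      using cat_rules(6-8)[OF E hc(1) r2(1) hc(3)[symmetric]] hc(2) by simp_all
    \<comment> \<open>Once the ends are known to agree, this equation in \<open>E\<close> may be
      compared at each \<open>j\<close>, where it becomes the \<open>Co\<close> equation of
      \<open>on_ob K j\<close>.\<close>
    have "Comp E (cmp (Co PA w ws) ?hs) (cmp (rho H ?g) xs) =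
        Comp E (on_ar (Phi PA w) ?rs) (Comp E (cmp (rho H w) ?ps) (on_ar h (cmp (Co A w ws) xs)))"
      (is "?l = ?r")
    proof (rule Arr_eqI)
      note l' = cat_rules(6-8)[OF E r1(1) cE(1,2)]
      note r' = cat_rules(6-8)[OF E r(1) cE(4) trans[OF cE(5) r(3)[symmetric]]]
      show "?l \<in> Arr E" "?r \<in> Arr E" by (rule l' r')+
      show "Dom E ?l = Dom E ?r" "Cod E ?l = Cod E ?r"
        unfolding l' r' r(2) r1(2) cE(3) by (rule refl)+
      fix j assume j: "j \<in> Obj J"
      note Kc = Kj[OF j, unfolded pseudo_morphism_iff[OF pK[OF j]], THEN conjunct2,
          THEN conjunct1, rule_format, OF c xs]
      have 1: "co (cmp (Co PA w ws) ?hs) j = cmp (Co F w ws) (map (on_ob (k j)) xs)"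
        using Ln(2)[OF nat_Co(1)[OF c refl] cE(7) j] hob[OF xs j] by (simp del: map_map)
      have 2: "map (\<lambda>a. co a j) ?rs =
          map (\<lambda>i. cmp (rho (on_ob K j) (ws ! i)) (reindex (block ?ns i) xs)) [0..<length ws]"
        using rj[OF cD(2) x j] by simp
      have 3: "co (on_ar (Phi PA w) ?rs) j = on_ar (Phi F w)
          (map (\<lambda>i. cmp (rho (on_ob K j) (ws ! i)) (reindex (block ?ns i) xs)) [0..<length ws])"
        using Lf(4)[OF F.Phi[OF cD(1)] cE(6) j] unfolding 2 PA_sel(2) .
      show "co ?l j = co ?r j"
        unfolding co_Comp[OF r1(1) cE(1,2) j] co_Comp[OF r(1) cE(4) trans[OF cE(5) r(3)[symmetric]] j]
          co_Comp[OF hc(1) r2(1) hc(3)[symmetric] j] 1 3 rj[OF \<gamma>(1) xs\<gamma> j] rj[OF cD(1) t(1) j]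
          h(4)[OF t(4) j]
        using Kc unfolding k_def .
    qed
    then show "Comp (Und PA) (cmp (Co PA w ws) (map (on_ob (fn H)) xs)) (cmp (rho H ?g) xs) =
        Comp (Und PA) (on_ar (Phi PA w) ?rs)
          (Comp (Und PA) (cmp (rho H w) ?ps) (on_ar (fn H) (cmp (Co A w ws) xs)))"
      unfolding PA_sel(1) fnH .
  next
    fix xs assume xs: "xs \<in> Obj (Pw (Suc 0) A)"
    let ?hs = "map (on_ob h) xs" and ?u = "unit_word T"
    note u = unit_word
    have xs': "xs \<in> Obj (Pw (arity T ?u) A)" using xs by (simp add: u)
    note hs = hx[OF xs] and r = rH[OF u(1) xs'] and n = natural_rules[OF Ln(1)[OF nat_Iu(1)] hx[OF xs]]
    note ia = natural_isoD[OF A.Iu[unfolded One_nat_def]]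
    note a = natural_rules[OF ia(1) xs]
    have 0: "Dom E (cmp (Ln (Suc 0) (Iu F)) ?hs) = Cod E (cmp (rho H ?u) xs)"
      using n(2) r(3) by (simp add: u nat_Iu(2))
    have "Comp E (cmp (Ln (Suc 0) (Iu F)) ?hs) (cmp (rho H ?u) xs) = on_ar h (cmp (Iu A) xs)" (is "?l = ?r")
    proof (rule Arr_eqI)
      note l' = cat_rules(6-8)[OF E r(1) n(1) 0]
      show "?l \<in> Arr E" "?r \<in> Arr E" using l' functor_rules(2)[OF h(1) a(1)] by simp_all
      \<comment> \<open>The codomains agree because the lifting of the unit functor is the unit
        functor of \<open>E\<close>.\<close>
      show "Dom E ?l = Dom E ?r" "Cod E ?l = Cod E ?r"
        unfolding l' r(2) n(3) functor_rules(3,4)[OF h(1) a(1)] a(2,3)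
        using xs hs by (simp_all add: ia nat_Iu(3) Lf_funit del: map_map) (simp_all add: pow_sel)
      fix j assume j: "j \<in> Obj J"
      note Kc = Kj[OF j, unfolded pseudo_morphism_iff[OF pK[OF j]], THEN conjunct2,
          THEN conjunct2, THEN conjunct1, rule_format, OF xs]
      show "co ?l j = co ?r j"
        unfolding co_Comp[OF r(1) n(1) 0 j] Ln(2)[OF nat_Iu(1) hs j] hob[OF xs j] rj[OF u(1) xs' j]
          h(4)[OF a(1) j] using Kc unfolding k_def .
    qed
    then show "Comp (Und PA) (cmp (Iu PA) (map (on_ob (fn H)) xs)) (cmp (rho H ?u) xs) =
        on_ar (fn H) (cmp (Iu A) xs)" by (simp only: PA_sel fnH)
  next
    fix w l f xs assume w: "w \<in> words T" and f: "index_map (arity T w) l f" and xs: "xs \<in> Obj (Pw l A)"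
    let ?hs = "map (on_ob h) xs" and ?v = "wsub T l f w"
    note v = wsub_word[OF w f] and sb = nat_Sb[OF w f]
    have xs': "xs \<in> Obj (Pw (arity T ?v) A)" using xs by (simp add: v)
    note fx = reindex_pow(1)[OF f xs]
    note hs = hx[OF xs] and r = rH[OF v(1) xs'] and r2 = rH[OF w fx]
      and n = natural_rules[OF Ln(1)[OF sb(1)] hx[OF xs]]
    note sa = natural_isoD[OF A.Sb[OF w f]]
    note a = natural_rules[OF sa(1) xs]
    have 0: "Dom E (cmp (Ln l (Sb F w l f)) ?hs) = Cod E (cmp (rho H ?v) xs)"
      using n(2) r(3) by (simp add: v sb(2))
    have fh: "reindex f ?hs = map (on_ob h) (reindex f xs)"
      using index_mapD(3)[OF f] xs by (simp add: reindex_map pow_sel)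
    have 1: "Dom E (cmp (rho H w) (reindex f xs)) = Cod E (on_ar h (cmp (Sb A w l f) xs))"
      unfolding r2(2) functor_rules(4)[OF h(1) a(1)] a(3) using xs by (simp add: sa(3))
    note ha = functor_rules(2)[OF h(1) a(1)]
    have "Comp E (cmp (Ln l (Sb F w l f)) ?hs) (cmp (rho H ?v) xs) =
        Comp E (cmp (rho H w) (reindex f xs)) (on_ar h (cmp (Sb A w l f) xs))" (is "?l = ?r")
    proof (rule Arr_eqI)
      note l' = cat_rules(6-8)[OF E r(1) n(1) 0] and r' = cat_rules(6-8)[OF E ha r2(1) 1]
      show "?l \<in> Arr E" "?r \<in> Arr E" by (rule l' r')+
      show "Dom E ?l = Dom E ?r"
        unfolding l' r' r(2) functor_rules(3)[OF h(1) a(1)] a(2) by (simp add: sa(2))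
      show "Cod E ?l = Cod E ?r"
        unfolding l' r' n(3) r2(3) using hs
        by (simp add: sb(3) Lf_fsub[OF f F.Phi[OF w]] fh del: map_map)
      fix j assume j: "j \<in> Obj J"
      note Kc = Kj[OF j, unfolded pseudo_morphism_iff[OF pK[OF j]], THEN conjunct2,
          THEN conjunct2, THEN conjunct2, rule_format, OF w f xs]
      show "co ?l j = co ?r j"
        unfolding co_Comp[OF r(1) n(1) 0 j] co_Comp[OF ha r2(1) 1 j] Ln(2)[OF sb(1) hs j] hob[OF xs j]
          rj[OF v(1) xs' j] rj[OF w fx j] h(4)[OF a(1) j] using Kc unfolding k_def .
    qed
    then show "Comp (Und PA) (cmp (Sb PA w l f) (map (on_ob (fn H)) xs)) (cmp (rho H ?v) xs) =
        Comp (Und PA) (cmp (rho H w) (reindex f xs)) (on_ar (fn H) (cmp (Sb A w l f) xs))"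
      by (simp only: PA_sel fnH)
  qed
  have "cone_mor H = K"
  proof (rule ftr_eqI[of _ "Obj J" _ "Arr J"])
    have *: "psmor_comp T A PA F (eps j) H = on_ob K j" if j: "j \<in> Obj J" for j
    proof (rule psmor_eqI[OF eps_comp(3)[OF pH j] pK[OF j]])
      show "rho (on_ob K j) \<in> extensional (words T)" using Kj[OF j] by (simp add: pseudo_morphism_def)
      have "fcomp ?X (pt j) h = k j"
        by (rule functor_eqI[OF is_functor_fcomp[OF h(1) is_functor_pt[OF j]] fk[OF j]])
          (simp_all add: functor_rules[OF h(1)] h(2,4) j)
      then show "fn (psmor_comp T A PA F (eps j) H) = fn (on_ob K j)"
        using eps_comp(1)[OF pH j] by (simp add: fnH k_def)
      fix w xs assume "w \<in> words T" "xs \<in> Obj (Pw (arity T w) A)"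
      then show "cmp (rho (psmor_comp T A PA F (eps j) H) w) xs = cmp (rho (on_ob K j) w) xs"
        using eps_comp(2)[OF pH j] rj j by simp
    qed (simp add: psmor_comp_def)
    then show "on_ob (cone_mor H) j = on_ob K j" if "j \<in> Obj J" for j
      using that by (simp add: cone_mor_def)
    fix u assume u: "u \<in> Arr J"
    \<comment> \<open>At \<open>x\<close> the left side is the value of \<open>on_ob h x\<close> on
      \<open>u\<close>, which was chosen as \<open>cmp (\<kappa> u) x\<close>.\<close>
    have "hcomp ?X ?Y (tr u) (nid ?X E h) = \<kappa> u"
    proof (rule natural_eqI[OF is_natural_hcomp[OF is_natural_nid[OF h(1)] is_natural_tr[OF u]] nk(1)[OF u]])
      have p: "fcomp ?X (pt j) h = k j" if j: "j \<in> Obj J" for j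
        by (rule functor_eqI[OF is_functor_fcomp[OF h(1) is_functor_pt[OF j]] fk[OF j]])
          (simp_all add: functor_rules[OF h(1)] h(2,4) j)
      then show "src (hcomp ?X ?Y (tr u) (nid ?X E h)) = src (\<kappa> u)"
        "tgt (hcomp ?X ?Y (tr u) (nid ?X E h)) = tgt (\<kappa> u)"
        using u by (simp_all add: nk)
      fix x assume x: "x \<in> Obj ?X"
      show "cmp (hcomp ?X ?Y (tr u) (nid ?X E h)) x = cmp (\<kappa> u) x"
        unfolding cmp_tr_fn[OF h(1) u x] by (rule h(3)[OF x u])
    qed
    then show "on_ar (cone_mor H) u = on_ar K u"
      using u * by (simp add: cone_mor_def Ku fnH)
  qed (use functor_ext_ob[OF K] functor_ext_ar[OF K] in \<open>simp_all add: cone_mor_def\<close>)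
  with mH show ?thesis by blast
qed

section \<open>2-cells into the power algebra and transformations of cones\<close>

lemma cmp_pt_cell:
  assumes "is_natural (Und A) E \<alpha>" "j \<in> Obj J" "x \<in> Obj (Und A)"
  shows "cmp (hcomp (Und A) (Und F) (nid E (Und F) (pt j)) \<alpha>) x = co (cmp \<alpha> x) j"
  using cmp_hcomp_nid_left[OF assms(1) is_functor_pt[OF assms(2)] assms(3)]
    natural_rules(1)[OF assms(1,3)] by simp

text \<open>The ends are recovered from the source and target cones by \<open>cone_mor_inj\<close>,
  the transformation from its values at all \<open>j\<close>.\<close>

lemma cone_cell_inj:
  assumes c: "pseudo_cell T A PA G H \<alpha>" and c': "pseudo_cell T A PA G' H' \<alpha>'"
    and eq: "cone_cell (G, H, \<alpha>) = cone_cell (G', H', \<alpha>')"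
  shows "(G, H, \<alpha>) = (G', H', \<alpha>')"
proof -
  have m: "pseudo_morphism T A PA G" "pseudo_morphism T A PA H" "pseudo_morphism T A PA G'"
    "pseudo_morphism T A PA H'" and n: "is_natural (Und A) E \<alpha>" "is_natural (Und A) E \<alpha>'"
    and st: "src \<alpha> = fn G" "tgt \<alpha> = fn H" "src \<alpha>' = fn G'" "tgt \<alpha>' = fn H'"
    using c c' by (simp_all add: pseudo_cell_def)
  have e: "cone_mor G = cone_mor G'" "cone_mor H = cone_mor H'"
    using arg_cong[OF eq, of src] arg_cong[OF eq, of tgt] by (simp_all add: cone_cell_def)
  have GH: "G = G'" "H = H'"
    using cone_mor_inj[OF m(1,3) e(1)] cone_mor_inj[OF m(2,4) e(2)] .
  have ej: "hcomp (Und A) (Und F) (nid E (Und F) (pt j)) \<alpha> = hcomp (Und A) (Und F) (nid E (Und F) (pt j)) \<alpha>'"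
    if "j \<in> Obj J" for j
    using arg_cong[OF eq, of "\<lambda>t. cmp t j"] that by (simp add: cone_cell_def)
  have "\<alpha> = \<alpha>'"
  proof (rule natural_E_eqI[OF n])
    fix x j assume x: "x \<in> Obj (Und A)" and j: "j \<in> Obj J"
    show "co (cmp \<alpha> x) j = co (cmp \<alpha>' x) j"
      using cmp_pt_cell[OF n(1) j x] cmp_pt_cell[OF n(2) j x] ej[OF j] by simp
  qed (simp_all add: st GH)
  then show ?thesis using GH by simp
qed

text \<open>The ends come from surjectivity on morphisms. The third entries of the components of
  \<tau> are assembled into a transformation into \<open>E\<close>, and the cell condition is then
  tested at each \<open>j\<close>.\<close>

lemma cone_cell_surj:
  assumes \<tau>: "is_natural J (psalg_hom T A F) \<tau>"
  shows "\<exists>G H \<alpha>. pseudo_cell T A PA G H \<alpha> \<and> cone_cell (G, H, \<alpha>) = \<tau>"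
proof -
  let ?X = "Und A" and ?Y = "Und F"
  note [simp] = cat_rules[OF J] cat_rules[OF A.Und] cat_rules[OF E]
  obtain G where G: "pseudo_morphism T A PA G" and sG: "cone_mor G = src \<tau>"
    using cone_mor_surj[OF natural_src[OF \<tau>]] by blast
  obtain H where H: "pseudo_morphism T A PA H" and tH: "cone_mor H = tgt \<tau>"
    using cone_mor_surj[OF natural_tgt[OF \<tau>]] by blast
  note pG = pseudo_morphism_premorphism_PA[OF G] and pH = pseudo_morphism_premorphism_PA[OF H]
  note fG = fn_functor[OF G] and fH = fn_functor[OF H]
  interpret G: premorphism T A PA G by (rule pG)
  interpret H: premorphism T A PA H by (rule pH)
  define \<theta> where "\<theta> j = snd (snd (cmp \<tau> j))" for j
  let ?G = "\<lambda>j. psmor_comp T A PA F (eps j) G" and ?H = "\<lambda>j. psmor_comp T A PA F (eps j) H"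
  have \<tau>j: "cmp \<tau> j = (?G j, ?H j, \<theta> j)" and cell: "pseudo_cell T A F (?G j) (?H j) (\<theta> j)"
    if j: "j \<in> Obj J" for j
  proof -
    obtain a b c where abc: "cmp \<tau> j = (a, b, c)" by (cases "cmp \<tau> j")
    have "on_ob (src \<tau>) j = ?G j" "on_ob (tgt \<tau>) j = ?H j"
      using j unfolding sG[symmetric] tH[symmetric] by (simp_all add: cone_mor_def)
    then show e: "cmp \<tau> j = (?G j, ?H j, \<theta> j)"
      using natural_rules(2,3)[OF \<tau> j] by (simp add: abc \<theta>_def)
    show "pseudo_cell T A F (?G j) (?H j) (\<theta> j)"
      using natural_rules(1)[OF \<tau> j] unfolding e by simp
  qed
  note cellD = cell[unfolded pseudo_cell_iff[OF lawvere A_alg F_alg]]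
  have n\<theta>: "is_natural ?X ?Y (\<theta> j)" "src (\<theta> j) = fcomp ?X (pt j) (fn G)" "tgt (\<theta> j) = fcomp ?X (pt j) (fn H)"
    if "j \<in> Obj J" for j
    using cellD[OF that] eps_comp(1)[OF pG that] eps_comp(1)[OF pH that] by simp_all
  note [simp] = functor_rules[OF fG] functor_rules[OF fH]
  define \<alpha> where "\<alpha> = lift_ntr ?X (fn G) (fn H) (\<lambda>j. cmp (\<theta> j))"
  \<comment> \<open>Naturality of \<tau> at \<open>u\<close> is an equation of triples; its last
    entry, at the object \<open>x\<close>, is the square needed for an arrow of
    \<open>E\<close>.\<close>
  have natJ: "Comp ?Y (cmp (\<theta> (Cod J u)) x) (mo (on_ob (fn G) x) u) =
      Comp ?Y (mo (on_ob (fn H) x) u) (cmp (\<theta> (Dom J u)) x)" if u: "u \<in> Arr J" and x: "x \<in> Obj ?X" for u x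
  proof -
    have "vcomp ?X ?Y (\<theta> (Cod J u)) (hcomp ?X ?Y (tr u) (nid ?X E (fn G))) =
        vcomp ?X ?Y (hcomp ?X ?Y (tr u) (nid ?X E (fn H))) (\<theta> (Dom J u))"
      using naturality[OF \<tau> u] u
      by (simp add: sG[symmetric] tH[symmetric] \<tau>j) (simp add: cone_mor_def)
    then have "cmp (vcomp ?X ?Y (\<theta> (Cod J u)) (hcomp ?X ?Y (tr u) (nid ?X E (fn G)))) x =
        cmp (vcomp ?X ?Y (hcomp ?X ?Y (tr u) (nid ?X E (fn H))) (\<theta> (Dom J u))) x"
      by (rule arg_cong)
    then show ?thesis
      unfolding vcomp_sel(3)[OF x] cmp_tr_fn[OF fG u x] cmp_tr_fn[OF fH u x] .
  qed
  have natA: "Comp ?Y (cmp (\<theta> j) (Cod ?X f)) (co (on_ar (fn G) f) j) =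
      Comp ?Y (co (on_ar (fn H) f) j) (cmp (\<theta> j) (Dom ?X f))" if "j \<in> Obj J" "f \<in> Arr ?X" for j f
    using naturality[OF n\<theta>(1)[OF that(1)] that(2)] that by (simp add: n\<theta>)
  have t: "cmp (\<theta> j) x \<in> Arr ?Y" "Dom ?Y (cmp (\<theta> j) x) = ob (on_ob (fn G) x) j"
    "Cod ?Y (cmp (\<theta> j) x) = ob (on_ob (fn H) x) j" if "j \<in> Obj J" "x \<in> Obj ?X" for j x
    using natural_rules[OF n\<theta>(1)[OF that(1)] that(2)] that by (simp_all add: n\<theta>)
  have \<alpha>: "is_natural ?X E \<alpha>" "\<lbrakk>x \<in> Obj ?X; j \<in> Obj J\<rbrakk> \<Longrightarrow> co (cmp \<alpha> x) j = cmp (\<theta> j) x"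
    "src \<alpha> = fn G" "tgt \<alpha> = fn H" for x j
    unfolding \<alpha>_def by (rule lift_ntr[OF fG fH t natJ natA]; assumption)+ simp_all
  have "pseudo_cell T A PA G H \<alpha>"
    unfolding pseudo_cell_iff[OF lawvere A_alg pseudo_algebra_PA]
  proof (intro conjI ballI G H \<alpha>(3,4))
    show "is_natural ?X (Und PA) \<alpha>" using \<alpha>(1) by simp
    fix w xs assume w: "w \<in> words T" and xs: "xs \<in> Obj (Pw (arity T w) A)"
    let ?\<phi> = "on_ob (Phi A w) xs" and ?a = "map (cmp \<alpha>) xs"
    have \<phi>: "?\<phi> \<in> Obj ?X" by (rule functor_rules(1)[OF A.Phi[OF w] xs])
    note rG = G.rho_rules[OF w xs, unfolded PA_sel(1,2)] and rH = H.rho_rules[OF w xs, unfolded PA_sel(1,2)]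
    note a\<phi> = natural_rules[OF \<alpha>(1) \<phi>, unfolded \<alpha>(3,4)]
    have a: "?a \<in> Arr (pow (arity T w) E)" "Dom (pow (arity T w) E) ?a = map (on_ob (fn G)) xs"
      "Cod (pow (arity T w) E) ?a = map (on_ob (fn H)) xs"
      using xs by (auto simp: pow_sel \<alpha>(3,4) natural_rules[OF \<alpha>(1)] subset_iff)
    note La = functor_rules(2-4)[OF Lf(1)[OF F.Phi[OF w]] a(1), unfolded a(2,3)]
    note cl = cat_rules(6-8)[OF E a\<phi>(1) rH(1) trans[OF rH(2) a\<phi>(3)[symmetric]]]
      and cr = cat_rules(6-8)[OF E rG(1) La(1) trans[OF La(2) rG(3)[symmetric]]]
    have "Comp E (cmp (rho H w) xs) (cmp \<alpha> ?\<phi>) =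
        Comp E (on_ar (Lf (arity T w) (Phi F w)) ?a) (cmp (rho G w) xs)" (is "?l = ?r")
    proof (rule Arr_eqI)
      show "?l \<in> Arr E" "?r \<in> Arr E" by (rule cl cr)+
      show "Dom E ?l = Dom E ?r" "Cod E ?l = Cod E ?r"
        unfolding cl cr a\<phi>(2) rG(2) rH(3) La(3) by (rule refl)+
      fix j assume j: "j \<in> Obj J"
      have m: "map (\<lambda>a. co a j) ?a = map (cmp (\<theta> j)) xs"
        using xs j by (auto simp: pow_sel \<alpha>(2) subset_iff)
      \<comment> \<open>The cell condition of \<open>\<theta> j\<close>; by \<open>eps_comp\<close>
        the \<open>rho\<close> in it are the values at \<open>j\<close> of those of \<open>G\<close>
        and \<open>H\<close>.\<close>
      have "Comp ?Y (cmp (rho (?H j) w) xs) (cmp (\<theta> j) ?\<phi>) =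
          Comp ?Y (on_ar (Phi F w) (map (cmp (\<theta> j)) xs)) (cmp (rho (?G j) w) xs)"
        using cellD[OF j] w xs by blast
      then show "co ?l j = co ?r j"
        unfolding co_Comp[OF a\<phi>(1) rH(1) trans[OF rH(2) a\<phi>(3)[symmetric]] j]
          co_Comp[OF rG(1) La(1) trans[OF La(2) rG(3)[symmetric]] j] \<alpha>(2)[OF \<phi> j]
          Lf(4)[OF F.Phi[OF w] a(1) j] m eps_comp(2)[OF pG j w xs] eps_comp(2)[OF pH j w xs] .
    qed
    then show "Comp (Und PA) (cmp (rho H w) xs) (cmp \<alpha> ?\<phi>) =
        Comp (Und PA) (on_ar (Phi PA w) ?a) (cmp (rho G w) xs)"
      by (simp only: PA_sel)
  qed
  moreover have "cone_cell (G, H, \<alpha>) = \<tau>"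
  proof (rule ntr_eqI[of _ _ "Obj J"])
    fix j assume j: "j \<in> Obj J"
    have "hcomp ?X ?Y (nid E ?Y (pt j)) \<alpha> = \<theta> j"
    proof (rule natural_eqI[OF is_natural_hcomp[OF \<alpha>(1) is_natural_nid[OF is_functor_pt[OF j]]] n\<theta>(1)[OF j]])
      fix x assume x: "x \<in> Obj ?X"
      show "cmp (hcomp ?X ?Y (nid E ?Y (pt j)) \<alpha>) x = cmp (\<theta> j) x"
        unfolding cmp_pt_cell[OF \<alpha>(1) j x] by (rule \<alpha>(2)[OF x j])
    qed (simp_all add: \<alpha>(3,4) n\<theta> j)
    then show "cmp (cone_cell (G, H, \<alpha>)) j = cmp \<tau> j"
      using j by (simp add: cone_cell_def \<tau>j)
  qed (simp_all add: cone_cell_def sG tH natural_ext[OF \<tau>])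
  ultimately show ?thesis by blast
qed

end

section \<open>The cotensor product in the 2-category of small pseudo algebras\<close>

theorem lemma8p11:
  fixes elts :: "'u \<Rightarrow> 'u set"
    and T :: "'t lawvere"
    and J :: "('u, 'u) cat"
    and F :: "('t, 'u, 'u) psalg"
  assumes "universe elts"
    and "lawvere_theory T"
    and "small_category elts J"
    and "F \<in> Ob (PsAlg elts T)"
  shows "\<exists>P. is_cotensor (PsAlg elts T) J F P"
proof -
  let ?C = "PsAlg elts T"
  have F: "pseudo_algebra T F" "small_category elts (Und F)" and J: "category J"
    using assms(3,4) by (auto simp: small_category_def)
  \<comment> \<open>The functor category coded inside the universe; the smallness of
    \<open>E\<close> is what makes \<open>PA\<close> an object of the 2-category.\<close>
  obtain E enc where sE: "small_category elts E" and "iso_of_categories (fun_cat J (Und F)) E enc"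
    using universe.functor_category_small[OF assms(1,3) F(2)] .
  then obtain ev where "is_functor (fun_cat J (Und F)) E enc" "is_functor E (fun_cat J (Und F)) ev"
    "fcomp (fun_cat J (Und F)) ev enc = fid (fun_cat J (Und F))" "fcomp E enc ev = fid E"
    by (auto simp: iso_of_categories_def)
  then interpret power_algebra T F J E enc ev
    using F J assms(2)
    by (intro power_algebra.intro power_category.intro) (auto simp: small_category_def)
  have PA: "PA \<in> Ob ?C" using pseudo_algebra_PA sE by simp
  interpret evaluation_cone ?C J F PA Eps
    using two_category_PsAlg[OF assms(2)] assms(4) PA is_functor_Eps
    by (intro evaluation_cone.intro evaluation_cone_axioms.intro) simp_all
  have "is_cotensor ?C J F PA"
  proof (rule is_cotensor_of_cone)
    fix A assume A: "A \<in> Ob ?C"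
    then interpret power_algebra_cone T F J E enc ev A
      by (intro power_algebra_cone.intro power_algebra_axioms) simp
    \<comment> \<open>The cone formed in the 2-category and the one formed directly from morphisms
      agree on \<open>J\<close>, and both are extensional.\<close>
    have ob: "cone_ob A H = cone_mor H" if "pseudo_morphism T A PA H" for H
      using functor_ext_ob[OF is_functor_cone_ob[OF A]] functor_ext_ar[OF is_functor_cone_ob[OF A]] that
      by (intro ftr_eqI[of _ "Obj J" _ "Arr J"]) (simp_all add: cone_mor_def)
    have ar: "cone_ar A (G, H, \<alpha>) = cone_cell (G, H, \<alpha>)" if "pseudo_cell T A PA G H \<alpha>" for G H \<alpha>
    proof (rule ntr_eqI[of _ _ "Obj J"])
      have "pseudo_morphism T A PA G" "pseudo_morphism T A PA H"
        using that by (simp_all add: pseudo_cell_def)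
      then show "src (cone_ar A (G, H, \<alpha>)) = src (cone_cell (G, H, \<alpha>))"
        "tgt (cone_ar A (G, H, \<alpha>)) = tgt (cone_cell (G, H, \<alpha>))"
        by (simp_all add: ob cone_cell_def)
    qed (simp_all add: cone_cell_def)
    show "bij_betw (cone_ob A) (Obj (HomCat ?C A PA)) {K. is_functor J (HomCat ?C A F) K}"
      unfolding bij_betw_def
    proof (intro conjI inj_onI equalityI subsetI)
      fix H H' assume "H \<in> Obj (HomCat ?C A PA)" "H' \<in> Obj (HomCat ?C A PA)" "cone_ob A H = cone_ob A H'"
      then show "H = H'" using cone_mor_inj[of H H'] by (simp add: ob)
    next
      fix K assume "K \<in> cone_ob A ` Obj (HomCat ?C A PA)"
      then show "K \<in> {K. is_functor J (HomCat ?C A F) K}" using is_functor_cone_ob[OF A] by auto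
    next
      fix K assume "K \<in> {K. is_functor J (HomCat ?C A F) K}"
      then obtain H where "pseudo_morphism T A PA H" "cone_mor H = K"
        using cone_mor_surj[of K] by auto
      then show "K \<in> cone_ob A ` Obj (HomCat ?C A PA)" using ob[of H] by force
    qed
    show "bij_betw (cone_ar A) (Arr (HomCat ?C A PA)) {\<tau>. is_natural J (HomCat ?C A F) \<tau>}"
      unfolding bij_betw_def
    proof (intro conjI inj_onI equalityI subsetI)
      fix c c' assume c: "c \<in> Arr (HomCat ?C A PA)" "c' \<in> Arr (HomCat ?C A PA)" "cone_ar A c = cone_ar A c'"
      obtain G H \<alpha> G' H' \<alpha>' where e: "c = (G, H, \<alpha>)" "c' = (G', H', \<alpha>')" by (metis surj_pair)
      show "c = c'"
        using c cone_cell_inj[of G H \<alpha> G' H' \<alpha>'] unfolding e by (simp add: ar)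
    next
      fix \<tau> assume "\<tau> \<in> cone_ar A ` Arr (HomCat ?C A PA)"
      then show "\<tau> \<in> {\<tau>. is_natural J (HomCat ?C A F) \<tau>}" using is_natural_cone_ar[OF A] by auto
    next
      fix \<tau> assume "\<tau> \<in> {\<tau>. is_natural J (HomCat ?C A F) \<tau>}"
      then obtain G H \<alpha> where c: "pseudo_cell T A PA G H \<alpha>" and "cone_cell (G, H, \<alpha>) = \<tau>"
        using cone_cell_surj[of \<tau>] by auto
      then have "\<tau> = cone_ar A (G, H, \<alpha>)" using ar[OF c] by simp
      moreover have "(G, H, \<alpha>) \<in> Arr (HomCat ?C A PA)" using c by simp
      ultimately show "\<tau> \<in> cone_ar A ` Arr (HomCat ?C A PA)" by (rule image_eqI)
    qed
  qed
  then show ?thesis ..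
qed

end
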